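(* Let $\mathcal{I}$ and $\mathcal{J}$ be non-orthogonal ideals on $\omega$. Suppose that $\mathcal{I}$ is coanalytic. (1) $(\mathcal{I},\mathcal{J})$ is of the first q-type if and only if $(\mathcal{I},\mathcal{J})(QC(X))=PWD_0(X)$ for every metric Baire space $X$. (2) $(\mathcal{I},\mathcal{J})$ is of the second q-type if and only if $(\mathcal{I},\mathcal{J})(QC(X))=PWD(X)$ for every metric Baire space $X$. (3) $(\mathcal{I},\mathcal{J})$ is of the third q-type if and only if $\mathrm{Baire}(X)\subseteq(\mathcal{I},\mathcal{J})(QC(X))$ for every metric Baire space $X$. Moreover, if $(\mathcal{I},\mathcal{J})$ is of the third q-type and $\mathcal{I}$ is Borel, then $\mathrm{Baire}(X)=(\mathcal{I},\mathcal{J})(QC(X))$ for every metric Baire space $X$.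
   Context: An ideal on a countable set $S$ is a family $\mathcal{I}\subseteq\mathcal{P}(S)$ closed under finite unions and subsets and containing all finite subsets of $S$ (it is not required to be proper). $\mathcal{I}^+=\{A\subseteq S: A\notin\mathcal{I}\}$ and $\mathcal{I}^*=\{A\subseteq S: S\setminus A\in\mathcal{I}\}$. Borel/coanalytic refers to $\mathcal{I}$ as a subset of $\mathcal{P}(\omega)\cong 2^\omega$ with the product topology. Ideals $\mathcal{I},\mathcal{J}$ on $\omega$ are orthogonal if there are $A\in\mathcal{I}$, $B\in\mathcal{J}$ with $A\cup B=\omega$. Equal convergence: a sequence of reals $(\varepsilon_n)_{n\in\omega}$ is $\mathcal{J}$-convergent to $0$ if $\{n:|\varepsilon_n|\ge\varepsilon\}\in\mathcal{J}$ for every $\varepsilon>0$. A sequence $(f_n)_{n\in\omega}\subseteq\mathbb{R}^X$ is $(\mathcal{I},\mathcal{J})$-equal convergent to $f\in\mathbb{R}^X$ if there is a sequence $(\varepsilon_n)_{n\in\omega}$ of positive reals, $\mathcal{J}$-convergent to $0$, with $\{n\in\omega: |f_n(x)-f(x)|\ge\varepsilon_n\}\in\mathcal{I}$ for each $x\in X$. For $\mathcal{F}\subseteq\mathbb{R}^X$, $(\mathcal{I},\mathcal{J})(\mathcal{F})$ is the family of all $f\in\mathbb{R}^X$ that are $(\mathcal{I},\mathcal{J})$-equal limits of sequences of functions from $\mathcal{F}$. For $A\subseteq\omega$ and $(A_n)_{n\in\omega}\subseteq\mathcal{P}(\omega)$: $\mathcal{I}\sqcup A=\{M\cup N: M\in\mathcal{I},\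 N\subseteq A\}$ and $\mathcal{I}\sqcup(A_n)_{n\in\omega}=\{M\cup N: M\in\mathcal{I},\ \exists n\in\omega\ N\subseteq\bigcup_{i<n}A_i\}$. An ideal $\mathcal{I}$ is $\omega$-$+$-diagonalizable if there is a countable family $(X_n)_{n\in\omega}\subseteq\mathcal{I}^+$ such that for each $Y\in\mathcal{I}^*$ there is $n$ with $X_n\subseteq Y$. An ideal $\mathcal{I}$ on $\omega$ is weakly Ramsey if for every coloring $f:[\omega]^2\to 2$ such that for each $x\in\omega$ either $\{y: f(\{x,y\})=0\}\in\mathcal{I}$ or $\{y: f(\{x,y\})=1\}\in\mathcal{I}$, there is $H\in\mathcal{I}^+$ with $f\upharpoonright[H]^2$ constant. q-types: $(\mathcal{I},\mathcal{J})$ is of the first q-type if for any sequence $(A_n)_{n\in\omega}$ of elements of $\mathcal{J}$ the ideal $\mathcal{I}\sqcup(A_n)_{n\in\omega}$ is $\omega$-$+$-diagonalizable; of the second q-type if there is a sequence $(A_n)_{n\in\omega}$ of elements of $\mathcal{J}$ such that $\mathcal{I}\sqcup(A_n)_{n\in\omega}$ is not weakly Ramsey, but for any $A\in\mathcal{J}$ the ideal $\mathcal{I}\sqcup A$ is $\omega$-$+$-diagonalizable; of the third q-type if there is $A\in\mathcal{J}$ such that $\mathcal{I}\sqcup A$ is not weakly Ramsey. Function classes: $f:X\to\mathbb{R}$ is quasi-continuous at $x_0$ if for every $\varepsilon>0$ and every open neighbourhood $U$ of $x_0$ there is a non-empty open $V\subseteq U$ with $|f(x)-f(x_0)|<\varepsilon$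 for all $x\in V$. $QC(X)$ is the class of functions $X\to\mathbb{R}$ quasi-continuous at every point. $PWD(X)$ is the class of pointwise discontinuous functions, i.e. $f:X\to\mathbb{R}$ whose set of continuity points is dense in $X$. $PWD_0(X)$ is the class of $f:X\to\mathbb{R}$ such that $X\setminus C_q(f)$ is nowhere dense, where $C_q(f)$ is the set of quasi-continuity points of $f$. $\mathrm{Baire}(X)$ is the class of all $f:X\to\mathbb{R}$ with the Baire property. *)

theory Defs
  imports "HOL-Analysis.Analysis" "HOL-Library.Ramsey"
begin

section \<open>Ideals on the natural numbers\<close>

definition ideal_on_nat :: "nat set set \<Rightarrow> bool" where
  "ideal_on_nat I \<longleftrightarrow>
     (\<forall>A\<in>I. \<forall>B\<in>I. A \<union> B \<in> I) \<and> (\<forall>A\<in>I. \<forall>B. B \<subseteq> A \<longrightarrow> B \<in> I) \<and> (\<forall>A. finite A \<longrightarrow> A \<in> I)"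

definition positive_sets :: "nat set set \<Rightarrow> nat set set" where
  "positive_sets I = {A. A \<notin> I}"

definition dual_filter :: "nat set set \<Rightarrow> nat set set" where
  "dual_filter I = {A. - A \<in> I}"

definition orthogonal_ideals :: "nat set set \<Rightarrow> nat set set \<Rightarrow> bool" where
  "orthogonal_ideals I J \<longleftrightarrow> (\<exists>A\<in>I. \<exists>B\<in>J. A \<union> B = UNIV)"

text \<open>A family of subsets of \<open>nat\<close> is identified with a set of characteristic functions in
  \<open>nat \<Rightarrow> bool\<close>, whose type class topology is the product of the discrete topologies on \<open>bool\<close>.\<close>

definition char_functions :: "nat set set \<Rightarrow> (nat \<Rightarrow> bool) set" where
  "char_functions I = (\<lambda>A n. n \<in> A) ` I"

definition borel_family :: "nat set set \<Rightarrow> bool" where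
  "borel_family I \<longleftrightarrow> char_functions I \<in> sets borel"

text \<open>Analytic sets are the continuous images of the Baire space \<open>nat \<Rightarrow> nat\<close> (product of discrete
  spaces), together with the empty set.\<close>

definition analytic_set :: "'a::topological_space set \<Rightarrow> bool" where
  "analytic_set S \<longleftrightarrow> S = {} \<or> (\<exists>g :: (nat \<Rightarrow> nat) \<Rightarrow> 'a. continuous_on UNIV g \<and> range g = S)"

definition coanalytic_family :: "nat set set \<Rightarrow> bool" where
  "coanalytic_family I \<longleftrightarrow> analytic_set (- char_functions I)"

definition ideal_join :: "nat set set \<Rightarrow> nat set \<Rightarrow> nat set set" where
  "ideal_join I A = {M \<union> N |M N. M \<in> I \<and> N \<subseteq> A}"

definition ideal_join_seq :: "nat set set \<Rightarrow> (nat \<Rightarrow> nat set) \<Rightarrow> nat set set" where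
  "ideal_join_seq I A = {M \<union> N |M N. M \<in> I \<and> (\<exists>n. N \<subseteq> (\<Union>i<n. A i))}"

definition omega_plus_diagonalizable :: "nat set set \<Rightarrow> bool" where
  "omega_plus_diagonalizable I \<longleftrightarrow>
     (\<exists>X :: nat \<Rightarrow> nat set. (\<forall>n. X n \<in> positive_sets I) \<and> (\<forall>Y\<in>dual_filter I. \<exists>n. X n \<subseteq> Y))"

text \<open>Colourings are functions on sets, of which only the values on two-element sets matter;
  hence the restriction to \<open>y \<noteq> x\<close>.\<close>

definition weakly_Ramsey :: "nat set set \<Rightarrow> bool" where
  "weakly_Ramsey I \<longleftrightarrow>
     (\<forall>f :: nat set \<Rightarrow> nat.
        f \<in> nsets UNIV 2 \<rightarrow> {0, 1} \<and>
        (\<forall>x. {y. y \<noteq> x \<and> f {x, y} = 0} \<in> I \<or> {y. y \<noteq> x \<and> f {x, y} = 1} \<in> I)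
        \<longrightarrow> (\<exists>H\<in>positive_sets I. \<exists>c. \<forall>e\<in>nsets H 2. f e = c))"

definition first_q_type :: "nat set set \<Rightarrow> nat set set \<Rightarrow> bool" where
  "first_q_type I J \<longleftrightarrow>
     (\<forall>A :: nat \<Rightarrow> nat set. (\<forall>n. A n \<in> J) \<longrightarrow> omega_plus_diagonalizable (ideal_join_seq I A))"

definition second_q_type :: "nat set set \<Rightarrow> nat set set \<Rightarrow> bool" where
  "second_q_type I J \<longleftrightarrow>
     (\<exists>A :: nat \<Rightarrow> nat set. (\<forall>n. A n \<in> J) \<and> \<not> weakly_Ramsey (ideal_join_seq I A)) \<and>
     (\<forall>A\<in>J. omega_plus_diagonalizable (ideal_join I A))"

definition third_q_type :: "nat set set \<Rightarrow> nat set set \<Rightarrow> bool" where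
  "third_q_type I J \<longleftrightarrow> (\<exists>A\<in>J. \<not> weakly_Ramsey (ideal_join I A))"

section \<open>Topological notions relative to a carrier\<close>

definition Baire_space :: "'a topology \<Rightarrow> bool" where
  "Baire_space X \<longleftrightarrow>
     (\<forall>G :: nat \<Rightarrow> 'a set.
        (\<forall>n. openin X (G n) \<and> X closure_of G n = topspace X)
        \<longrightarrow> X closure_of (\<Inter>n. G n) = topspace X)"

definition nowhere_dense_in :: "'a topology \<Rightarrow> 'a set \<Rightarrow> bool" where
  "nowhere_dense_in X S \<longleftrightarrow> S \<subseteq> topspace X \<and> X interior_of (X closure_of S) = {}"

definition meager_in :: "'a topology \<Rightarrow> 'a set \<Rightarrow> bool" where
  "meager_in X S \<longleftrightarrow> (\<exists>N :: nat \<Rightarrow> 'a set. (\<forall>n. nowhere_dense_in X (N n)) \<and> S = (\<Union>n. N n))"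

definition has_Baire_property :: "'a topology \<Rightarrow> 'a set \<Rightarrow> bool" where
  "has_Baire_property X S \<longleftrightarrow>
     S \<subseteq> topspace X \<and> (\<exists>U. openin X U \<and> meager_in X ((S - U) \<union> (U - S)))"

text \<open>A real function on the carrier of \<open>X\<close> is represented by any total function \<open>'a \<Rightarrow> real\<close>
  extending it. All function classes below, and the equal limits, depend only on the values on the
  carrier, so equality and inclusion of these classes mean the same as for functions on the
  carrier.\<close>

definition quasi_continuous_at :: "'a topology \<Rightarrow> ('a \<Rightarrow> real) \<Rightarrow> 'a \<Rightarrow> bool" where
  "quasi_continuous_at X f x0 \<longleftrightarrow>
     (\<forall>\<epsilon>>0. \<forall>U. openin X U \<and> x0 \<in> U
        \<longrightarrow> (\<exists>V. openin X V \<and> V \<noteq> {} \<and> V \<subseteq> U \<and> (\<forall>x\<in>V. \<bar>f x - f x0\<bar> < \<epsilon>)))"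

definition QC :: "'a topology \<Rightarrow> ('a \<Rightarrow> real) set" where
  "QC X = {f. \<forall>x\<in>topspace X. quasi_continuous_at X f x}"

definition PWD :: "'a topology \<Rightarrow> ('a \<Rightarrow> real) set" where
  "PWD X = {f. X closure_of {x \<in> topspace X. topcontinuous_at X euclideanreal f x} = topspace X}"

definition PWD0 :: "'a topology \<Rightarrow> ('a \<Rightarrow> real) set" where
  "PWD0 X = {f. nowhere_dense_in X (topspace X - {x \<in> topspace X. quasi_continuous_at X f x})}"

definition Baire_functions :: "'a topology \<Rightarrow> ('a \<Rightarrow> real) set" where
  "Baire_functions X = {f. \<forall>U. open U \<longrightarrow> has_Baire_property X {x \<in> topspace X. f x \<in> U}}"

section \<open>Equal convergence with respect to a pair of ideals\<close>

definition ideal_null_seq :: "nat set set \<Rightarrow> (nat \<Rightarrow> real) \<Rightarrow> bool" where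
  "ideal_null_seq J e \<longleftrightarrow> (\<forall>\<epsilon>>0. {n. \<bar>e n\<bar> \<ge> \<epsilon>} \<in> J)"

definition equal_convergent ::
  "nat set set \<Rightarrow> nat set set \<Rightarrow> 'a set \<Rightarrow> (nat \<Rightarrow> 'a \<Rightarrow> real) \<Rightarrow> ('a \<Rightarrow> real) \<Rightarrow> bool" where
  "equal_convergent I J S F f \<longleftrightarrow>
     (\<exists>e :: nat \<Rightarrow> real. (\<forall>n. e n > 0) \<and> ideal_null_seq J e \<and>
        (\<forall>x\<in>S. {n. \<bar>F n x - f x\<bar> \<ge> e n} \<in> I))"

definition equal_limits ::
  "nat set set \<Rightarrow> nat set set \<Rightarrow> 'a set \<Rightarrow> ('a \<Rightarrow> real) set \<Rightarrow> ('a \<Rightarrow> real) set" where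
  "equal_limits I J S \<F> = {f. \<exists>F. (\<forall>n. F n \<in> \<F>) \<and> equal_convergent I J S F f}"

abbreviation equal_limits_QC ::
  "nat set set \<Rightarrow> nat set set \<Rightarrow> 'a topology \<Rightarrow> ('a \<Rightarrow> real) set" where
  "equal_limits_QC I J X \<equiv> equal_limits I J (topspace X) (QC X)"

text \<open>``Every metric Baire space'' cannot be a quantification over all types inside a formula.
  The theorem using these notions is polymorphic in \<open>'a\<close> and quantifies over all metric spaces
  whose carrier is a subset of \<open>'a\<close>, so all metric spaces are covered by instantiating \<open>'a\<close>. Each
  characterization also lists the metric spaces on sets of reals: for a small type \<open>'a\<close>
  (e.g. \<open>unit\<close>) the spaces over \<open>'a\<close> alone do not determine the type of a pair of ideals.\<close>

end

(* For a coanalytic ideal, unfolding the game in which one player names sets of the ideal and the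
   other one answers with numbers outside of them shows that the ideal is omega-+-diagonalizable or
   not weakly Ramsey; hence every pair of ideals has one of the three q-types, and since PWD0, PWD
   and Baire differ on the real line (Thomae's and Dirichlet's functions), it suffices to compute the
   equal limits for each q-type.

   Upper bounds: diagonalizing sets Z i give a countable cover of X by the sets T i of those x for
   which F n x is close to f x for all n in Z i. By Baire category some T i is dense in an open set,
   and quasi-continuity of a single F n transfers the values of f from T i to all of that set.

   Lower bounds: f is continuous on the complement of an increasing union of closed nowhere dense
   sets D k. Near a closed nowhere dense set a quasi-continuous function may be changed on a locally
   finite family of tiny balls so as to take arbitrary values on that set. A colouring witnessing the
   failure of weak Ramseyness yields sets B n in the ideal such that a set containing no n < n' with
   n' in B n is in the ideal. So the patch W n of the n-th approximation is chosen disjoint from W k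
   for all k < n with n in B k: then the indices n for which W n contains a given x off the D k form
   a set in the ideal. *)
theory Submission
  imports Defs
begin

section \<open>A game that decides whether an ideal is diagonalizable\<close>

text \<open>Positivity for a coanalytic ideal is only analytic, so the plain game in which the
  second player tries to produce a positive set lies beyond the determinacy of Borel games. Making
  the second player spell out a witness lowers the payoff to G_delta. Countability of the
  diagonalizing family comes from there being countably many histories, each contributing countably
  many positive sets. The obstacle in the lower bounds is that weak Ramseyness fails for the join of
  \<open>I\<close> with sets \<open>A i\<close> of \<open>J\<close>. Avoidance therefore puts the
  indices of the patches through a point only into this larger ideal, while the error sets have to
  lie in \<open>I\<close>. Every index \<open>n\<close> is given a level \<open>\<kappa> n\<close>:
  indices in \<open>A i\<close> for some \<open>i < k\<close> have level below \<open>k\<close>,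
  almost all indices of level below \<open>k\<close> are of this kind, and patch \<open>n\<close>
  stays close to \<open>D (\<kappa> n)\<close>. A point off all \<open>D k\<close> then lies in
  finitely many patches of level below \<open>k\<close>, which removes the sets \<open>A i\<close>
  again.\<close>

text \<open>In round \<open>n\<close> the first player chooses \<open>\<sigma> h \<in> K\<close>, where \<open>h\<close> is the history, and the second
  player answers with a number outside of \<open>\<sigma> h\<close>, optionally together with one more entry of a
  witness for membership in an analytic set. The second player must announce infinitely many
  entries and keep all histories good. The payoff set being \<open>G\<^sub>\<delta>\<close>, the proof of determinacy follows
  Wolfe.\<close>

type_synonym history = "(nat \<times> nat option) list"

locale ideal_game =
  fixes K :: "nat set set" and good :: "history \<Rightarrow> bool"
begin

abbreviation prefix_of :: "(nat \<Rightarrow> nat \<times> nat option) \<Rightarrow> nat \<Rightarrow> history" where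
  "prefix_of p n \<equiv> map p [0..<n]"

definition wins_from :: "(history \<Rightarrow> nat set) \<Rightarrow> history \<Rightarrow> bool" where
  "wins_from \<sigma> h \<longleftrightarrow>
     (\<forall>p. prefix_of p (length h) = h \<longrightarrow> (\<forall>n\<ge>length h. fst (p n) \<notin> \<sigma> (prefix_of p n)) \<longrightarrow>
        (\<forall>n. good (prefix_of p n)) \<longrightarrow> finite {n. snd (p n) \<noteq> None})"

definition first_wins :: "history \<Rightarrow> bool" where
  "first_wins h \<longleftrightarrow> (\<exists>\<sigma>. range \<sigma> \<subseteq> K \<and> wins_from \<sigma> h)"

text \<open>Positions from which the second player can force one more announcement without entering
  a position won by the first player. When \<open>K\<close> is an ideal, no move in \<open>K\<close>
  covers \<open>E\<close>; being inductive, the predicate bounds the waiting time by a well-founded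
  rank.\<close>

inductive reach :: "history \<Rightarrow> bool" where
  step: "E \<notin> K \<Longrightarrow>
    (\<And>k. k \<in> E \<Longrightarrow> (\<exists>m. \<not> first_wins (h @ [(k, Some m)])) \<or> reach (h @ [(k, None)])) \<Longrightarrow> reach h"

text \<open>The answers that keep the second player's chances alive. If \<open>reach h\<close>
  fails, this set is itself a move available to the first player, and it blocks all of them.\<close>

definition escapes :: "history \<Rightarrow> nat set" where
  "escapes h = {k. (\<exists>m. \<not> first_wins (h @ [(k, Some m)])) \<or> reach (h @ [(k, None)])}"

lemma escapes_mem: "\<not> reach h \<Longrightarrow> escapes h \<in> K"
  using step[of "escapes h" h] unfolding escapes_def by blast

lemma take_prefix_of: "m \<le> n \<Longrightarrow> take m (prefix_of p n) = prefix_of p m"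
  by (simp add: take_map)

text \<open>If \<open>reach h\<close> fails, playing \<open>escapes\<close> keeps all later
  histories outside \<open>reach\<close> as long as nothing is announced, and an announcement can
  only lead to a position won by the first player. Switching at that moment to a winning strategy
  for that position wins from \<open>h\<close>.\<close>

lemma not_first_wins_imp_reach:
  assumes "{} \<in> K" "\<not> first_wins h"
  shows "reach h"
proof (rule ccontr)
  assume nr: "\<not> reach h"
  define \<tau> where "\<tau> q = (SOME \<sigma>. range \<sigma> \<subseteq> K \<and> wins_from \<sigma> q)" for q
  have \<tau>: "range (\<tau> q) \<subseteq> K \<and> wins_from (\<tau> q) q" if "first_wins q" for q
    using someI_ex[OF that[unfolded first_wins_def]] unfolding \<tau>_def .
  define ann where "ann q = {i. length h \<le> i \<and> i < length q \<and> snd (q ! i) \<noteq> None}" for q :: history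
  \<comment> \<open>A strategy sees only the history, so the moment of switching is read off from
    it: \<open>start q\<close> ends with the first announcement made after \<open>h\<close>.\<close>
  define start where "start q = take (Suc (Min (ann q))) q" for q
  define \<sigma> where "\<sigma> q = (if ann q = {} then (if reach q then {} else escapes q)
      else if first_wins (start q) then \<tau> (start q) q else {})" for q
  have "range \<sigma> \<subseteq> K"
    using assms(1) \<tau> escapes_mem by (auto simp: \<sigma>_def)
  moreover have "wins_from \<sigma> h"
    unfolding wins_from_def
  proof (intro allI impI)
    fix p
    assume ph: "prefix_of p (length h) = h"
      and legal: "\<forall>n\<ge>length h. fst (p n) \<notin> \<sigma> (prefix_of p n)"
      and good: "\<forall>n. good (prefix_of p n)"
    show "finite {n. snd (p n) \<noteq> None}"
    proof (cases "\<exists>n\<ge>length h. snd (p n) \<noteq> None")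
      case False
      then have "{n. snd (p n) \<noteq> None} \<subseteq> {..<length h}" using False not_less by blast
      then show ?thesis using finite_subset by blast
    next
      case True
      define N where "N = (LEAST n. length h \<le> n \<and> snd (p n) \<noteq> None)"
      have N: "length h \<le> N" "snd (p N) \<noteq> None"
        using True LeastI_ex[of "\<lambda>n. length h \<le> n \<and> snd (p n) \<noteq> None"] unfolding N_def by auto
      have N_least: "snd (p i) = None" if "length h \<le> i" "i < N" for i
        using not_less_Least[of i "\<lambda>n. length h \<le> n \<and> snd (p n) \<noteq> None"] that unfolding N_def by auto
      have ann_empty: "ann (prefix_of p n) = {}" if "n \<le> N" for n
        using N_least that by (force simp: ann_def)
      have nreach: "\<not> reach (prefix_of p n)" if "length h \<le> n" "n \<le> N" for n
        using that
      proof (induction n rule: dec_induct)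
        case base
        then show ?case using ph nr by simp
      next
        case (step n)
        then have "fst (p n) \<notin> escapes (prefix_of p n)"
          using legal[rule_format, of n] ann_empty[of n] by (auto simp: \<sigma>_def)
        moreover obtain k where "p n = (k, None)"
          using N_least[of n] step by (cases "p n") auto
        ultimately show ?case by (simp add: escapes_def)
      qed
      define q where "q = prefix_of p (Suc N)"
      have lenq: "length q = Suc N" by (simp add: q_def)
      have "fst (p N) \<notin> escapes (prefix_of p N)"
        using legal[rule_format, of N] ann_empty[of N] nreach[of N] N by (auto simp: \<sigma>_def)
      moreover obtain k m where "p N = (k, Some m)"
        using N by (cases "p N") auto
      ultimately have fw: "first_wins q"
        by (simp add: q_def escapes_def)
      have start: "start (prefix_of p n) = q" if "Suc N \<le> n" for n
      proof -
        have "Min (ann (prefix_of p n)) = N"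
        proof (rule Min_eqI)
          show "finite (ann (prefix_of p n))" by (rule finite_subset[of _ "{..<n}"]) (auto simp: ann_def)
          show "N \<in> ann (prefix_of p n)" using N that by (auto simp: ann_def)
          show "N \<le> y" if "y \<in> ann (prefix_of p n)" for y
            using that N_least[of y] by (force simp: ann_def)
        qed
        then show ?thesis using take_prefix_of[OF that] by (simp add: start_def q_def)
      qed
      have "fst (p n) \<notin> \<tau> q (prefix_of p n)" if "Suc N \<le> n" for n
      proof -
        have "N \<in> ann (prefix_of p n)" using N that by (auto simp: ann_def)
        then have "ann (prefix_of p n) \<noteq> {}" by auto
        then have "\<sigma> (prefix_of p n) = \<tau> q (prefix_of p n)"
          using start[OF that] fw by (simp add: \<sigma>_def)
        then show ?thesis using legal[rule_format, of n] N that by auto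
      qed
      moreover have "prefix_of p (length q) = q" by (simp add: q_def)
      ultimately show ?thesis
        using \<tau>[OF fw] good unfolding wins_from_def lenq by blast
    qed
  qed
  ultimately show False using assms(2) by (auto simp: first_wins_def)
qed

text \<open>The sets \<open>E\<close> used in the derivation of \<open>reach h\<close> form a
  countable family, because branching is over natural numbers. If \<open>Y\<close> contains none of
  them, an answer outside \<open>Y\<close> exists at every node, and the descent ends in an
  announcement by well-foundedness.\<close>

lemma reach_countable_family:
  assumes "reach h"
  shows "\<exists>\<E>. countable \<E> \<and> \<E> \<inter> K = {} \<and>
    (\<forall>Y. (\<forall>E\<in>\<E>. \<not> E \<subseteq> Y) \<longrightarrow>
       (\<exists>u. (\<exists>i<length u. snd (u ! i) \<noteq> None) \<and> fst ` set u \<inter> Y = {} \<and> \<not> first_wins (h @ u)))"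
  using assms
proof (induction rule: reach.induct)
  case (step E h)
  define Q where "Q k \<E> \<longleftrightarrow> countable \<E> \<and> \<E> \<inter> K = {} \<and>
    (\<forall>Y. (\<forall>E\<in>\<E>. \<not> E \<subseteq> Y) \<longrightarrow>
       (\<exists>u. (\<exists>i<length u. snd (u ! i) \<noteq> None) \<and> fst ` set u \<inter> Y = {} \<and> \<not> first_wins ((h @ [(k, None)]) @ u)))"
    for k \<E>
  \<comment> \<open>Only answers in \<open>E0\<close> have to be continued recursively; every other
    \<open>k \<in> E\<close> allows an announcement at once.\<close>
  define E0 where "E0 = {k \<in> E. \<nexists>m. \<not> first_wins (h @ [(k, Some m)])}"
  have "\<exists>\<E>. Q k \<E>" if k: "k \<in> E0" for k
  proof -
    have "k \<in> E" using k by (simp add: E0_def)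
    then show ?thesis
      unfolding Q_def
      by (rule disjE[OF step(2)]) (use k in \<open>simp add: E0_def\<close>, elim conjE)
  qed
  then have "\<forall>k\<in>E0. \<exists>\<E>. Q k \<E>" ..
  from bchoice[OF this] obtain F where F: "\<And>k. k \<in> E0 \<Longrightarrow> Q k (F k)" by auto
  let ?\<E> = "insert E (\<Union>k\<in>E0. F k)"
  have "countable ?\<E>" using F by (auto simp: Q_def)
  moreover have "?\<E> \<inter> K = {}" using F step(1) by (auto simp: Q_def)
  moreover have "\<exists>u. (\<exists>i<length u. snd (u ! i) \<noteq> None) \<and> fst ` set u \<inter> Y = {} \<and> \<not> first_wins (h @ u)"
    if Y: "\<forall>E\<in>?\<E>. \<not> E \<subseteq> Y" for Y
  proof -
    obtain k where k: "k \<in> E" "k \<notin> Y" using Y by auto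
    show ?thesis
    proof (cases "k \<in> E0")
      case False
      then obtain m where "\<not> first_wins (h @ [(k, Some m)])" using k by (auto simp: E0_def)
      then show ?thesis using k by (intro exI[of _ "[(k, Some m)]"]) auto
    next
      case True
      then obtain u where u: "\<exists>i<length u. snd (u ! i) \<noteq> None" "fst ` set u \<inter> Y = {}"
        "\<not> first_wins ((h @ [(k, None)]) @ u)"
        using F[OF True, unfolded Q_def, THEN conjunct2, THEN conjunct2, rule_format, of Y] Y True by auto
      have "\<exists>i<length ((k, None) # u). snd (((k, None) # u) ! i) \<noteq> None"
        using u(1) by (metis Suc_less_eq length_Cons nth_Cons_Suc)
      then show ?thesis using u k by (intro exI[of _ "(k, None) # u"]) auto
    qed
  qed
  ultimately show ?case by blast
qed

text \<open>From a history with a bad prefix any strategy wins vacuously, since no play through it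
  keeps all prefixes good.\<close>

lemma not_first_wins_good:
  assumes "{} \<in> K" "\<not> first_wins h" "n \<le> length h"
  shows "good (take n h)"
proof (rule ccontr)
  assume bad: "\<not> good (take n h)"
  have "wins_from (\<lambda>_. {}) h"
    unfolding wins_from_def
  proof (intro allI impI)
    fix p assume "prefix_of p (length h) = h" "\<forall>n. good (prefix_of p n)"
    then show "finite {n. snd (p n) \<noteq> None}"
      using bad take_prefix_of[OF assms(3)] by metis
  qed
  then show False using assms(1,2) by (auto simp: first_wins_def)
qed

text \<open>There are countably many histories, so the families of all positions not won by the
  first player can be united. For \<open>Y\<close> containing no member, finite extensions from such
  positions to such positions concatenate to an infinite play, each contributing an
  announcement.\<close>

lemma second_wins:
  assumes "{} \<in> K" "\<not> first_wins []"
  shows "\<exists>\<E>. countable \<E> \<and> \<E> \<inter> K = {} \<and>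
    (\<forall>Y. (\<forall>E\<in>\<E>. \<not> E \<subseteq> Y) \<longrightarrow>
       (\<exists>p. (\<forall>n. fst (p n) \<notin> Y) \<and> (\<forall>n. good (prefix_of p n)) \<and> infinite {n. snd (p n) \<noteq> None}))"
proof -
  define Q where "Q h \<E> \<longleftrightarrow> countable \<E> \<and> \<E> \<inter> K = {} \<and>
    (\<forall>Y. (\<forall>E\<in>\<E>. \<not> E \<subseteq> Y) \<longrightarrow>
       (\<exists>u. (\<exists>i<length u. snd (u ! i) \<noteq> None) \<and> fst ` set u \<inter> Y = {} \<and> \<not> first_wins (h @ u)))" for h \<E>
  have "\<exists>\<E>. Q h \<E>" if "\<not> first_wins h" for h
    unfolding Q_def by (rule reach_countable_family[OF not_first_wins_imp_reach[OF assms(1) that]])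
  then have "\<forall>h\<in>{h. \<not> first_wins h}. \<exists>\<E>. Q h \<E>" by simp
  from bchoice[OF this] obtain F where F: "\<And>h. \<not> first_wins h \<Longrightarrow> Q h (F h)" by auto
  let ?\<E> = "\<Union>h\<in>{h. \<not> first_wins h}. F h"
  have "countable ?\<E>" using F by (auto simp: Q_def)
  moreover have "?\<E> \<inter> K = {}" using F by (auto simp: Q_def)
  moreover have "\<exists>p. (\<forall>n. fst (p n) \<notin> Y) \<and> (\<forall>n. good (prefix_of p n)) \<and> infinite {n. snd (p n) \<noteq> None}"
    if Y: "\<forall>E\<in>?\<E>. \<not> E \<subseteq> Y" for Y
  proof -
    have ex: "\<exists>u. (\<exists>i<length u. snd (u ! i) \<noteq> None) \<and> fst ` set u \<inter> Y = {} \<and> \<not> first_wins (h @ u)"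
      if "\<not> first_wins h" for h
      using F[OF that, unfolded Q_def, THEN conjunct2, THEN conjunct2, rule_format, of Y] Y that by auto
    have "\<exists>H. \<forall>n. (\<not> first_wins (H n) \<and> fst ` set (H n) \<inter> Y = {}) \<and>
       (\<exists>u. H (Suc n) = H n @ u \<and> (\<exists>i<length u. snd (u ! i) \<noteq> None))"
    proof (rule dependent_nat_choice)
      show "\<exists>h. \<not> first_wins h \<and> fst ` set h \<inter> Y = {}"
        using assms(2) by (intro exI[of _ "[]"]) simp
      fix h n assume h: "\<not> first_wins h \<and> fst ` set h \<inter> Y = {}"
      obtain u where "\<exists>i<length u. snd (u ! i) \<noteq> None" "fst ` set u \<inter> Y = {}" "\<not> first_wins (h @ u)"
        using ex[OF conjunct1[OF h]] by blast
      then show "\<exists>h'. (\<not> first_wins h' \<and> fst ` set h' \<inter> Y = {}) \<and> (\<exists>u. h' = h @ u \<and> (\<exists>i<length u. snd (u ! i) \<noteq> None))"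
        using h by (intro exI[of _ "h @ u"]) auto
    qed
    then obtain H where H: "\<And>n. \<not> first_wins (H n)" "\<And>n. fst ` set (H n) \<inter> Y = {}"
      and HS: "\<And>n. \<exists>u. H (Suc n) = H n @ u \<and> (\<exists>i<length u. snd (u ! i) \<noteq> None)" by blast
    have ext: "\<exists>u. H (m + k) = H m @ u" for m k
    proof (induction k)
      case (Suc k)
      then show ?case using HS[of "m + k"] by auto
    qed auto
    have nth_H: "H n ! i = H m ! i" if "m \<le> n" "i < length (H m)" for m n i
      using ext[of m "n - m"] that by (auto simp: nth_append)
    have len: "n \<le> length (H n)" for n
    proof (induction n)
      case (Suc n)
      then show ?case using HS[of n] by fastforce
    qed auto
    define p where "p n = H (Suc n) ! n" for n
    have p: "p i = H n ! i" if "i < length (H n)" for i n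
      using nth_H[of "Suc i" n i] nth_H[of n "Suc i" i] len[of "Suc i"] that
      unfolding p_def by (metis Suc_le_eq nle_le)
    have pre: "prefix_of p n = take n (H n)" for n
      using len[of n] p by (auto intro!: nth_equalityI)
    have "fst (p n) \<notin> Y" for n
    proof -
      have "p n \<in> set (H (Suc n))" using len[of "Suc n"] by (simp add: p_def)
      then show ?thesis using H(2)[of "Suc n"] by blast
    qed
    moreover have "good (prefix_of p n)" for n
      using not_first_wins_good[OF assms(1) H(1) len] pre by simp
    moreover have "infinite {n. snd (p n) \<noteq> None}"
      unfolding infinite_nat_iff_unbounded_le
    proof
      fix m
      obtain u i where u: "H (Suc m) = H m @ u" "i < length u" "snd (u ! i) \<noteq> None" using HS by blast
      have "p (length (H m) + i) = u ! i" using p[of "length (H m) + i" "Suc m"] u by simp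
      then show "\<exists>n\<ge>m. n \<in> {n. snd (p n) \<noteq> None}"
        using u(3) len[of m] by (intro exI[of _ "length (H m) + i"]) auto
    qed
    ultimately show ?thesis by blast
  qed
  ultimately show ?thesis by blast
qed

end

section \<open>Coanalytic ideals\<close>

lemma ideal_on_natD:
  assumes "ideal_on_nat I"
  shows "A \<in> I \<Longrightarrow> B \<in> I \<Longrightarrow> A \<union> B \<in> I" "A \<in> I \<Longrightarrow> B \<subseteq> A \<Longrightarrow> B \<in> I" "finite A \<Longrightarrow> A \<in> I"
  using assms unfolding ideal_on_nat_def by blast+

lemma ideal_finite_UN:
  assumes "ideal_on_nat I" "finite S" "\<And>s. s \<in> S \<Longrightarrow> A s \<in> I"
  shows "(\<Union>s\<in>S. A s) \<in> I"
  using assms(2,3) by induction (auto intro: ideal_on_natD[OF assms(1)])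

text \<open>The working form of membership: the part covered by the sets \<open>A i\<close> may be
  taken as large as possible.\<close>

lemma ideal_join_seq_iff:
  assumes "ideal_on_nat I"
  shows "H \<in> ideal_join_seq I A \<longleftrightarrow> (\<exists>k. H - (\<Union>i<k. A i) \<in> I)"
proof
  assume "H \<in> ideal_join_seq I A"
  then obtain M N k where "H = M \<union> N" "M \<in> I" "N \<subseteq> (\<Union>i<k. A i)"
    unfolding ideal_join_seq_def by blast
  then have "H - (\<Union>i<k. A i) \<subseteq> M" by blast
  then show "\<exists>k. H - (\<Union>i<k. A i) \<in> I" using ideal_on_natD(2)[OF assms \<open>M \<in> I\<close>] by blast
next
  assume "\<exists>k. H - (\<Union>i<k. A i) \<in> I"
  then obtain k where "H - (\<Union>i<k. A i) \<in> I" ..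
  moreover have "H = (H - (\<Union>i<k. A i)) \<union> (H \<inter> (\<Union>i<k. A i))" by blast
  ultimately show "H \<in> ideal_join_seq I A"
    unfolding ideal_join_seq_def by blast
qed

lemma ideal_join_iff:
  assumes "ideal_on_nat I"
  shows "H \<in> ideal_join I A \<longleftrightarrow> H - A \<in> I"
proof
  assume "H \<in> ideal_join I A"
  then obtain M N where "H = M \<union> N" "M \<in> I" "N \<subseteq> A"
    unfolding ideal_join_def by blast
  then have "H - A \<subseteq> M" by blast
  then show "H - A \<in> I" using ideal_on_natD(2)[OF assms \<open>M \<in> I\<close>] by blast
next
  assume "H - A \<in> I"
  moreover have "H = (H - A) \<union> (H \<inter> A)" by blast
  ultimately show "H \<in> ideal_join I A" unfolding ideal_join_def by blast
qed

text \<open>Lets both kinds of join be treated at once. The empty union at \<open>k = 0\<close> does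
  no harm, as it only gives a stronger condition.\<close>

lemma ideal_join_eq_seq:
  assumes "ideal_on_nat I"
  shows "ideal_join I A = ideal_join_seq I (\<lambda>_. A)"
proof (rule set_eqI)
  fix H
  have "H - (\<Union>i<k. A) \<in> I \<Longrightarrow> H - A \<in> I" for k :: nat
    by (cases "k = 0") (auto intro: ideal_on_natD(2)[OF assms] split: if_splits)
  moreover have "H - (\<Union>i<Suc 0. A) = H - A" by auto
  ultimately show "H \<in> ideal_join I A \<longleftrightarrow> H \<in> ideal_join_seq I (\<lambda>_. A)"
    unfolding ideal_join_iff[OF assms] ideal_join_seq_iff[OF assms] by metis
qed

lemma ideal_on_nat_join_seq:
  assumes I: "ideal_on_nat I"
  shows "ideal_on_nat (ideal_join_seq I A)"
  unfolding ideal_on_nat_def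
proof (intro conjI ballI allI impI)
  fix G H assume "G \<in> ideal_join_seq I A" "H \<in> ideal_join_seq I A"
  then obtain k l where kl: "G - (\<Union>i<k. A i) \<in> I" "H - (\<Union>i<l. A i) \<in> I"
    using ideal_join_seq_iff[OF I] by blast
  have "G \<union> H - (\<Union>i<max k l. A i) \<subseteq> (G - (\<Union>i<k. A i)) \<union> (H - (\<Union>i<l. A i))" by force
  then show "G \<union> H \<in> ideal_join_seq I A"
    using ideal_on_natD[OF I] kl ideal_join_seq_iff[OF I] by meson
next
  fix G H assume "G \<in> ideal_join_seq I A" "H \<subseteq> G"
  then show "H \<in> ideal_join_seq I A"
    using ideal_on_natD(2)[OF I] ideal_join_seq_iff[OF I] by (meson Diff_mono subset_refl)
next
  fix H :: "nat set" assume "finite H"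
  then show "H \<in> ideal_join_seq I A"
    using ideal_on_natD(3)[OF I] ideal_join_seq_iff[OF I] by blast
qed

section \<open>Positivity as the projection of a closed set\<close>

lemma tendsto_fun_iff:
  fixes l :: "'i \<Rightarrow> 'b::topological_space"
  shows "(f \<longlongrightarrow> l) F \<longleftrightarrow> (\<forall>i. ((\<lambda>a. f a i) \<longlongrightarrow> l i) F)"
proof -
  have "limitin euclidean f l F \<longleftrightarrow> (\<forall>i\<in>UNIV. limitin euclidean (\<lambda>a. f a i) (l i) F)"
    unfolding euclidean_product_topology[symmetric] limitin_componentwise by simp
  then show ?thesis by simp
qed

text \<open>That is, the complement of \<open>K\<close> is the projection of the closed set with the tree \<open>R\<close>.\<close>

definition positive_witness :: "nat set set \<Rightarrow> (nat set \<Rightarrow> nat list \<Rightarrow> bool) \<Rightarrow> bool" where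
  "positive_witness K R \<longleftrightarrow>
     (\<forall>H. H \<notin> K \<longleftrightarrow> (\<exists>y. \<forall>n. R (H \<inter> {..<n}) (map y [0..<n])))"

lemma char_functions_mem_iff: "(\<lambda>n. n \<in> H) \<in> char_functions I \<longleftrightarrow> H \<in> I"
proof
  assume "(\<lambda>n. n \<in> H) \<in> char_functions I"
  then obtain A where "A \<in> I" "(\<lambda>n. n \<in> H) = (\<lambda>n. n \<in> A)" unfolding char_functions_def by blast
  then show "H \<in> I" by (metis subset_antisym subsetI)
qed (auto simp: char_functions_def)

lemma coanalytic_positive_witness:
  assumes "coanalytic_family I"
  shows "\<exists>R. positive_witness I R"
proof -
  note char = char_functions_mem_iff[of _ I]
  show ?thesis
  proof (cases "- char_functions I = {}")
    case True
    then have "H \<in> I" for H using char by blast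
    then show ?thesis by (intro exI[of _ "\<lambda>_ _. False"]) (auto simp: positive_witness_def)
  next
    case False
    then obtain g :: "(nat \<Rightarrow> nat) \<Rightarrow> nat \<Rightarrow> bool"
      where g: "continuous_on UNIV g" "range g = - char_functions I"
      using assms unfolding coanalytic_family_def analytic_set_def by auto
    \<comment> \<open>\<open>R\<close> asks only for some branch through \<open>t\<close> whose
      image agrees with \<open>S\<close> so far. Branches found for longer and longer
      \<open>t\<close> converge, and continuity of \<open>g\<close> identifies the image of the
      limit.\<close>
    define R where "R S t \<longleftrightarrow> (\<exists>y. (\<forall>i<length t. y i = t ! i) \<and> (\<forall>i<length t. g y i \<longleftrightarrow> i \<in> S))"
      for S and t :: "nat list"
    have "H \<notin> I \<longleftrightarrow> (\<exists>y. \<forall>n. R (H \<inter> {..<n}) (map y [0..<n]))" for H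
    proof
      assume "H \<notin> I"
      then have "(\<lambda>n. n \<in> H) \<in> range g" using char g(2) by blast
      then obtain y where "g y = (\<lambda>n. n \<in> H)" by auto
      then show "\<exists>y. \<forall>n. R (H \<inter> {..<n}) (map y [0..<n])"
        unfolding R_def by (intro exI[of _ y] allI) auto
    next
      assume "\<exists>y. \<forall>n. R (H \<inter> {..<n}) (map y [0..<n])"
      then obtain y where y: "\<And>n. R (H \<inter> {..<n}) (map y [0..<n])" by blast
      have "\<exists>w. (\<forall>i<n. w i = y i) \<and> (\<forall>i<n. g w i \<longleftrightarrow> i \<in> H)" for n
        using y[of n] unfolding R_def by auto
      then obtain w where w: "\<And>n i. i < n \<Longrightarrow> w n i = y i" "\<And>n i. i < n \<Longrightarrow> g (w n) i \<longleftrightarrow> i \<in> H"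
        by metis
      have "w \<longlonglongrightarrow> y"
        unfolding tendsto_fun_iff
        proof
        show "(\<lambda>n. w n i) \<longlonglongrightarrow> y i" for i
          by (intro tendsto_eventually eventually_sequentiallyI[of "Suc i"] w(1)) simp
      qed
      then have "(\<lambda>n. g (w n)) \<longlonglongrightarrow> g y"
        using continuous_on_tendsto_compose[OF g(1)] by simp
      moreover have "(\<lambda>n. g (w n)) \<longlonglongrightarrow> (\<lambda>i. i \<in> H)"
        unfolding tendsto_fun_iff
        proof
        show "(\<lambda>n. g (w n) i) \<longlonglongrightarrow> (i \<in> H)" for i
          by (intro tendsto_eventually eventually_sequentiallyI[of "Suc i"] w(2)) simp
      qed
      ultimately have "g y i = (i \<in> H)" for i
        using LIMSEQ_unique[of "\<lambda>n. g (w n) i"] unfolding tendsto_fun_iff by blast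
      then have "g y = (\<lambda>i. i \<in> H)" by blast
      then show "H \<notin> I" using g(2) char by (metis Compl_iff rangeI)
    qed
    then show ?thesis unfolding positive_witness_def by blast
  qed
qed

text \<open>A set is positive for the join iff \<open>H - C k\<close> is positive for every
  \<open>k\<close>; the countably many witnesses are coded as the rows of a single one.\<close>

lemma positive_witness_join_seq:
  assumes I: "ideal_on_nat I" and R: "positive_witness I R"
  shows "\<exists>R'. positive_witness (ideal_join_seq I A) R'"
proof -
  define C where "C k = (\<Union>i<k. A i)" for k :: nat
  \<comment> \<open>A prefix is tested only on those rows whose first \<open>n\<close> entries it
    already contains. The bound \<open>n \<le> length t\<close> guarantees that the truncation of
    the set does not affect its part below \<open>n\<close>.\<close>
  define R' where "R' S t \<longleftrightarrow>
    (\<forall>k n. n \<le> length t \<and> (\<forall>i<n. prod_encode (k, i) < length t) \<longrightarrow>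
        R ((S - C k) \<inter> {..<n}) (map (\<lambda>i. t ! prod_encode (k, i)) [0..<n]))" for S and t :: "nat list"
  have "H \<notin> ideal_join_seq I A \<longleftrightarrow> (\<exists>y. \<forall>n. R' (H \<inter> {..<n}) (map y [0..<n]))" for H
  proof -
    have "H \<notin> ideal_join_seq I A \<longleftrightarrow> (\<forall>k. H - C k \<notin> I)"
      unfolding ideal_join_seq_iff[OF I] C_def by blast
    also have "\<dots> \<longleftrightarrow> (\<forall>k. \<exists>z. \<forall>n. R ((H - C k) \<inter> {..<n}) (map z [0..<n]))"
      using R unfolding positive_witness_def by blast
    also have "\<dots> \<longleftrightarrow> (\<exists>y. \<forall>n. R' (H \<inter> {..<n}) (map y [0..<n]))"
    proof
      assume "\<forall>k. \<exists>z. \<forall>n. R ((H - C k) \<inter> {..<n}) (map z [0..<n])"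
      from choice[OF this] obtain z where z: "\<And>k n. R ((H - C k) \<inter> {..<n}) (map (z k) [0..<n])" by blast
      define y where "y = (\<lambda>(k, i). z k i) \<circ> prod_decode"
      have "R' (H \<inter> {..<N}) (map y [0..<N])" for N
        unfolding R'_def
      proof (intro allI impI)
        fix k n assume n: "n \<le> length (map y [0..<N]) \<and> (\<forall>i<n. prod_encode (k, i) < length (map y [0..<N]))"
        have "(H \<inter> {..<N} - C k) \<inter> {..<n} = (H - C k) \<inter> {..<n}" using n by auto
        moreover have "map (\<lambda>i. map y [0..<N] ! prod_encode (k, i)) [0..<n] = map (z k) [0..<n]"
          using n by (auto simp: y_def)
        ultimately show "R ((H \<inter> {..<N} - C k) \<inter> {..<n}) (map (\<lambda>i. map y [0..<N] ! prod_encode (k, i)) [0..<n])"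
          using z[of k n] by (simp only:)
      qed
      then show "\<exists>y. \<forall>n. R' (H \<inter> {..<n}) (map y [0..<n])" by blast
    next
      assume "\<exists>y. \<forall>n. R' (H \<inter> {..<n}) (map y [0..<n])"
      then obtain y where y: "\<And>n. R' (H \<inter> {..<n}) (map y [0..<n])" by blast
      show "\<forall>k. \<exists>z. \<forall>n. R ((H - C k) \<inter> {..<n}) (map z [0..<n])"
      proof (intro allI exI)
        fix k n
        \<comment> \<open>Long enough to contain the first \<open>n\<close> entries of row
          \<open>k\<close> and to satisfy \<open>n \<le> N\<close>.\<close>
        define N where "N = n + Suc (\<Sum>i<n. prod_encode (k, i))"
        have enc: "prod_encode (k, i) < N" if "i < n" for i
          using member_le_sum[of i "{..<n}" "\<lambda>i. prod_encode (k, i)"] that by (simp add: N_def)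
        have "R ((H \<inter> {..<N} - C k) \<inter> {..<n}) (map (\<lambda>i. map y [0..<N] ! prod_encode (k, i)) [0..<n])"
          using y[of N] enc unfolding R'_def by (auto simp: N_def)
        moreover have "(H \<inter> {..<N} - C k) \<inter> {..<n} = (H - C k) \<inter> {..<n}" by (auto simp: N_def)
        moreover have "map (\<lambda>i. map y [0..<N] ! prod_encode (k, i)) [0..<n] = map (\<lambda>i. y (prod_encode (k, i))) [0..<n]"
          using enc by auto
        ultimately show "R ((H - C k) \<inter> {..<n}) (map (\<lambda>i. y (prod_encode (k, i))) [0..<n])" by simp
      qed
    qed
    finally show ?thesis .
  qed
  then show ?thesis unfolding positive_witness_def by blast
qed

section \<open>Failure of weak Ramseyness in terms of avoidance\<close>

text \<open>A winning strategy of the first player in the game of avoiding \<open>B n\<close> for all earlier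
  choices \<open>n\<close>.\<close>

definition avoidance_system :: "nat set set \<Rightarrow> (nat \<Rightarrow> nat set) \<Rightarrow> bool" where
  "avoidance_system K B \<longleftrightarrow>
     range B \<subseteq> K \<and> (\<forall>H. (\<forall>n\<in>H. \<forall>n'\<in>H. n < n' \<longrightarrow> n' \<notin> B n) \<longrightarrow> H \<in> K)"

text \<open>Let \<open>c x\<close> be a colour such that the neighbours of \<open>x\<close> joined
  by the other colour form a set in \<open>K\<close>, and let \<open>B x\<close> be this set. If
  avoidance holds on \<open>H\<close>, the colour of a pair is decided by its smaller element, so
  \<open>H\<close> splits into two homogeneous pieces, both in \<open>K\<close>.\<close>

lemma not_weakly_Ramsey_imp_avoidance:
  assumes K: "ideal_on_nat K" and "\<not> weakly_Ramsey K"
  shows "\<exists>B. avoidance_system K B"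
proof -
  obtain f :: "nat set \<Rightarrow> nat" where f: "f \<in> nsets UNIV 2 \<rightarrow> {0, 1}"
    and split: "\<And>x. {y. y \<noteq> x \<and> f {x, y} = 0} \<in> K \<or> {y. y \<noteq> x \<and> f {x, y} = 1} \<in> K"
    and hom: "\<And>H c. \<forall>e\<in>nsets H 2. f e = c \<Longrightarrow> H \<in> K"
    proof -
    from assms(2)[unfolded weakly_Ramsey_def not_all] obtain f :: "nat set \<Rightarrow> nat" where
      f: "\<not> (f \<in> nsets UNIV 2 \<rightarrow> {0, 1} \<and>
          (\<forall>x. {y. y \<noteq> x \<and> f {x, y} = 0} \<in> K \<or> {y. y \<noteq> x \<and> f {x, y} = 1} \<in> K) \<longrightarrow>
          (\<exists>H\<in>positive_sets K. \<exists>c. \<forall>e\<in>nsets H 2. f e = c))" by (rule exE)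
    show thesis
      by (rule that[of f]) (use f in \<open>auto simp: positive_sets_def\<close>)
  qed
  define c where "c x = (if {y. y \<noteq> x \<and> f {x, y} = 0} \<in> K then 1 else 0 :: nat)" for x
  define B where "B x = {y. y \<noteq> x \<and> f {x, y} = 1 - c x}" for x
  have "B x \<in> K" for x using split[of x] by (auto simp: B_def c_def)
  moreover have "H \<in> K" if legal: "\<forall>n\<in>H. \<forall>n'\<in>H. n < n' \<longrightarrow> n' \<notin> B n" for H
  proof -
    have col: "f {n, n'} = c n" if "n \<in> H" "n' \<in> H" "n < n'" for n n'
    proof -
      have "f {n, n'} \<in> {0, 1}" using f that by (auto simp: nsets_def Pi_iff)
      moreover have "f {n, n'} \<noteq> 1 - c n" using legal that by (auto simp: B_def)
      ultimately show ?thesis by (auto simp: c_def split: if_splits)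
    qed
    have "{n \<in> H. c n = i} \<in> K" for i
    proof (rule hom[of _ i], rule ballI)
      fix e assume "e \<in> nsets {n \<in> H. c n = i} 2"
      then obtain x y where e: "e = {x, y}" "x \<in> H" "y \<in> H" "c x = i" "c y = i" "x \<noteq> y"
        unfolding nsets_def card_2_iff by auto
      then show "f e = i"
        using col[of x y] col[of y x] by (cases "x < y") (auto simp: insert_commute)
    qed
    then have "{n \<in> H. c n = 0} \<union> {n \<in> H. c n = 1} \<in> K" using ideal_on_natD(1)[OF K] by blast
    moreover have "H \<subseteq> {n \<in> H. c n = 0} \<union> {n \<in> H. c n = 1}" by (auto simp: c_def)
    ultimately show ?thesis using ideal_on_natD(2)[OF K] by blast
  qed
  ultimately show ?thesis unfolding avoidance_system_def by blast
qed

text \<open>Colour a pair by whether its larger element lies in \<open>B\<close> of the smaller one.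
  A set homogeneous for colour 0 with least element \<open>h\<close> is contained in
  \<open>B h \<union> {h}\<close>; any other homogeneous set obeys the avoidance rule.\<close>

lemma avoidance_imp_not_weakly_Ramsey:
  assumes K: "ideal_on_nat K" and B: "avoidance_system K B"
  shows "\<not> weakly_Ramsey K"
proof
  assume wR: "weakly_Ramsey K"
  define f :: "nat set \<Rightarrow> nat" where "f e = (if Max e \<in> B (Min e) then 0 else 1)" for e
  have f: "f {x, y} = (if y \<in> B x then 0 else 1)" if "x < y" for x y
  proof -
    have "Max {x, y} = y" "Min {x, y} = x" using that by (auto simp: max_def min_def)
    then show ?thesis by (simp add: f_def)
  qed
  have "{y. y \<noteq> x \<and> f {x, y} = 0} \<in> K" for x
  proof (rule ideal_on_natD(2)[OF K])
    show "B x \<union> {..<x} \<in> K"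
      using B by (intro ideal_on_natD(1)[OF K _ ideal_on_natD(3)[OF K]]) (auto simp: avoidance_system_def)
    show "{y. y \<noteq> x \<and> f {x, y} = 0} \<subseteq> B x \<union> {..<x}"
      proof
      show "y \<in> B x \<union> {..<x}" if "y \<in> {y. y \<noteq> x \<and> f {x, y} = 0}" for y
        using that f[of x y] by (cases "x < y") (auto split: if_splits)
    qed
  qed
  moreover have "f \<in> nsets UNIV 2 \<rightarrow> {0, 1}" by (auto simp: f_def)
  ultimately have "\<exists>H\<in>positive_sets K. \<exists>c. \<forall>e\<in>nsets H 2. f e = c"
    using wR[unfolded weakly_Ramsey_def, rule_format, of f] by simp
  then obtain H c where H: "H \<notin> K" and hom: "\<forall>e\<in>nsets H 2. f e = c"
    unfolding positive_sets_def by blast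
  have pair: "f {x, y} = c" if "x \<in> H" "y \<in> H" "x < y" for x y
    using hom that by (auto simp: nsets_def)
  have "H \<in> K"
  proof (cases "c = 0")
    case False
    have "n' \<notin> B n" if "n \<in> H" "n' \<in> H" "n < n'" for n n'
      using pair[OF that] f[OF that(3)] False by auto
    then have "\<forall>n\<in>H. \<forall>n'\<in>H. n < n' \<longrightarrow> n' \<notin> B n" by blast
    then show ?thesis using B by (auto simp: avoidance_system_def)
  next
    case True
    have "H \<noteq> {}" using H ideal_on_natD(3)[OF K] by auto
    define h where "h = (LEAST n. n \<in> H)"
    have h: "h \<in> H" "\<And>n. n \<in> H \<Longrightarrow> h \<le> n"
      using \<open>H \<noteq> {}\<close> unfolding h_def by (auto intro: LeastI Least_le)
    have "H \<subseteq> B h \<union> {h}"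
    proof
      fix n assume "n \<in> H"
      then show "n \<in> B h \<union> {h}" using h(1) h(2)[of n] pair[of h n] f[of h n] True
        by (cases "n = h") (auto split: if_splits)
    qed
    moreover have "B h \<union> {h} \<in> K"
      using B by (intro ideal_on_natD(1)[OF K _ ideal_on_natD(3)[OF K]]) (auto simp: avoidance_system_def)
    ultimately show ?thesis using ideal_on_natD(2)[OF K] by blast
  qed
  then show False using H by simp
qed

section \<open>The game for an ideal with a positivity witness\<close>

definition announced :: "history \<Rightarrow> nat list" where
  "announced h = List.map_filter snd h"

lemma announced_simps [simp]:
  "announced [] = []"
  "announced (h @ [(k, None)]) = announced h"
  "announced (h @ [(k, Some m)]) = announced h @ [m]"
  by (auto simp: announced_def List.map_filter_def)

text \<open>Answers increase strictly and at most one value is announced per round. Hence all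
  elements below the number of announcements have been played already, and the tree condition speaks
  about the final set of answers.\<close>

definition good_history :: "(nat set \<Rightarrow> nat list \<Rightarrow> bool) \<Rightarrow> history \<Rightarrow> bool" where
  "good_history R h \<longleftrightarrow> sorted_wrt (<) (map fst h) \<and>
     R (fst ` set h \<inter> {..<length (announced h)}) (announced h)"

lemma strict_mono_image_below:
  fixes e :: "nat \<Rightarrow> nat"
  assumes "strict_mono e" "l \<le> n"
  shows "e ` {..<n} \<inter> {..<l} = range e \<inter> {..<l}"
proof -
  have "i < n" if "e i < l" for i
    using strict_mono_imp_increasing[OF assms(1), of i] that assms(2) by linarith
  then show ?thesis by auto
qed

text \<open>If a set \<open>Y\<close> of the dual filter contained no member of the second player's
  family, the resulting play would have a positive set of answers inside \<open>- Y\<close>, which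
  belongs to \<open>K\<close>.\<close>

lemma second_wins_imp_diagonalizable:
  assumes K: "ideal_on_nat K" and R: "positive_witness K R"
    and sw: "\<not> ideal_game.first_wins K (good_history R) []"
  shows "omega_plus_diagonalizable K"
proof -
  have empty: "{} \<in> K" using ideal_on_natD(3)[OF K] by simp
  obtain \<E> where \<E>: "countable \<E>" "\<E> \<inter> K = {}"
    and play: "\<And>Y. \<forall>E\<in>\<E>. \<not> E \<subseteq> Y \<Longrightarrow>
       \<exists>p. (\<forall>n. fst (p n) \<notin> Y) \<and> (\<forall>n. good_history R (map p [0..<n])) \<and> infinite {n. snd (p n) \<noteq> None}"
    using ideal_game.second_wins[OF empty sw] by blast
  have contained: "\<exists>E\<in>\<E>. E \<subseteq> Y" if Y: "Y \<in> dual_filter K" for Y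
  proof (rule ccontr)
    assume "\<not> (\<exists>E\<in>\<E>. E \<subseteq> Y)"
    then obtain p where pY: "\<And>n. fst (p n) \<notin> Y" and good: "\<And>n. good_history R (map p [0..<n])"
      and inf: "infinite {n. snd (p n) \<noteq> None}" using play[of Y] by blast
    define e where "e = fst \<circ> p"
    define a where "a n = announced (map p [0..<n])" for n
    have mono: "strict_mono e"
    proof (rule strict_monoI)
      fix m n :: nat assume "m < n"
      moreover have "sorted_wrt (<) (map e [0..<Suc n])"
        using good[of "Suc n"] by (simp add: good_history_def e_def comp_def)
      ultimately show "e m < e n"
        by (auto simp: sorted_wrt_iff_nth_less dest!: spec[of _ m] spec[of _ n] simp del: upt_Suc)
    qed
    have aS: "a (Suc n) = (case snd (p n) of None \<Rightarrow> a n | Some m \<Rightarrow> a n @ [m])" for n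
      by (cases "p n") (auto simp: a_def split: option.split)
    have "\<exists>u. a (n + k) = a n @ u" for n k
      by (induction k) (auto simp: aS split: option.split)
    then have pre: "\<exists>u. a m = a n @ u" if "n \<le> m" for m n
      using that by (metis le_Suc_ex)
    have len: "length (a n) \<le> n" for n
      by (induction n) (auto simp: aS a_def[of 0] split: option.split)
    have ex: "\<exists>n. length (a n) = l" for l
    proof (induction l)
      case 0
      then show ?case by (intro exI[of _ 0]) (simp add: a_def)
    next
      case (Suc l)
      then obtain n where n: "length (a n) = l" ..
      define N where "N = (LEAST m. n \<le> m \<and> snd (p m) \<noteq> None)"
      have "\<exists>m. n \<le> m \<and> snd (p m) \<noteq> None"
        using inf by (auto simp: infinite_nat_iff_unbounded_le)
      then have N: "n \<le> N" "snd (p N) \<noteq> None" unfolding N_def by (rule LeastI2_ex, simp)+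
      have "a m = a n" if "n \<le> m" "m \<le> N" for m
        using that
      proof (induction m rule: dec_induct)
        case (step m)
        then have "snd (p m) = None" using not_less_Least[of m "\<lambda>m. n \<le> m \<and> snd (p m) \<noteq> None"] unfolding N_def by auto
        then show ?case using step.IH step.hyps step.prems aS[of m] by simp
      qed simp
      then have "a N = a n" using N(1) by blast
      then have "length (a (Suc N)) = Suc l" using N(2) n aS[of N] by (auto split: option.splits)
      then show ?case by blast
    qed
    \<comment> \<open>The limit of the announced lists. They extend one another and every length
      occurs, so the choice of the index is immaterial.\<close>
    define y where "y i = a (SOME n. length (a n) = Suc i) ! i" for i
    have a_eq: "a n = map y [0..<length (a n)]" for n
    proof (rule nth_equalityI)
      fix i assume i: "i < length (a n)"
      define m where "m = (SOME n. length (a n) = Suc i)"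
      have m: "length (a m) = Suc i" unfolding m_def using ex by (rule someI_ex)
      have "a n ! i = a m ! i"
        using pre[of n m] pre[of m n] i m by (cases "n \<le> m") (auto simp: nth_append)
      then show "a n ! i = map y [0..<length (a n)] ! i" using i by (simp add: y_def m_def)
    qed simp
    have "R (range e \<inter> {..<l}) (map y [0..<l])" for l
    proof -
      obtain n where n: "length (a n) = l" using ex by blast
      have "fst ` set (map p [0..<n]) = e ` {..<n}" by (auto simp: e_def image_image lessThan_atLeast0)
      then have "R (e ` {..<n} \<inter> {..<l}) (a n)"
        using good[of n] n by (simp add: good_history_def a_def)
      moreover have "e ` {..<n} \<inter> {..<l} = range e \<inter> {..<l}"
        using strict_mono_image_below[OF mono] len[of n] n by simp
      moreover have "a n = map y [0..<l]" using a_eq[of n] n by simp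
      ultimately show ?thesis by simp
    qed
    then have "range e \<notin> K" using R unfolding positive_witness_def by blast
    moreover have "range e \<subseteq> - Y" using pY by (auto simp: e_def)
    ultimately show False using Y ideal_on_natD(2)[OF K] by (auto simp: dual_filter_def)
  qed
  have "\<E> \<noteq> {}" using contained[of UNIV] empty by (auto simp: dual_filter_def)
  define X where "X = from_nat_into \<E>"
  have "X n \<in> positive_sets K" for n
    using from_nat_into[OF \<open>\<E> \<noteq> {}\<close>, of n] \<E>(2) by (auto simp: X_def positive_sets_def)
  moreover have "\<exists>n. X n \<subseteq> Y" if "Y \<in> dual_filter K" for Y
  proof -
    obtain E where "E \<in> \<E>" "E \<subseteq> Y" using contained[OF \<open>Y \<in> dual_filter K\<close>] by blast
    then show ?thesis using from_nat_into_to_nat_on[OF \<E>(1)] unfolding X_def by metis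
  qed
  ultimately show ?thesis unfolding omega_plus_diagonalizable_def by blast
qed

text \<open>The first player does not see the whole witness. The remedy is that the second player may
  delay an announcement until its value is bounded by the number played, so that only finitely many
  histories have to be answered at the same time.\<close>

lemma first_wins_imp_avoidance:
  assumes K: "ideal_on_nat K" and R: "positive_witness K R"
    and fw: "ideal_game.first_wins K (good_history R) []"
  shows "\<exists>B. avoidance_system K B"
proof -
  obtain \<sigma> where \<sigma>K: "range \<sigma> \<subseteq> K" and \<sigma>: "\<And>p. \<forall>n. fst (p n) \<notin> \<sigma> (map p [0..<n]) \<Longrightarrow>
      \<forall>n. good_history R (map p [0..<n]) \<Longrightarrow> finite {n. snd (p n) \<noteq> None}"
    using fw unfolding ideal_game.first_wins_def ideal_game.wins_from_def by auto
  \<comment> \<open>A play with strictly increasing answers up to \<open>x\<close> has at most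
    \<open>Suc x\<close> rounds, so its history lies in this finite set once its announcements are
    bounded by \<open>x\<close> too.\<close>
  define Hist where "Hist x = {h :: history. set h \<subseteq> {..x} \<times> (insert None (Some ` {..x})) \<and> length h \<le> Suc x}" for x
  have fin: "finite (Hist x)" for x
    unfolding Hist_def by (intro finite_lists_length_le) auto
  define B where "B x = (\<Union>h\<in>Hist x. \<sigma> h)" for x
  have "B x \<in> K" for x
    unfolding B_def using \<sigma>K by (intro ideal_finite_UN[OF K fin]) auto
  moreover have "H \<in> K" if legal: "\<forall>n\<in>H. \<forall>n'\<in>H. n < n' \<longrightarrow> n' \<notin> B n" for H
  proof (rule ccontr)
    assume "H \<notin> K"
    then have "infinite H" using ideal_on_natD(3)[OF K] by blast
    then obtain h where "h \<in> H" using infinite_imp_nonempty by blast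
    \<comment> \<open>Dropping the numbers up to some \<open>h \<in> H\<close> takes care of the
      opening move: \<open>\<sigma> []\<close> is part of \<open>B h\<close>, which the remaining
      numbers avoid.\<close>
    define H' where "H' = H - {..h}"
    have "H \<subseteq> H' \<union> {..h}" by (auto simp: H'_def)
    then have "H' \<notin> K"
      using \<open>H \<notin> K\<close> ideal_on_natD(1)[OF K _ ideal_on_natD(3)[OF K]] ideal_on_natD(2)[OF K] by blast
    then have "infinite H'" using ideal_on_natD(3)[OF K] by blast
    obtain y where y: "\<And>n. R (H' \<inter> {..<n}) (map y [0..<n])"
      using R \<open>H' \<notin> K\<close> unfolding positive_witness_def by blast
    define e where "e = enumerate H'"
    have mono: "strict_mono e" and ran: "range e = H'"
      using strict_mono_enumerate range_enumerate \<open>infinite H'\<close> unfolding e_def by auto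
    define c where "c = rec_nat 0 (\<lambda>n c. if y c \<le> e n then Suc c else c)"
    have c0: "c 0 = 0" and cS: "c (Suc n) = (if y (c n) \<le> e n then Suc (c n) else c n)" for n
      by (simp_all add: c_def)
    define p where "p n = (e n, if y (c n) \<le> e n then Some (y (c n)) else None)" for n
    have cle: "c n \<le> n" for n by (induction n) (auto simp: c0 cS)
    have ann: "announced (map p [0..<n]) = map y [0..<c n]" for n
      by (induction n) (auto simp: c0 cS p_def)
    have "fst (p n) \<notin> \<sigma> (map p [0..<n])" for n
    proof (cases n)
      case 0
      have "e 0 \<in> H'" using ran by blast
      then have "e 0 \<in> H" "h < e 0" by (auto simp: H'_def)
      then have "e 0 \<notin> B h" using legal \<open>h \<in> H\<close> by blast
      moreover have "[] \<in> Hist h" by (simp add: Hist_def)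
      ultimately show ?thesis using 0 by (auto simp: B_def p_def)
    next
      case (Suc m)
      have "e n \<in> H" "e m \<in> H" using ran by (auto simp: H'_def)
      moreover have "e m < e n" using mono Suc by (simp add: strict_mono_def)
      ultimately have "e n \<notin> B (e m)" using legal by blast
      moreover have "map p [0..<n] \<in> Hist (e m)"
      proof -
        have le: "e i \<le> e m" if "i < n" for i
          using mono that Suc by (simp add: strict_mono_less_eq)
        have "p i \<in> {..e m} \<times> (insert None (Some ` {..e m}))" if "i < n" for i
          using le[OF that] by (auto simp: p_def)
        then have "p ` {0..<n} \<subseteq> {..e m} \<times> (insert None (Some ` {..e m}))"
          unfolding image_subset_iff by simp
        moreover have "n \<le> Suc (e m)" using strict_mono_imp_increasing[OF mono, of m] Suc by simp
        ultimately show ?thesis by (simp add: Hist_def)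
      qed
      ultimately show ?thesis by (auto simp: B_def p_def)
    qed
    moreover have "good_history R (map p [0..<n])" for n
    proof -
      have "map fst (map p [0..<n]) = map e [0..<n]" by (simp add: p_def)
      moreover have "sorted_wrt (<) (map e [0..<n])"
        using mono by (auto simp: sorted_wrt_iff_nth_less strict_mono_def)
      moreover have "fst ` set (map p [0..<n]) = e ` {..<n}" by (auto simp: p_def image_image lessThan_atLeast0)
      moreover have "e ` {..<n} \<inter> {..<c n} = H' \<inter> {..<c n}"
        using strict_mono_image_below[OF mono cle] ran by simp
      ultimately show ?thesis
        using y[of "c n"] ann[of n] by (simp add: good_history_def del: set_map map_map)
    qed
    ultimately have "finite {n. snd (p n) \<noteq> None}" using \<sigma> by blast
    then obtain N where N: "\<And>n. N \<le> n \<Longrightarrow> snd (p n) = None"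
      unfolding finite_nat_set_iff_bounded by (metis (mono_tags, lifting) mem_Collect_eq not_less)
    then have late: "e n < y (c n)" if "N \<le> n" for n
      using N[OF that] by (auto simp: p_def split: if_splits)
    have const: "c n = c N" if "N \<le> n" for n
      using that
    proof (induction n rule: dec_induct)
      case (step n)
      then show ?case using late[OF step.hyps(1)] cS[of n] by simp
    qed simp
    \<comment> \<open>If announcements stopped, the pending value would stay constant, while the
      numbers played eventually reach it and force its announcement.\<close>
    define n where "n = max N (y (c N))"
    have "y (c N) \<le> e n" using strict_mono_imp_increasing[OF mono, of n] by (simp add: n_def)
    moreover have "N \<le> n" by (simp add: n_def)
    ultimately show False using late[of n] const[of n] by simp
  qed
  ultimately show ?thesis unfolding avoidance_system_def by blast
qed

text \<open>Positions not won by the first player already give a diagonalizing family, so its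
  absence hands the first player a winning strategy and hence an avoidance system.\<close>

theorem coanalytic_dichotomy:
  assumes "ideal_on_nat I" "coanalytic_family I" "\<not> omega_plus_diagonalizable (ideal_join_seq I A)"
  shows "\<not> weakly_Ramsey (ideal_join_seq I A)"
proof -
  have K: "ideal_on_nat (ideal_join_seq I A)" by (rule ideal_on_nat_join_seq[OF assms(1)])
  obtain R where R: "positive_witness (ideal_join_seq I A) R"
    using coanalytic_positive_witness[OF assms(2)] positive_witness_join_seq[OF assms(1)] by blast
  show ?thesis
    using second_wins_imp_diagonalizable[OF K R] first_wins_imp_avoidance[OF K R]
      avoidance_imp_not_weakly_Ramsey[OF K] assms(3) by blast
qed

section \<open>Scattered families of balls near a closed nowhere dense set\<close>

definition closed_nwd :: "'a topology \<Rightarrow> 'a set \<Rightarrow> bool" where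
  "closed_nwd X D \<longleftrightarrow> closedin X D \<and> X interior_of D = {}"

lemma closed_nwd_avoid:
  assumes "closed_nwd X D" "openin X U" "U \<noteq> {}"
  shows "U - D \<noteq> {}"
  using assms interior_of_maximal[of U D X] unfolding closed_nwd_def by blast

lemma closure_of_meets_iff:
  "x \<in> X closure_of S \<longleftrightarrow> x \<in> topspace X \<and> (\<forall>U. openin X U \<and> x \<in> U \<longrightarrow> U \<inter> S \<noteq> {})"
  unfolding in_closure_of by blast

lemma closure_of_meets: "x \<in> X closure_of S \<Longrightarrow> openin X U \<Longrightarrow> x \<in> U \<Longrightarrow> U \<inter> S \<noteq> {}"
  unfolding closure_of_meets_iff by blast

lemma closure_of_Diff_nwd:
  assumes D: "closed_nwd X D" and G: "openin X G"
  shows "X closure_of (G - D) = X closure_of G"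
proof
  show "X closure_of G \<subseteq> X closure_of (G - D)"
  proof
    fix x assume x: "x \<in> X closure_of G"
    have "U \<inter> (G - D) \<noteq> {}" if "openin X U" "x \<in> U" for U
    proof -
      have "U \<inter> G \<noteq> {}" using x that unfolding closure_of_meets_iff by blast
      then have "U \<inter> G - D \<noteq> {}"
        using closed_nwd_avoid[OF D openin_Int[OF \<open>openin X U\<close> G]] by blast
      then show ?thesis by blast
    qed
    then show "x \<in> X closure_of (G - D)"
      using x unfolding closure_of_meets_iff by blast
  qed
qed (intro closure_of_mono Diff_subset)

context Metric_space
begin

section \<open>Closed discrete sets and nets near a nowhere dense set\<close>

definition sparse :: "'a set \<Rightarrow> bool" where
  "sparse U \<longleftrightarrow> (\<forall>x\<in>M. \<exists>e>0. U \<inter> mball x e \<subseteq> {x})"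

lemma sparse_Un:
  assumes "sparse U" "sparse V"
  shows "sparse (U \<union> V)"
  unfolding sparse_def
proof
  fix x assume "x \<in> M"
  then obtain e1 e2 where e: "e1 > 0" "U \<inter> mball x e1 \<subseteq> {x}" "e2 > 0" "V \<inter> mball x e2 \<subseteq> {x}"
    using assms unfolding sparse_def by meson
  have "mball x (min e1 e2) \<subseteq> mball x e1" "mball x (min e1 e2) \<subseteq> mball x e2"
    by (intro mball_subset_concentric; simp)+
  then have "(U \<union> V) \<inter> mball x (min e1 e2) \<subseteq> {x}" using e by blast
  then show "\<exists>e>0. (U \<union> V) \<inter> mball x e \<subseteq> {x}" using e by (intro exI[of _ "min e1 e2"]) auto
qed

lemma sparse_finite_UN: "finite S \<Longrightarrow> (\<And>s. s \<in> S \<Longrightarrow> sparse (Q s)) \<Longrightarrow> sparse (\<Union>s\<in>S. Q s)"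
proof (induction rule: finite_induct)
  case empty
  then show ?case by (auto simp: sparse_def intro: exI[of _ 1])
qed (auto intro: sparse_Un)

text \<open>A ball of radius \<open>\<delta>/2\<close> contains at most one point of
  \<open>S\<close>; shrinking the radius to the distance of that point removes it, unless it is the
  centre.\<close>

lemma sparse_separated:
  assumes "S \<subseteq> M" "\<delta> > 0" and sep: "\<And>s t. s \<in> S \<Longrightarrow> t \<in> S \<Longrightarrow> s \<noteq> t \<Longrightarrow> \<delta> \<le> d s t"
  shows "sparse S"
  unfolding sparse_def
proof
  fix x assume x: "x \<in> M"
  show "\<exists>e>0. S \<inter> mball x e \<subseteq> {x}"
  proof (cases "S \<inter> mball x (\<delta>/2) \<subseteq> {x}")
    case True
    then show ?thesis using \<open>\<delta> > 0\<close> by (intro exI[of _ "\<delta>/2"]) auto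
  next
    case False
    then obtain q where "q \<in> S \<inter> mball x (\<delta>/2)" "q \<noteq> x" by blast
    then have q: "q \<in> S" "d x q < \<delta>/2" "q \<noteq> x" by auto
    have qM: "q \<in> M" using q assms(1) by blast
    have "d x q > 0" using q x qM by simp
    moreover have "S \<inter> mball x (min (\<delta>/2) (d x q)) = {}"
    proof (rule ccontr)
      assume "S \<inter> mball x (min (\<delta>/2) (d x q)) \<noteq> {}"
      then obtain s where s: "s \<in> S" "s \<in> M" "d x s < \<delta>/2" "d x s < d x q" by auto
      have "d s q < \<delta>" using triangle[of s x q] s q x qM commute[of s x] by linarith
      then show False using sep[of s q] s q by auto
    qed
    ultimately show ?thesis using \<open>\<delta> > 0\<close> by (intro exI[of _ "min (\<delta>/2) (d x q)"]) auto
  qed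
qed

lemma maximal_separated:
  assumes "E \<subseteq> M" "\<delta> > 0"
  shows "\<exists>S\<subseteq>E. (\<forall>s\<in>S. \<forall>t\<in>S. s \<noteq> t \<longrightarrow> \<delta> \<le> d s t) \<and> (\<forall>x\<in>E. \<exists>s\<in>S. d x s < \<delta>)"
proof -
  define \<A> where "\<A> = {S. S \<subseteq> E \<and> (\<forall>s\<in>S. \<forall>t\<in>S. s \<noteq> t \<longrightarrow> \<delta> \<le> d s t)}"
  have "\<Union>\<C> \<in> \<A>" if "subset.chain \<A> \<C>" for \<C>
  proof -
    have "\<delta> \<le> d s t" if "s \<in> A" "A \<in> \<C>" "t \<in> B" "B \<in> \<C>" "s \<noteq> t" for s t A B
    proof -
      have "A \<subseteq> B \<or> B \<subseteq> A" "A \<in> \<A>" "B \<in> \<A>"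
        using \<open>subset.chain \<A> \<C>\<close> that unfolding subset_chain_def by blast+
      then show ?thesis using that unfolding \<A>_def by blast
    qed
    moreover have "\<Union>\<C> \<subseteq> E" using that unfolding subset_chain_def \<A>_def by blast
    ultimately show ?thesis unfolding \<A>_def by blast
  qed
  then obtain S where S: "S \<in> \<A>" and max: "\<And>T. T \<in> \<A> \<Longrightarrow> S \<subseteq> T \<Longrightarrow> T = S"
    using subset_Zorn'[of \<A>] by metis
  have "\<exists>s\<in>S. d x s < \<delta>" if "x \<in> E" for x
  proof (rule ccontr)
    assume far: "\<not> (\<exists>s\<in>S. d x s < \<delta>)"
    then have "insert x S \<in> \<A>"
      using S that unfolding \<A>_def by (auto simp: not_less commute)
    then have "x \<in> S" using max[of "insert x S"] by blast
    moreover have "d x x < \<delta>" using that assms by (simp add: subset_iff)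
    ultimately show False using far by blast
  qed
  moreover have "S \<subseteq> E" "\<forall>s\<in>S. \<forall>t\<in>S. s \<noteq> t \<longrightarrow> \<delta> \<le> d s t" using S unfolding \<A>_def by simp_all
  ultimately show ?thesis by (intro exI[of _ S] conjI ballI) blast+
qed

text \<open>Every point \<open>s\<close> of a maximal \<open>\<epsilon>/2\<close>-separated set in
  \<open>D \<inter> mtopology closure_of G\<close> is moved by less than \<open>\<epsilon>/8\<close>
  into \<open>G - D - U\<close>. This leaves separation \<open>\<epsilon>/4\<close> and mesh below
  \<open>\<epsilon>/2 + \<epsilon>/8\<close>. The set \<open>U\<close> can be avoided because near
  \<open>s\<close> it contains at most \<open>s\<close> itself, which lies in
  \<open>D\<close>.\<close>

lemma sparse_net:
  assumes D: "closed_nwd mtopology D" and G: "openin mtopology G" and U: "sparse U" and "\<epsilon> > 0"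
  shows "\<exists>Q\<subseteq>G - D - U. sparse Q \<and> (\<forall>x\<in>D \<inter> mtopology closure_of G. \<exists>q\<in>Q. d x q < \<epsilon>)
    \<and> (\<forall>q\<in>Q. \<exists>x\<in>D. d x q < \<epsilon>)"
proof -
  define E where "E = D \<inter> mtopology closure_of G"
  have EM: "E \<subseteq> M" using closure_of_subset_topspace[of mtopology G] by (auto simp: E_def)
  obtain S where S: "S \<subseteq> E" "\<And>s t. s \<in> S \<Longrightarrow> t \<in> S \<Longrightarrow> s \<noteq> t \<Longrightarrow> \<epsilon>/2 \<le> d s t"
    "\<And>x. x \<in> E \<Longrightarrow> \<exists>s\<in>S. d x s < \<epsilon>/2"
    proof -
    obtain S where S: "S \<subseteq> E" "\<forall>s\<in>S. \<forall>t\<in>S. s \<noteq> t \<longrightarrow> \<epsilon>/2 \<le> d s t" "\<forall>x\<in>E. \<exists>s\<in>S. d x s < \<epsilon>/2"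
      using maximal_separated[OF EM half_gt_zero[OF \<open>\<epsilon> > 0\<close>]] by (elim exE conjE)
    show thesis
      by (rule that[OF S(1)]) (use S in simp_all)
  qed
  have "\<exists>p. p \<in> G - D - U \<and> d s p < \<epsilon>/8" if "s \<in> S" for s
  proof -
    have s: "s \<in> M" "s \<in> D" "s \<in> mtopology closure_of G" using that S EM by (auto simp: E_def)
    obtain e where e: "e > 0" "U \<inter> mball s e \<subseteq> {s}" using U s unfolding sparse_def by blast
    define r where "r = min e (\<epsilon>/8)"
    have r: "r > 0" "r \<le> e" "r \<le> \<epsilon>/8" using e \<open>\<epsilon> > 0\<close> by (auto simp: r_def)
    have "mball s r \<inter> G \<noteq> {}" using s r unfolding closure_of_meets_iff by simp
    then have "mball s r \<inter> G - D \<noteq> {}"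
      using closed_nwd_avoid[OF D openin_Int[OF openin_mball G]] by blast
    then obtain p where p: "p \<in> G" "p \<notin> D" "p \<in> mball s r" by blast
    then have "p \<in> mball s e" using mball_subset_concentric[OF r(2)] by blast
    then have "p \<notin> U" using e s p by blast
    then show ?thesis using p r by auto
  qed
  then obtain p where p: "\<And>s. s \<in> S \<Longrightarrow> p s \<in> G - D - U" "\<And>s. s \<in> S \<Longrightarrow> d s (p s) < \<epsilon>/8" by metis
  have GM: "G \<subseteq> M" using openin_subset[OF G] by simp
  have pM: "p s \<in> M" if "s \<in> S" for s using p(1)[OF that] GM by blast
  have sM: "s \<in> M" if "s \<in> S" for s using that S EM by blast
  have "sparse (p ` S)"
  proof (rule sparse_separated)
    show "p ` S \<subseteq> M" using pM by blast
    show "\<epsilon>/4 > 0" using \<open>\<epsilon> > 0\<close> by simp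
    fix u v assume "u \<in> p ` S" "v \<in> p ` S" "u \<noteq> v"
    then obtain s t where st: "s \<in> S" "t \<in> S" "u = p s" "v = p t" "s \<noteq> t" by blast
    have "d s t \<le> d s u + d u v + d v t"
      using triangle[of s u t] triangle[of u v t] st sM pM by simp
    then show "\<epsilon>/4 \<le> d u v"
      using S(2)[OF st(1,2,5)] p(2)[OF st(1)] p(2)[OF st(2)] commute[of v t] unfolding st(3,4) by linarith
  qed
  moreover have "\<exists>q\<in>p ` S. d x q < \<epsilon>" if x: "x \<in> E" for x
  proof -
    obtain s where s: "s \<in> S" "d x s < \<epsilon>/2" using S(3)[OF x] by blast
    have "d x (p s) \<le> d x s + d s (p s)" using triangle sM[OF s(1)] pM[OF s(1)] x EM by blast
    then have "d x (p s) < \<epsilon>" using s(2) p(2)[OF s(1)] \<open>\<epsilon> > 0\<close> by linarith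
    then show ?thesis using s by blast
  qed
  moreover have "\<exists>x\<in>D. d x q < \<epsilon>" if "q \<in> p ` S" for q
  proof -
    obtain s where s: "s \<in> S" "q = p s" using \<open>q \<in> p ` S\<close> by blast
    then have "s \<in> D" "d s q < \<epsilon>" using S(1) p(2)[of s] \<open>\<epsilon> > 0\<close> by (auto simp: E_def)
    then show ?thesis by blast
  qed
  moreover have "p ` S \<subseteq> G - D - U" using p(1) by blast
  ultimately show ?thesis unfolding E_def by (intro exI[of _ "p ` S"] conjI ballI)
qed

text \<open>The \<open>V j\<close> are unions of tiny balls around nets that become finer towards
  \<open>D\<close>. Since every label receives nets of arbitrarily small mesh, \<open>V j\<close>
  clusters at all of \<open>D \<inter> mtopology closure_of G j\<close>, while off \<open>D\<close>
  the balls are so isolated that closures commute with unions.\<close>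

lemma scattered_family:
  fixes G :: "nat \<Rightarrow> 'a set"
  assumes D: "closed_nwd mtopology D" and G: "\<And>j. openin mtopology (G j)"
  shows "\<exists>V. (\<forall>j. openin mtopology (V j) \<and> V j \<inter> D = {} \<and>
       D \<inter> mtopology closure_of G j \<subseteq> mtopology closure_of V j \<and> mtopology closure_of V j \<subseteq> G j \<union> D) \<and>
     (\<forall>j k. j \<noteq> k \<longrightarrow> mtopology closure_of V j \<inter> mtopology closure_of V k \<subseteq> D) \<and>
     (\<forall>T. mtopology closure_of (\<Union>j\<in>T. V j) \<subseteq> (\<Union>j\<in>T. mtopology closure_of V j) \<union> D)"
proof -
  \<comment> \<open>Each label occurs at arbitrarily late stages \<open>l\<close>, where the mesh
    \<open>inverse (Suc l)\<close> is small.\<close>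
  define j where "j l = fst (prod_decode l)" for l
  have j_inf: "\<exists>l\<ge>n. j l = i" for i n
    by (intro exI[of _ "prod_encode (i, n)"]) (simp add: j_def le_prod_encode_2)
  define P where "P f l Q \<longleftrightarrow> Q \<subseteq> G (j l) - D - (\<Union>k<l. f k) \<and> sparse Q \<and>
      (\<forall>x\<in>D \<inter> mtopology closure_of G (j l). \<exists>q\<in>Q. d x q < inverse (Suc l)) \<and>
      (\<forall>q\<in>Q. \<exists>x\<in>D. d x q < inverse (Suc l))" for f :: "nat \<Rightarrow> 'a set" and l Q
  have "\<exists>Q. \<forall>l. P Q l (Q l)"
  proof (rule dependent_wellorder_choice)
    fix f g :: "nat \<Rightarrow> 'a set" and l Q assume "\<And>k. k < l \<Longrightarrow> f k = g k"
    then have "(\<Union>k<l. f k) = (\<Union>k<l. g k)" by auto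
    then show "P f l Q = P g l Q" unfolding P_def by simp
  next
    fix l and f :: "nat \<Rightarrow> 'a set" assume "\<And>k. k < l \<Longrightarrow> P f k (f k)"
    then have "sparse (\<Union>k<l. f k)" by (intro sparse_finite_UN) (auto simp: P_def)
    from sparse_net[OF D G[of "j l"] this, of "inverse (Suc l)"] show "\<exists>Q. P f l Q"
      unfolding P_def by auto
  qed
  then obtain Q where "\<And>l. P Q l (Q l)" by blast
  then have Q: "\<And>l. Q l \<subseteq> G (j l) - D" "\<And>l k. k < l \<Longrightarrow> Q l \<inter> Q k = {}" "\<And>l. sparse (Q l)"
    "\<And>l x. x \<in> D \<Longrightarrow> x \<in> mtopology closure_of G (j l) \<Longrightarrow> \<exists>q\<in>Q l. d x q < inverse (Suc l)"
    "\<And>l q. q \<in> Q l \<Longrightarrow> \<exists>x\<in>D. d x q < inverse (Suc l)"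
    unfolding P_def by (blast, blast, blast, blast, blast)
  define QQ where "QQ = (\<Union>l. Q l)"
  have GM: "G i \<subseteq> M" for i using openin_subset[OF G] by simp
  have QM: "Q l \<subseteq> M" for l using Q(1) GM by blast
  then have QQM: "QQ \<subseteq> M" by (auto simp: QQ_def)
  have DM: "D \<subseteq> M" using D closedin_subset by (fastforce simp: closed_nwd_def)
  have off: "\<exists>r>0. mball x r \<inter> D = {}" if "x \<in> M - D" for x
  proof -
    have "openin mtopology (M - D)" using D by (metis closed_nwd_def openin_diff openin_topspace topspace_mtopology)
    then have "\<exists>r>0. mball x r \<subseteq> M - D" using that unfolding openin_mtopology by simp
    then obtain r where "r > 0" "mball x r \<subseteq> M - D" by blast
    then show ?thesis by blast
  qed
  \<comment> \<open>Late nets stay close to \<open>D\<close>, so near a point off \<open>D\<close>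
    only finitely many of the sparse sets \<open>Q l\<close> matter.\<close>
  have sparse_off: "\<exists>e>0. QQ \<inter> mball x e \<subseteq> {x}" if x: "x \<in> M - D" for x
  proof -
    obtain r where r: "r > 0" "mball x r \<inter> D = {}" using off[OF x] by blast
    obtain L where L: "inverse (real (Suc L)) < r/2" using reals_Archimedean[of "r/2"] r by auto
    have "sparse (\<Union>l<L. Q l)" using Q(3) by (intro sparse_finite_UN) auto
    then obtain e where e: "e > 0" "(\<Union>l<L. Q l) \<inter> mball x e \<subseteq> {x}" using x unfolding sparse_def by blast
    have "QQ \<inter> mball x (min e (r/2)) \<subseteq> {x}"
    proof
      fix q assume q: "q \<in> QQ \<inter> mball x (min e (r/2))"
      then obtain l where l: "q \<in> Q l" by (auto simp: QQ_def)
      show "q \<in> {x}"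
      proof (cases "l < L")
        case True
        then show ?thesis using e q l by auto
      next
        case False
        obtain y where y: "y \<in> D" "d y q < inverse (Suc l)" using Q(5)[OF l] by blast
        have "inverse (real (Suc l)) \<le> inverse (real (Suc L))" using False by simp
        moreover have "d x y \<le> d x q + d y q"
          using triangle[of x q y] x y(1) l QM DM commute[of q y] by (simp add: subset_iff)
        moreover have "d x q < r/2" using q by simp
        ultimately have "d x y < r" using y(2) L by linarith
        then have "y \<in> mball x r \<inter> D" using x y DM by auto
        then show ?thesis using r by blast
      qed
    qed
    then show ?thesis using e r by (intro exI[of _ "min e (r/2)"]) auto
  qed
  have lab: "\<exists>l. q \<in> Q l" if "q \<in> QQ" for q using that by (auto simp: QQ_def)
  have "\<exists>\<rho>>0. QQ \<inter> mball q (4 * \<rho>) \<subseteq> {q} \<and> mball q (2 * \<rho>) \<inter> D = {} \<and> (\<forall>l. q \<in> Q l \<longrightarrow> mball q (2 * \<rho>) \<subseteq> G (j l))"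
    if q: "q \<in> QQ" for q
  proof -
    obtain l where l: "q \<in> Q l" using lab[OF q] by blast
    have uniq: "l' = l" if "q \<in> Q l'" for l' using Q(2)[of l l'] Q(2)[of l' l] l that by (metis disjoint_iff linorder_neqE_nat)
    have qD: "q \<in> M - D" using Q(1) QM l by blast
    obtain r where r: "r > 0" "mball q r \<inter> D = {}" using off[OF qD] by blast
    obtain e where e: "e > 0" "QQ \<inter> mball q e \<subseteq> {q}" using sparse_off[OF qD] by blast
    have "q \<in> G (j l)" using Q(1) l by blast
    then obtain s where s: "s > 0" "mball q s \<subseteq> G (j l)" using G[of "j l"] unfolding openin_mtopology by blast
    \<comment> \<open>Radius \<open>4 * \<rho>\<close> isolates \<open>q\<close> among the centres;
      radius \<open>2 * \<rho>\<close> keeps even the closure of the ball of radius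
      \<open>\<rho>\<close> inside \<open>G (j l)\<close> and off \<open>D\<close>.\<close>
    define \<rho> where "\<rho> = min (min r s) e / 4"
    have "\<rho> > 0" "4 * \<rho> \<le> e" "2 * \<rho> \<le> r" "2 * \<rho> \<le> s" using r e s by (auto simp: \<rho>_def)
    moreover have "mball q (4 * \<rho>) \<subseteq> mball q e" "mball q (2 * \<rho>) \<subseteq> mball q r" "mball q (2 * \<rho>) \<subseteq> mball q s"
      using calculation by (intro mball_subset_concentric; simp)+
    ultimately show ?thesis using r e s uniq by (intro exI[of _ \<rho>]) blast
  qed
  then obtain \<rho> where \<rho>: "\<And>q. q \<in> QQ \<Longrightarrow> \<rho> q > 0" "\<And>q. q \<in> QQ \<Longrightarrow> QQ \<inter> mball q (4 * \<rho> q) \<subseteq> {q}"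
    "\<And>q. q \<in> QQ \<Longrightarrow> mball q (2 * \<rho> q) \<inter> D = {}" "\<And>q l. q \<in> Q l \<Longrightarrow> mball q (2 * \<rho> q) \<subseteq> G (j l)"
    unfolding QQ_def by (metis UN_I UNIV_I)
  define V where "V i = (\<Union>q\<in>(\<Union>l\<in>{l. j l = i}. Q l). mball q (\<rho> q))" for i
  have single: "\<exists>e>0. \<exists>q\<in>QQ. (\<forall>q'\<in>QQ. mball q' (\<rho> q') \<inter> mball x e \<noteq> {} \<longrightarrow> q' = q) \<and> e \<le> \<rho> q"
    if x: "x \<in> M - D" and ne: "QQ \<noteq> {}" for x
  proof -
    obtain e where e: "e > 0" "QQ \<inter> mball x e \<subseteq> {x}" using sparse_off[OF x] by blast
    \<comment> \<open>Two such balls give \<open>d q q' < e + \<rho> q + \<rho> q'\<close>, while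
      both radii are at most \<open>d q q' / 4\<close>. So both radii are below \<open>e/2\<close>
      and both centres fall into \<open>mball x e\<close>, which contains no centre other than
      \<open>x\<close>.\<close>
    have same: "q = q'" if q: "q \<in> QQ" "q' \<in> QQ" "mball q (\<rho> q) \<inter> mball x (e/2) \<noteq> {}"
      "mball q' (\<rho> q') \<inter> mball x (e/2) \<noteq> {}" for q q'
    proof (rule ccontr)
      assume "q \<noteq> q'"
      have qM: "q \<in> M" "q' \<in> M" using q QQM by auto
      obtain u v where uv: "u \<in> M" "d q u < \<rho> q" "d x u < e/2" "v \<in> M" "d q' v < \<rho> q'" "d x v < e/2"
        using q by auto
      have "d x q < e/2 + \<rho> q" "d x q' < e/2 + \<rho> q'"
        using triangle[of x u q] triangle[of x v q'] uv qM x commute[of u q] commute[of v q'] by auto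
      moreover have "d q q' \<le> d x q + d x q'" using triangle[of q x q'] qM x commute[of q x] by auto
      moreover have "4 * \<rho> q \<le> d q q'" "4 * \<rho> q' \<le> d q q'"
        using \<rho>(2)[OF q(1)] \<rho>(2)[OF q(2)] \<open>q \<noteq> q'\<close> q qM commute[of q q'] by (auto simp: not_less[symmetric])
      ultimately have "d x q < e" "d x q' < e" using \<rho>(1)[OF q(1)] \<rho>(1)[OF q(2)] by linarith+
      then have "q = x" "q' = x" using e q qM x by auto
      then show False using \<open>q \<noteq> q'\<close> by simp
    qed
    show ?thesis
    proof (cases "\<exists>q\<in>QQ. mball q (\<rho> q) \<inter> mball x (e/2) \<noteq> {}")
      case True
      then obtain q where q: "q \<in> QQ" "mball q (\<rho> q) \<inter> mball x (e/2) \<noteq> {}" by blast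
      have "mball x (min (e/2) (\<rho> q)) \<subseteq> mball x (e/2)" by (intro mball_subset_concentric) simp
      then have "q' = q" if "q' \<in> QQ" "mball q' (\<rho> q') \<inter> mball x (min (e/2) (\<rho> q)) \<noteq> {}" for q'
        using same[OF that(1) q(1) _ q(2)] that(2) by blast
      then show ?thesis using q e \<rho>(1)[OF q(1)]
        by (intro exI[of _ "min (e/2) (\<rho> q)"] conjI bexI[of _ q]) auto
    next
      case False
      obtain q where q: "q \<in> QQ" using ne by blast
      have "mball x (min (e/2) (\<rho> q)) \<subseteq> mball x (e/2)" by (intro mball_subset_concentric) simp
      then show ?thesis using q e \<rho>(1)[OF q] False
        by (intro exI[of _ "min (e/2) (\<rho> q)"] conjI bexI[of _ q]) auto
    qed
  qed
  have VQ: "\<exists>q\<in>QQ. mball q (\<rho> q) \<inter> W \<noteq> {} \<and> (\<exists>l. q \<in> Q l \<and> j l = i)" if "V i \<inter> W \<noteq> {}" for i W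
    using that unfolding V_def QQ_def by blast
  text \<open>Every point off \<open>D\<close> has a neighbourhood that meets only one of the balls.\<close>
  have main: "\<exists>l q. q \<in> Q l \<and> x \<in> mball q (2 * \<rho> q) \<and> x \<in> mtopology closure_of V (j l) \<and> j l \<in> T \<and>
      (\<forall>i. x \<in> mtopology closure_of V i \<longrightarrow> i = j l)"
    if x: "x \<in> mtopology closure_of (\<Union>i\<in>T. V i)" "x \<notin> D" for x T
  proof -
    have xM: "x \<in> M" using x(1) by (simp add: closure_of_meets_iff)
    have hit: "(\<Union>i\<in>T. V i) \<inter> mball x e \<noteq> {}" if "e > 0" for e
      using x(1) xM that unfolding closure_of_meets_iff by fastforce
    have "QQ \<noteq> {}" using hit[of 1] by (auto simp: V_def QQ_def)
    then obtain e q where e: "e > 0" "e \<le> \<rho> q" and q: "q \<in> QQ"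
      and only: "\<And>q'. q' \<in> QQ \<Longrightarrow> mball q' (\<rho> q') \<inter> mball x e \<noteq> {} \<Longrightarrow> q' = q"
      using single[of x] xM x(2) by blast
    obtain l where l: "q \<in> Q l" using lab[OF q] by blast
    have uniq: "l' = l" if "q \<in> Q l'" for l' using Q(2)[of l l'] Q(2)[of l' l] l that by (metis disjoint_iff linorder_neqE_nat)
    have only_i: "i = j l \<and> mball q (\<rho> q) \<inter> mball x e' \<noteq> {}"
      if ne: "V i \<inter> mball x e' \<noteq> {}" and le: "e' \<le> e" for i e'
    proof -
      obtain q' l' where q': "q' \<in> QQ" "mball q' (\<rho> q') \<inter> mball x e' \<noteq> {}" "q' \<in> Q l'" "j l' = i"
        using VQ[OF ne] by blast
      have "mball x e' \<subseteq> mball x e" using le by (rule mball_subset_concentric)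
      then have "q' = q" using only q' by blast
      then show ?thesis using q' uniq by blast
    qed
    have hitq: "j l \<in> T \<and> mball q (\<rho> q) \<inter> mball x e' \<noteq> {}" if "e' > 0" "e' \<le> e" for e'
      using hit[OF that(1)] only_i[OF _ that(2)] by blast
    have qV: "mball q (\<rho> q) \<subseteq> V (j l)" using l by (auto simp: V_def)
    have "x \<in> mtopology closure_of V (j l)"
      unfolding metric_closure_of
    proof (intro CollectI conjI allI impI)
      fix r :: real assume "r > 0"
      then have "mball q (\<rho> q) \<inter> mball x (min r e) \<noteq> {}" using hitq[of "min r e"] e by auto
      moreover have "mball x (min r e) \<subseteq> mball x r" by (intro mball_subset_concentric) simp
      ultimately show "\<exists>y\<in>V (j l). y \<in> mball x r" using qV by blast
    qed (rule xM)
    moreover have "x \<in> mball q (2 * \<rho> q)"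
    proof -
      obtain u where "u \<in> M" "d q u < \<rho> q" "d x u < e" using hitq[OF e(1) order_refl] by auto
      then show ?thesis using triangle[of q u x] e xM q QQM commute[of u x] by auto
    qed
    moreover have "i = j l" if "x \<in> mtopology closure_of V i" for i
    proof -
      have "V i \<inter> mball x e \<noteq> {}" using that xM e unfolding closure_of_meets_iff by fastforce
      then show ?thesis using only_i by blast
    qed
    ultimately show ?thesis using l hitq[OF e(1) order_refl] by blast
  qed
  have single_T: "(\<Union>i\<in>{k}. V i) = V k" for k by simp
  show ?thesis
  proof (intro exI[of _ V] conjI allI impI)
    fix i k
    show "openin mtopology (V i)" unfolding V_def by auto
    show "V i \<inter> D = {}"
    proof -
      have "mball q (\<rho> q) \<inter> D = {}" if "q \<in> QQ" for q
        using \<rho>(3)[OF that] mball_subset_concentric[of "\<rho> q" "2 * \<rho> q" q] \<rho>(1)[OF that] by fastforce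
      then show ?thesis unfolding V_def QQ_def by blast
    qed
    show "D \<inter> mtopology closure_of G i \<subseteq> mtopology closure_of V i"
    proof
      fix x assume x: "x \<in> D \<inter> mtopology closure_of G i"
      show "x \<in> mtopology closure_of V i"
        unfolding metric_closure_of
      proof (intro CollectI conjI allI impI)
        show "x \<in> M" using x DM by blast
        fix r :: real assume "r > 0"
        then obtain n where n: "inverse (real (Suc n)) < r" using reals_Archimedean by blast
        obtain l where l: "l \<ge> n" "j l = i" using j_inf by blast
        obtain q where q: "q \<in> Q l" "d x q < inverse (Suc l)" using Q(4)[of x l] x l by auto
        have "inverse (real (Suc l)) \<le> inverse (real (Suc n))" using l by simp
        then have "d x q < r" using q n by linarith
        moreover have qM: "q \<in> M" using q QM by blast
        moreover have "q \<in> mball q (\<rho> q)" using \<rho>(1)[of q] q qM by (auto simp: QQ_def)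
        then have "q \<in> V i" using q(1) l(2) unfolding V_def by blast
        ultimately show "\<exists>y\<in>V i. y \<in> mball x r" using x DM by auto
      qed
    qed
    show "mtopology closure_of V i \<subseteq> G i \<union> D"
    proof
      fix x assume "x \<in> mtopology closure_of V i"
      then show "x \<in> G i \<union> D" using main[of x "{i}"] \<rho>(4) unfolding single_T by blast
    qed
    show "mtopology closure_of V i \<inter> mtopology closure_of V k \<subseteq> D" if "i \<noteq> k"
      using main[of _ "{i}"] that unfolding single_T by blast
    show "mtopology closure_of (\<Union>i\<in>T. V i) \<subseteq> (\<Union>i\<in>T. mtopology closure_of V i) \<union> D" for T
    proof
      fix x assume "x \<in> mtopology closure_of (\<Union>i\<in>T. V i)"
      then show "x \<in> (\<Union>i\<in>T. mtopology closure_of V i) \<union> D" using main[of x T] by blast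
    qed
  qed
qed

end

section \<open>Approximation by quasi-continuous functions\<close>

lemma quasi_continuous_at_cong_open:
  assumes "quasi_continuous_at X g x" "openin X N" "x \<in> N" "\<And>y. y \<in> N \<Longrightarrow> f y = g y"
  shows "quasi_continuous_at X f x"
  unfolding quasi_continuous_at_def
proof (intro allI impI)
  fix \<epsilon> :: real and U assume "\<epsilon> > 0" and U: "openin X U \<and> x \<in> U"
  then obtain V where V: "openin X V" "V \<noteq> {}" "V \<subseteq> U \<inter> N" "\<forall>y\<in>V. \<bar>g y - g x\<bar> < \<epsilon>"
    using assms(1-3) openin_Int unfolding quasi_continuous_at_def by (metis IntI)
  then show "\<exists>V. openin X V \<and> V \<noteq> {} \<and> V \<subseteq> U \<and> (\<forall>y\<in>V. \<bar>f y - f x\<bar> < \<epsilon>)"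
    using assms(3,4) by (intro exI[of _ V]) auto
qed

context Metric_space
begin

text \<open>Near \<open>D\<close> the function is constant on small balls, with rational values all of which occur
  near every point of \<open>D \<inter> closure G\<close>. Hence it may take arbitrary values there. The sets \<open>R i\<close> keep
  room for later patches.\<close>

lemma quasi_continuous_patch:
  fixes f g :: "'a \<Rightarrow> real" and R :: "nat \<Rightarrow> 'a set"
  assumes D: "closed_nwd mtopology D" and G: "openin mtopology G" and R: "\<And>i. openin mtopology (R i)"
    and "r > 0"
    and g: "\<And>x. x \<in> M \<Longrightarrow> x \<notin> D \<inter> mtopology closure_of G \<Longrightarrow> quasi_continuous_at mtopology g x"
  shows "\<exists>F W. F \<in> QC mtopology \<and> closedin mtopology W \<and>
    (\<forall>x\<in>D \<inter> mtopology closure_of G. F x = f x) \<and> (\<forall>x\<in>M - W. F x = g x) \<and>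
    W - D \<subseteq> G \<and> (\<forall>x\<in>W - D. \<exists>y\<in>D. d y x < r) \<and>
    (\<forall>i. D \<inter> mtopology closure_of R i \<subseteq> mtopology closure_of (R i - W))"
proof -
  have DM: "D \<subseteq> M" using D closedin_subset by (fastforce simp: closed_nwd_def)
  \<comment> \<open>Restricting the patch to \<open>N\<close> is what confines the change to
    distance less than \<open>r\<close> from \<open>D\<close>.\<close>
  define N where "N = (\<Union>y\<in>D. mball y r)"
  have N: "openin mtopology N" "D \<subseteq> N" using DM \<open>r > 0\<close> by (auto simp: N_def)
  define E where "E = D \<inter> mtopology closure_of G"
  have E_eq: "E \<subseteq> D \<inter> mtopology closure_of (G \<inter> N)"
  proof
    fix x assume x: "x \<in> E"
    have "U \<inter> (G \<inter> N) \<noteq> {}" if "openin mtopology U" "x \<in> U" for U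
    proof -
      have "x \<in> U \<inter> N" using that x N by (auto simp: E_def)
      moreover have "x \<in> mtopology closure_of G" using x by (simp add: E_def)
      ultimately have "U \<inter> N \<inter> G \<noteq> {}" using closure_of_meets openin_Int[OF that(1) N(1)] by metis
      then show ?thesis by blast
    qed
    moreover have "x \<in> D" "x \<in> M" using x DM by (auto simp: E_def)
    ultimately show "x \<in> D \<inter> mtopology closure_of (G \<inter> N)"
      by (simp add: closure_of_meets_iff)
  qed
  \<comment> \<open>Even indices carry the prescribed values; odd indices reserve, near
    \<open>D\<close>, a part of each \<open>R i\<close> that the patch leaves untouched.\<close>
  define G' where "G' i = (if even i then G \<inter> N else R (i div 2))" for i :: nat
  have "openin mtopology (G' i)" for i using G R N by (auto simp: G'_def)
  from scattered_family[of D G', OF D this] obtain V where V_all: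
    "\<forall>j. openin mtopology (V j) \<and> V j \<inter> D = {} \<and>
       D \<inter> mtopology closure_of G' j \<subseteq> mtopology closure_of V j \<and> mtopology closure_of V j \<subseteq> G' j \<union> D"
    "\<forall>j k. j \<noteq> k \<longrightarrow> mtopology closure_of V j \<inter> mtopology closure_of V k \<subseteq> D"
    "\<forall>T. mtopology closure_of (\<Union>j\<in>T. V j) \<subseteq> (\<Union>j\<in>T. mtopology closure_of V j) \<union> D"
    by (elim exE conjE)
  have V: "\<And>i. openin mtopology (V i)" "\<And>i. V i \<inter> D = {}"
    "\<And>i. D \<inter> mtopology closure_of G' i \<subseteq> mtopology closure_of V i" "\<And>i. mtopology closure_of V i \<subseteq> G' i \<union> D"
    "\<And>i k. i \<noteq> k \<Longrightarrow> mtopology closure_of V i \<inter> mtopology closure_of V k \<subseteq> D"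
    "\<And>T. mtopology closure_of (\<Union>i\<in>T. V i) \<subseteq> (\<Union>i\<in>T. mtopology closure_of V i) \<union> D"
    using V_all by simp_all
  have VC: "V i \<subseteq> mtopology closure_of V i" for i
    using closure_of_subset[OF openin_subset[OF V(1)]] .
  define C where "C i = mtopology closure_of V (2 * i)" for i
  define W where "W = mtopology closure_of (\<Union>i\<in>range (\<lambda>i. 2 * i). V i)"
  have CW: "C i \<subseteq> W" for i unfolding C_def W_def by (intro closure_of_mono) auto
  have WC: "\<exists>i. x \<in> C i" if "x \<in> W" "x \<notin> D" for x
    using that V(6)[of "range (\<lambda>i. 2 * i)"] unfolding W_def C_def by blast
  have EC: "E \<subseteq> C i" for i
    using E_eq V(3)[of "2 * i"] unfolding C_def G'_def by auto
  have CD: "C i \<inter> D \<subseteq> E" for i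
  proof -
    have "V (2 * i) \<subseteq> G" using VC[of "2 * i"] V(4)[of "2 * i"] V(2)[of "2 * i"] by (auto simp: G'_def)
    then show ?thesis unfolding C_def E_def using closure_of_mono by blast
  qed
  define q :: "nat \<Rightarrow> real" where "q = from_nat_into \<rat>"
  have dense: "\<exists>i. \<bar>q i - a\<bar> < \<epsilon>" if "\<epsilon> > 0" for a \<epsilon>
  proof -
    have "a < a + \<epsilon>" using that by simp
    then obtain b where "b \<in> \<rat>" "a < b" "b < a + \<epsilon>" using Rats_dense_in_real by blast
    moreover obtain i where "q i = b"
      unfolding q_def using from_nat_into_surj[OF countable_rat \<open>b \<in> \<rat>\<close>] by blast
    ultimately show ?thesis by (intro exI[of _ i]) auto
  qed
  define F where "F x = (if x \<in> E then f x else if \<exists>i. x \<in> C i then q (THE i. x \<in> C i) else g x)" for x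
  have Fq: "F x = q i" if "x \<in> C i" "x \<notin> E" for x i
  proof -
    have "k = i" if "x \<in> C k" for k
      using V(5)[of "2 * k" "2 * i"] \<open>x \<in> C i\<close> \<open>x \<notin> E\<close> that CD[of i] unfolding C_def by fastforce
    then have "(THE i. x \<in> C i) = i" using that by (intro the_equality)
    then show ?thesis using that by (auto simp: F_def)
  qed
  have FV: "F y = q i" if "y \<in> V (2 * i)" for y i
    using Fq[of y i] that VC V(2)[of "2 * i"] unfolding C_def E_def by blast
  have Fg: "F x = g x" if "x \<notin> W" for x
    using that CW EC[of 0] by (auto simp: F_def)
  have near: "quasi_continuous_at mtopology F x"
    if appr: "\<And>\<epsilon>. \<epsilon> > 0 \<Longrightarrow> \<exists>i. x \<in> C i \<and> \<bar>q i - F x\<bar> < \<epsilon>" for x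
    unfolding quasi_continuous_at_def
  proof (intro allI impI)
    fix \<epsilon> :: real and U assume "\<epsilon> > 0" and U: "openin mtopology U \<and> x \<in> U"
    obtain i where i: "x \<in> C i" "\<bar>q i - F x\<bar> < \<epsilon>" using appr[OF \<open>\<epsilon> > 0\<close>] by blast
    have "U \<inter> V (2 * i) \<noteq> {}" using i(1) U closure_of_meets unfolding C_def by metis
    moreover have "openin mtopology (U \<inter> V (2 * i))" using U V(1) by blast
    ultimately show "\<exists>V. openin mtopology V \<and> V \<noteq> {} \<and> V \<subseteq> U \<and> (\<forall>y\<in>V. \<bar>F y - F x\<bar> < \<epsilon>)"
      using FV i(2) by (intro exI[of _ "U \<inter> V (2 * i)"]) auto
  qed
  have "quasi_continuous_at mtopology F x" if "x \<in> M" for x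
  proof -
    consider "x \<in> E" | i where "x \<notin> E" "x \<in> C i" | "x \<notin> E" "\<And>i. x \<notin> C i" by blast
    then show ?thesis
    proof cases
      case 1
      then show ?thesis using EC dense by (intro near) blast
    next
      case 2
      then show ?thesis using Fq by (intro near) (auto intro!: exI[of _ i])
    next
      \<comment> \<open>This happens only off \<open>W\<close>: a point of \<open>W\<close> in no
        \<open>C i\<close> would lie in \<open>D\<close>, and as \<open>W\<close> is contained in
        the closure of \<open>G\<close> it would belong to \<open>E\<close>.\<close>
      case 3
      show ?thesis
      proof (cases "x \<in> W")
        case False
        have "openin mtopology (M - W)"
          unfolding W_def by (metis openin_diff openin_topspace closedin_closure_of topspace_mtopology)
        then show ?thesis
          using quasi_continuous_at_cong_open[OF g, of x "M - W" F] Fg False that 3 by (auto simp: E_def)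
      next
        case True
        have "x \<in> D" using WC True 3 by blast
        have "x \<notin> mtopology closure_of G" using \<open>x \<in> D\<close> 3 by (simp add: E_def)
        moreover have "V (2 * i) \<subseteq> G" for i
          using VC[of "2 * i"] V(4)[of "2 * i"] V(2)[of "2 * i"] by (auto simp: G'_def)
        then have "W \<subseteq> mtopology closure_of G" unfolding W_def by (intro closure_of_mono) blast
        ultimately show ?thesis using True by blast
      qed
    qed
  qed
  then have "F \<in> QC mtopology" by (simp add: QC_def)
  moreover have "W - D \<subseteq> G \<inter> N"
  proof
    fix x assume "x \<in> W - D"
    then obtain i where "x \<in> C i" using WC by blast
    then show "x \<in> G \<inter> N" using V(4)[of "2 * i"] \<open>x \<in> W - D\<close> by (auto simp: C_def G'_def)
  qed
  moreover have "D \<inter> mtopology closure_of R i \<subseteq> mtopology closure_of (R i - W)" for i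
  proof -
    have "G' (2 * i + 1) = R i" by (simp add: G'_def)
    then have V': "D \<inter> mtopology closure_of R i \<subseteq> mtopology closure_of V (2 * i + 1)" "V (2 * i + 1) \<subseteq> R i"
      using V(3)[of "2 * i + 1"] V(4)[of "2 * i + 1"] VC[of "2 * i + 1"] V(2)[of "2 * i + 1"] by auto
    have "V (2 * i + 1) \<inter> W = {}"
    proof (rule ccontr)
      assume "V (2 * i + 1) \<inter> W \<noteq> {}"
      then obtain x where x: "x \<in> V (2 * i + 1)" "x \<in> W" by blast
      then have "x \<notin> D" using V(2)[of "2 * i + 1"] by blast
      then obtain k where "x \<in> C k" using WC x by blast
      moreover have "2 * i + 1 \<noteq> 2 * k" by presburger
      ultimately show False using V(5)[of "2 * i + 1" "2 * k"] x(1) VC \<open>x \<notin> D\<close> unfolding C_def by blast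
    qed
    then have "mtopology closure_of V (2 * i + 1) \<subseteq> mtopology closure_of (R i - W)"
      using V' by (intro closure_of_mono) blast
    then show ?thesis using V' by blast
  qed
  moreover have "closedin mtopology W" by (simp add: W_def)
  moreover have "F x = f x" if "x \<in> E" for x using that by (simp add: F_def)
  moreover have "\<exists>y\<in>D. d y x < r" if "x \<in> N" for x
    using that by (auto simp: N_def)
  ultimately show ?thesis
    using Fg unfolding E_def by (intro exI[of _ F] exI[of _ W]) blast
qed

section \<open>The recursive construction of an approximating sequence\<close>

lemma closedin_far:
  assumes "closedin mtopology D" "x \<in> M" "x \<notin> D"
  shows "\<exists>r>0. \<forall>y\<in>D. r \<le> d y x"
proof -
  have "openin mtopology (M - D)" using assms(1) by (metis openin_diff openin_topspace topspace_mtopology)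
  then have "\<exists>r>0. mball x r \<subseteq> M - D" using assms by (simp add: openin_mtopology)
  then obtain r where r: "r > 0" "mball x r \<subseteq> M - D" by blast
  have "r \<le> d y x" if "y \<in> D" for y
  proof (rule ccontr)
    assume "\<not> r \<le> d y x"
    moreover have "y \<in> M" using that closedin_subset[OF assms(1)] by auto
    ultimately have "y \<in> mball x r" using assms(2) by (simp add: commute)
    then show False using r that by blast
  qed
  then show ?thesis using r by blast
qed

text \<open>\<open>F n\<close> equals \<open>f\<close> on the part of \<open>D (\<kappa> n)\<close>
  in the closure of its permitted region, and \<open>g n\<close> outside \<open>W n\<close>. Off all
  \<open>D k\<close> the patches through a point obey the avoidance rule. At a point of some
  \<open>D m\<close>, an index whose region does not come near must lie in \<open>B k\<close> for
  one of finitely many earlier patches \<open>k\<close> of low level. The levels turn both facts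
  into membership in \<open>I\<close>.\<close>

theorem equal_limit_construction:
  fixes f :: "'a \<Rightarrow> real" and e :: "nat \<Rightarrow> real"
  defines "C \<equiv> \<lambda>A k. (\<Union>i<k. A i :: nat set)"
  assumes I: "ideal_on_nat I" and B: "avoidance_system (ideal_join_seq I A) B"
    and \<kappa>: "\<And>n k. n \<in> C A k \<Longrightarrow> \<kappa> n < k" "\<And>k. finite ({n. \<kappa> n < k} - C A k)"
    and D: "\<And>k. closed_nwd mtopology (D k)" and D_mono: "incseq D" and e: "\<And>n. e n > 0"
    and g: "\<And>n. g n \<in> QC mtopology"
    and approx: "\<And>x. x \<in> M \<Longrightarrow> {n. x \<notin> D (\<kappa> n) \<and> e n \<le> \<bar>g n x - f x\<bar>} \<in> I"
  shows "\<exists>F. (\<forall>n. F n \<in> QC mtopology) \<and> (\<forall>x\<in>M. {n. e n \<le> \<bar>F n x - f x\<bar>} \<in> I)"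
proof -
  have C_mono: "C A k \<subseteq> C A l" if "k \<le> l" for k l unfolding C_def using that by force
  have "\<exists>L k. L \<in> I \<and> B n \<subseteq> L \<union> C A k \<and> \<kappa> n \<le> k" for n
  proof -
    have "B n \<in> ideal_join_seq I A" using B by (auto simp: avoidance_system_def)
    then obtain k where "B n - C A k \<in> I" unfolding ideal_join_seq_iff[OF I] C_def by blast
    moreover have "B n \<subseteq> (B n - C A k) \<union> C A (max k (\<kappa> n))" using C_mono[of k "max k (\<kappa> n)"] by auto
    ultimately show ?thesis by (intro exI[of _ "B n - C A k"] exI[of _ "max k (\<kappa> n)"]) auto
  qed
  then obtain L j where L: "\<And>n. L n \<in> I" "\<And>n. B n \<subseteq> L n \<union> C A (j n)" by metis
  define off where "off W S = M - (\<Union>k\<in>S. W k)" for W :: "nat \<Rightarrow> 'a set" and S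
  define N where "N n = {k. k < n \<and> n \<in> B k}" for n
  \<comment> \<open>Patch \<open>k\<close> also keeps off \<open>D (j k)\<close>. So if
    \<open>x \<in> D m\<close> lies in \<open>W k\<close> but not in \<open>D (\<kappa> k)\<close>,
    then \<open>j k < m\<close>, and elements of \<open>B k\<close> of level at least
    \<open>m\<close> are not in \<open>C A (j k)\<close>; they belong to
    \<open>L k \<in> I\<close>.\<close>
  define G where "G W n = off W (N n) - D (j n)" for W n
  define P where "P FW n FW' \<longleftrightarrow> (let F = fst FW'; W = snd FW'; W' = snd \<circ> FW in
     F \<in> QC mtopology \<and> closedin mtopology W \<and>
     (\<forall>x\<in>D (\<kappa> n) \<inter> mtopology closure_of G W' n. F x = f x) \<and> (\<forall>x\<in>M - W. F x = g n x) \<and>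
     W - D (\<kappa> n) \<subseteq> G W' n \<and> (\<forall>x\<in>W - D (\<kappa> n). \<exists>y\<in>D (\<kappa> n). d y x < inverse (Suc n)) \<and>
     (\<forall>S\<subseteq>{..<n}. D (\<kappa> n) \<inter> mtopology closure_of off W' S \<subseteq> mtopology closure_of (off W' S - W)))"
    for FW :: "nat \<Rightarrow> ('a \<Rightarrow> real) \<times> 'a set" and n FW'
  have N_fin: "finite (N n)" "N n \<subseteq> {..<n}" for n by (auto simp: N_def)
  have open_off: "openin mtopology (off W S)" if "finite S" "\<And>k. k \<in> S \<Longrightarrow> closedin mtopology (W k)" for W S
    proof -
    have "closedin mtopology (\<Union>(W ` S))" using that by (intro closedin_Union) auto
    then show ?thesis unfolding off_def by (metis openin_diff openin_topspace topspace_mtopology)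
  qed
  have "\<exists>FW. \<forall>n. P FW n (FW n)"
  proof (rule dependent_wellorder_choice)
    fix FW FW' :: "nat \<Rightarrow> ('a \<Rightarrow> real) \<times> 'a set" and n Z assume eq: "\<And>k. k < n \<Longrightarrow> FW k = FW' k"
    have off_eq: "off (snd \<circ> FW) S = off (snd \<circ> FW') S" if "S \<subseteq> {..<n}" for S
      using eq that by (auto simp: off_def subset_iff)
    then have "G (snd \<circ> FW) n = G (snd \<circ> FW') n" using N_fin by (simp add: G_def)
    then show "P FW n Z = P FW' n Z" unfolding P_def using off_eq by (simp add: Let_def)
  next
    fix FW :: "nat \<Rightarrow> ('a \<Rightarrow> real) \<times> 'a set" and n assume "\<And>k. k < n \<Longrightarrow> P FW k (FW k)"
    then have cl: "closedin mtopology ((snd \<circ> FW) k)" if "k < n" for k using that by (simp add: P_def Let_def)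
    \<comment> \<open>Which of the earlier patches matter depends on the later index, so room is
      kept for every subset of \<open>{..<n}\<close>; binary coding lists these subsets as a
      sequence.\<close>
    define R where "R i = off (snd \<circ> FW) (set_decode i \<inter> {..<n})" for i
    have R: "openin mtopology (R i)" for i unfolding R_def using cl by (intro open_off) auto
    have "openin mtopology (off (snd \<circ> FW) (N n))" using N_fin cl by (intro open_off) auto
    then have G: "openin mtopology (G (snd \<circ> FW) n)" unfolding G_def using D by (auto simp: closed_nwd_def)
    have "\<exists>F W. F \<in> QC mtopology \<and> closedin mtopology W \<and>
        (\<forall>x\<in>D (\<kappa> n) \<inter> mtopology closure_of G (snd \<circ> FW) n. F x = f x) \<and> (\<forall>x\<in>M - W. F x = g n x) \<and>
        W - D (\<kappa> n) \<subseteq> G (snd \<circ> FW) n \<and> (\<forall>x\<in>W - D (\<kappa> n). \<exists>y\<in>D (\<kappa> n). d y x < inverse (Suc n)) \<and>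
        (\<forall>i. D (\<kappa> n) \<inter> mtopology closure_of R i \<subseteq> mtopology closure_of (R i - W))"
      by (rule quasi_continuous_patch[OF D G R]) (use g[of n] in \<open>simp_all add: QC_def\<close>)
    then obtain F W where FW: "F \<in> QC mtopology" "closedin mtopology W"
       "\<forall>x\<in>D (\<kappa> n) \<inter> mtopology closure_of G (snd \<circ> FW) n. F x = f x" "\<forall>x\<in>M - W. F x = g n x"
       "W - D (\<kappa> n) \<subseteq> G (snd \<circ> FW) n" "\<forall>x\<in>W - D (\<kappa> n). \<exists>y\<in>D (\<kappa> n). d y x < inverse (Suc n)"
       and res: "\<forall>i. D (\<kappa> n) \<inter> mtopology closure_of R i \<subseteq> mtopology closure_of (R i - W)"
      by (elim exE conjE)
    have "D (\<kappa> n) \<inter> mtopology closure_of off (snd \<circ> FW) S \<subseteq> mtopology closure_of (off (snd \<circ> FW) S - W)"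
      if "S \<subseteq> {..<n}" for S
    proof -
      have "set_decode (set_encode S) \<inter> {..<n} = S"
        using that finite_subset[OF that] by (simp add: Int_absorb2)
      then show ?thesis using res[rule_format, of "set_encode S"] by (simp add: R_def)
    qed
    then have "P FW n (F, W)" unfolding P_def Let_def fst_conv snd_conv using FW by blast
    then show "\<exists>Z. P FW n Z" by blast
  qed
  then obtain FW where FW: "\<And>n. P FW n (FW n)" by blast
  define F where "F n = fst (FW n)" for n
  define W where "W n = snd (FW n)" for n
  have W_eq: "snd \<circ> FW = W" by (auto simp: W_def)
  have F: "\<And>n. F n \<in> QC mtopology" and W: "\<And>n. closedin mtopology (W n)"
    and Ff: "\<And>n x. x \<in> D (\<kappa> n) \<Longrightarrow> x \<in> mtopology closure_of G W n \<Longrightarrow> F n x = f x"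
    and Fg: "\<And>n x. x \<in> M \<Longrightarrow> x \<notin> W n \<Longrightarrow> F n x = g n x"
    and WG: "\<And>n. W n - D (\<kappa> n) \<subseteq> G W n"
    and Wd: "\<And>n x. x \<in> W n \<Longrightarrow> x \<notin> D (\<kappa> n) \<Longrightarrow> \<exists>y\<in>D (\<kappa> n). d y x < inverse (Suc n)"
    and Woff: "\<And>n S. S \<subseteq> {..<n} \<Longrightarrow>
        D (\<kappa> n) \<inter> mtopology closure_of off W S \<subseteq> mtopology closure_of (off W S - W n)"
    using FW unfolding P_def Let_def W_eq F_def[symmetric] W_def[symmetric] by (blast, blast, blast, blast, blast, blast, blast)
  have openW: "openin mtopology (off W S)" if "finite S" for S using open_off[OF that] W by blast
  have Dm: "D k \<subseteq> D l" if "k \<le> l" for k l using D_mono that by (rule incseqD)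
  \<comment> \<open>The patches of \<open>S\<close> are removed in increasing order. Since
    \<open>m \<le> \<kappa> n\<close>, the point lies in \<open>D (\<kappa> n)\<close>, and the room
    kept at stage \<open>n\<close> leaves it in the closure of what remains.\<close>
  have thin: "x \<in> mtopology closure_of off W S" if "x \<in> D m" "finite S" "\<forall>n\<in>S. m \<le> \<kappa> n" for x m S
    using that(2,3)
  proof (induction S rule: finite_linorder_max_induct)
    case empty
    have "x \<in> M" using that(1) D[of m] closedin_subset[of mtopology "D m"] by (auto simp: closed_nwd_def)
    then show ?case using closure_of_topspace[of mtopology] by (simp add: off_def)
  next
    case (insert n S)
    then have "x \<in> D (\<kappa> n) \<inter> mtopology closure_of off W S" using that(1) Dm by auto
    then have "x \<in> mtopology closure_of (off W S - W n)" using Woff[of S n] insert by auto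
    moreover have "off W S - W n = off W (insert n S)" by (auto simp: off_def)
    ultimately show ?case by simp
  qed
  \<comment> \<open>The patches of a fixed level \<open>k\<close> shrink to the closed set
    \<open>D k\<close>.\<close>
  have fin_level: "finite {n. \<kappa> n = k \<and> x \<in> W n}" if "x \<in> M" "x \<notin> D k" for x k
  proof -
    have "closedin mtopology (D k)" using D[of k] by (simp add: closed_nwd_def)
    from closedin_far[OF this that] obtain r where r: "r > 0" "\<forall>y\<in>D k. r \<le> d y x" by blast
    obtain n0 where n0: "inverse (real (Suc n0)) < r" using reals_Archimedean[OF r(1)] by blast
    have "n < n0" if n: "\<kappa> n = k" "x \<in> W n" for n
    proof (rule ccontr)
      assume "\<not> n < n0"
      then have "inverse (real (Suc n)) \<le> inverse (real (Suc n0))" by simp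
      moreover obtain y where "y \<in> D k" "d y x < inverse (Suc n)" using Wd[OF n(2)] n(1) \<open>x \<notin> D k\<close> by blast
      moreover from this have "r \<le> d y x" using r(2) by blast
      ultimately show False using n0 by linarith
    qed
    then show ?thesis by (auto intro: finite_subset[of _ "{..<n0}"])
  qed
  have fin_below: "finite {n. \<kappa> n < m \<and> x \<in> W n}" if "x \<in> M" "\<forall>k<m. x \<notin> D k" for x m
  proof -
    have "{n. \<kappa> n < m \<and> x \<in> W n} = (\<Union>k<m. {n. \<kappa> n = k \<and> x \<in> W n})" by auto
    then show ?thesis using fin_level that by simp
  qed
  have "{n. e n \<le> \<bar>F n x - f x\<bar>} \<in> I" if x: "x \<in> M" for x
  proof -
    define Z where "Z = {n. x \<notin> D (\<kappa> n) \<and> e n \<le> \<bar>g n x - f x\<bar>}"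
    have Z: "Z \<in> I" using approx[OF x] by (simp add: Z_def)
    show ?thesis
    proof (cases "\<exists>m. x \<in> D m")
      case False
      define H where "H = {n. x \<in> W n}"
      have "n' \<notin> B n" if "n \<in> H" "n' \<in> H" "n < n'" for n n'
      proof
        assume "n' \<in> B n"
        then have "n \<in> N n'" using that by (simp add: N_def)
        moreover have "x \<in> G W n'" using WG[of n'] that(2) False by (auto simp: H_def)
        ultimately show False using that(1) by (auto simp: G_def off_def H_def)
      qed
      then have "H \<in> ideal_join_seq I A" using B unfolding avoidance_system_def by blast
      then obtain k where k: "H - C A k \<in> I" unfolding ideal_join_seq_iff[OF I] C_def by blast
      \<comment> \<open>Indices in \<open>C A k\<close> have level below \<open>k\<close>, and only
        finitely many patches of these levels reach \<open>x\<close>; thus \<open>H\<close> lies in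
        \<open>I\<close> and not merely in the join.\<close>
      have "finite (H \<inter> C A k)"
        by (rule finite_subset[OF _ fin_below[OF x, of k]]) (use \<kappa>(1) False in \<open>auto simp: H_def\<close>)
      then have "(H - C A k) \<union> (H \<inter> C A k) \<in> I" using ideal_on_natD(1)[OF I k] ideal_on_natD(3)[OF I] by blast
      then have "(H - C A k) \<union> (H \<inter> C A k) \<union> Z \<in> I" using ideal_on_natD(1)[OF I] Z by blast
      moreover have "{n. e n \<le> \<bar>F n x - f x\<bar>} \<subseteq> (H - C A k) \<union> (H \<inter> C A k) \<union> Z"
      proof
        fix n assume "n \<in> {n. e n \<le> \<bar>F n x - f x\<bar>}"
        then show "n \<in> (H - C A k) \<union> (H \<inter> C A k) \<union> Z"
          using Fg[OF x, of n] False by (cases "x \<in> W n") (auto simp: H_def Z_def)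
      qed
      ultimately show ?thesis using ideal_on_natD(2)[OF I] by blast
    next
      case True
      define m where "m = (LEAST m. x \<in> D m)"
      have m: "x \<in> D m" using True unfolding m_def by (rule LeastI_ex)
      have below: "\<forall>k<m. x \<notin> D k" unfolding m_def using not_less_Least by blast
      define H where "H = {n. \<kappa> n < m \<and> x \<in> W n}"
      have finH: "finite H" unfolding H_def by (rule fin_below[OF x below])
      have "{n. e n \<le> \<bar>F n x - f x\<bar>} \<subseteq> H \<union> Z \<union> (\<Union>k\<in>H. L k)"
      proof
        fix n assume n: "n \<in> {n. e n \<le> \<bar>F n x - f x\<bar>}"
        show "n \<in> H \<union> Z \<union> (\<Union>k\<in>H. L k)"
        proof (cases "\<kappa> n < m")
          case True
          then show ?thesis using n Fg[OF x, of n] below by (auto simp: H_def Z_def)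
        next
          case False
          then have xD: "x \<in> D (\<kappa> n)" using m Dm[of m "\<kappa> n"] by auto
          have "x \<notin> mtopology closure_of G W n" using Ff[OF xD] n e[of n] by auto
          \<comment> \<open>Otherwise \<open>x\<close> lies in the open set left by the patches in
            \<open>N n\<close> of level below \<open>m\<close>, and in the closure of what the
            others leave, hence in the closure of the region \<open>G W n\<close>.\<close>
          have "\<exists>k\<in>N n. k \<in> H"
          proof (rule ccontr)
            assume none: "\<not> (\<exists>k\<in>N n. k \<in> H)"
            define N1 where "N1 = {k \<in> N n. \<kappa> k < m}"
            define N2 where "N2 = {k \<in> N n. \<not> \<kappa> k < m}"
            have N12: "off W (N n) = off W N1 \<inter> off W N2" "finite N1" "finite N2"
              using N_fin[of n] by (auto simp: N1_def N2_def off_def)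
            have "x \<in> off W N1" using none x by (auto simp: off_def N1_def H_def)
            moreover have "x \<in> mtopology closure_of off W N2" using thin[OF m N12(3)] by (auto simp: N2_def)
            ultimately have "x \<in> mtopology closure_of off W (N n)"
              unfolding N12(1) using openin_Int_closure_of_subset[OF openW[OF N12(2)], of "off W N2"] by blast
            then have "x \<in> mtopology closure_of G W n"
              unfolding G_def using closure_of_Diff_nwd[OF D openW[OF N_fin(1)]] by simp
            then show False using \<open>x \<notin> mtopology closure_of G W n\<close> by blast
          qed
          then obtain k where k: "k \<in> N n" "k \<in> H" by blast
          have "x \<notin> D (\<kappa> k)" using k(2) below by (auto simp: H_def)
          then have "x \<notin> D (j k)" using WG[of k] k(2) by (auto simp: H_def G_def)
          then have "j k < m" using Dm[of m "j k"] m by (metis not_less subsetD)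
          then have "n \<notin> C A (j k)" using \<kappa>(1)[of n "j k"] False by auto
          moreover have "n \<in> B k" using k(1) by (simp add: N_def)
          ultimately have "n \<in> L k" using L(2)[of k] by blast
          then show ?thesis using k(2) by blast
        qed
      qed
      moreover have "H \<union> Z \<union> (\<Union>k\<in>H. L k) \<in> I"
        using ideal_finite_UN[OF I finH, of L] L(1) Z ideal_on_natD(1)[OF I] ideal_on_natD(3)[OF I finH] by blast
      ultimately show ?thesis using ideal_on_natD(2)[OF I] by blast
    qed
  qed
  then show ?thesis using F by blast
qed

end

section \<open>Lower bounds for the classes of equal limits\<close>

lemma equal_limitsI:
  assumes "\<And>n. F n \<in> \<F>" "\<And>n. e n > 0" "ideal_null_seq J e" "\<And>x. x \<in> S \<Longrightarrow> {n. e n \<le> \<bar>F n x - f x\<bar>} \<in> I"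
  shows "f \<in> equal_limits I J S \<F>"
  using assms unfolding equal_limits_def equal_convergent_def by blast

lemma closed_nwd_complement:
  assumes "closed_nwd X D"
  shows "openin X (topspace X - D)" "X closure_of (topspace X - D) = topspace X"
  using assms interior_of_eq_empty_complement[of X D] unfolding closed_nwd_def by auto

lemma closed_nwd_Un:
  assumes "closed_nwd X D" "closed_nwd X E"
  shows "closed_nwd X (D \<union> E)"
  unfolding closed_nwd_def interior_of_eq_empty
proof (intro conjI allI impI)
  show "closedin X (D \<union> E)" using assms by (auto simp: closed_nwd_def)
  fix T assume T: "openin X T \<and> T \<subseteq> D \<union> E"
  show "T = {}"
  proof (rule ccontr)
    assume "T \<noteq> {}"
    then have "T - D \<noteq> {}" using closed_nwd_avoid[OF assms(1)] T by blast
    moreover have "openin X (T - D)" using T assms(1) by (auto simp: closed_nwd_def)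
    ultimately have "T - D - E \<noteq> {}" using closed_nwd_avoid[OF assms(2)] by blast
    then show False using T by blast
  qed
qed

lemma closed_nwd_closure: "nowhere_dense_in X S \<Longrightarrow> closed_nwd X (X closure_of S)"
  by (simp add: closed_nwd_def nowhere_dense_in_def)

lemma closed_nwd_finite_UN: "finite S \<Longrightarrow> (\<And>s. s \<in> S \<Longrightarrow> closed_nwd X (D s)) \<Longrightarrow> closed_nwd X (\<Union>s\<in>S. D s)"
proof (induction rule: finite_induct)
  case empty
  then show ?case by (simp add: closed_nwd_def)
qed (auto intro: closed_nwd_Un)

definition clip :: "nat \<Rightarrow> real \<Rightarrow> real" where
  "clip n y = max (- real n) (min (real n) y)"

lemma abs_clip_le: "\<bar>clip n y\<bar> \<le> real n"
  by (auto simp: clip_def)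

lemma clip_eq: "\<bar>y\<bar> \<le> real n \<Longrightarrow> clip n y = y"
  by (auto simp: clip_def)

lemma clip_diff_le: "\<bar>clip n y - clip n z\<bar> \<le> \<bar>y - z\<bar>"
  by (auto simp: clip_def)

lemma continuity_point_small_oscillation:
  assumes "topcontinuous_at X euclideanreal f x" "\<delta> > 0"
  shows "\<exists>U. openin X U \<and> x \<in> U \<and> (\<forall>y\<in>U. \<forall>z\<in>U. \<bar>f y - f z\<bar> < \<delta>)"
proof -
  have "openin euclideanreal (ball (f x) (\<delta>/2)) \<and> f x \<in> ball (f x) (\<delta>/2)" using assms(2) by simp
  then obtain U where U: "openin X U" "x \<in> U" "\<forall>y\<in>U. f y \<in> ball (f x) (\<delta>/2)"
    using assms(1) unfolding topcontinuous_at_def by blast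
  have "\<bar>f y - f z\<bar> < \<delta>" if "y \<in> U" "z \<in> U" for y z
  proof -
    have "\<bar>f x - f y\<bar> < \<delta>/2" "\<bar>f x - f z\<bar> < \<delta>/2" using U(3) that by (auto simp: dist_real_def)
    then show ?thesis by linarith
  qed
  then show ?thesis using U by blast
qed

context Metric_space
begin

text \<open>Choosing cluster values makes the restriction to a dense set of continuity points
  quasi-continuous; clipping makes sure that cluster values exist.\<close>

lemma clip_extension:
  fixes f :: "'a \<Rightarrow> real"
  assumes P: "mtopology closure_of P = M"
    and cont: "\<And>x \<epsilon>. x \<in> P \<Longrightarrow> \<epsilon> > 0 \<Longrightarrow> \<exists>U. openin mtopology U \<and> x \<in> U \<and> (\<forall>y\<in>U \<inter> P. \<bar>f y - f x\<bar> < \<epsilon>)"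
  shows "\<exists>g\<in>QC mtopology. \<forall>x\<in>M. \<forall>\<epsilon>>0. \<forall>U. openin mtopology U \<and> x \<in> U \<longrightarrow>
    (\<exists>p\<in>P \<inter> U. \<bar>clip n (f p) - g x\<bar> < \<epsilon>)"
proof -
  define cluster where "cluster x c \<longleftrightarrow> (\<forall>\<epsilon>>0. \<forall>U. openin mtopology U \<and> x \<in> U \<longrightarrow>
    (\<exists>p\<in>P \<inter> U. \<bar>clip n (f p) - c\<bar> < \<epsilon>))" for x c
  have "\<exists>c. cluster x c" if x: "x \<in> M" for x
  proof -
    have "\<exists>p. p \<in> P \<inter> mball x (inverse (Suc k))" for k
      using closure_of_meets[of x mtopology P "mball x (inverse (Suc k))"] x P by auto
    then obtain p where p: "\<And>k. p k \<in> P \<inter> mball x (inverse (Suc k))" by metis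
    have "bounded (range (\<lambda>k. clip n (f (p k))))"
      using abs_clip_le by (intro boundedI[of _ "real n"]) auto
    then obtain c r where r: "strict_mono r" "((\<lambda>k. clip n (f (p k))) \<circ> r) \<longlonglongrightarrow> c"
      using bounded_imp_convergent_subsequence by blast
    have "cluster x c"
      unfolding cluster_def
    proof (intro allI impI)
      fix \<epsilon> :: real and U assume "\<epsilon> > 0" and U: "openin mtopology U \<and> x \<in> U"
      then obtain s where s: "s > 0" "mball x s \<subseteq> U" unfolding openin_mtopology by blast
      obtain k0 where k0: "inverse (real (Suc k0)) < s" using reals_Archimedean[OF s(1)] by blast
      obtain k1 where k1: "\<And>k. k1 \<le> k \<Longrightarrow> \<bar>clip n (f (p (r k))) - c\<bar> < \<epsilon>"
        using LIMSEQ_D[OF r(2) \<open>\<epsilon> > 0\<close>] by auto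
      define k where "k = max k0 k1"
      have "k0 \<le> r k" using strict_mono_imp_increasing[OF r(1), of k] by (simp add: k_def)
      then have "inverse (real (Suc (r k))) \<le> inverse (real (Suc k0))" by simp
      then have "inverse (real (Suc (r k))) \<le> s" using k0 by linarith
      then have "p (r k) \<in> P \<inter> U" using p[of "r k"] mball_subset_concentric[of _ s x] s(2) by blast
      then show "\<exists>p\<in>P \<inter> U. \<bar>clip n (f p) - c\<bar> < \<epsilon>" using k1[of k] by (auto simp: k_def)
    qed
    then show ?thesis ..
  qed
  then obtain g where g: "\<And>x. x \<in> M \<Longrightarrow> cluster x (g x)" by metis
  have "quasi_continuous_at mtopology g x" if x: "x \<in> M" for x
    unfolding quasi_continuous_at_def
  proof (intro allI impI)
    fix \<epsilon> :: real and U assume "\<epsilon> > 0" and U: "openin mtopology U \<and> x \<in> U"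
    \<comment> \<open>One third for the cluster value at \<open>x\<close>, one for the variation of
      \<open>f\<close> on \<open>W \<inter> P\<close>, one for the cluster value at
      \<open>y\<close>.\<close>
    have e3: "\<epsilon>/3 > 0" using \<open>\<epsilon> > 0\<close> by simp
    obtain p where p: "p \<in> P \<inter> U" "\<bar>clip n (f p) - g x\<bar> < \<epsilon>/3"
      using g[OF x] U e3 unfolding cluster_def by blast
    obtain W where W: "openin mtopology W" "p \<in> W" "\<And>y. y \<in> W \<inter> P \<Longrightarrow> \<bar>f y - f p\<bar> < \<epsilon>/3"
      using cont[of p "\<epsilon>/3"] p e3 by blast
    have UW: "openin mtopology (U \<inter> W)" using U W by blast
    have "\<bar>g y - g x\<bar> < \<epsilon>" if y: "y \<in> U \<inter> W" for y
    proof -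
      have "y \<in> M" using y openin_subset[OF W(1)] by auto
      then obtain p' where p': "p' \<in> P \<inter> (U \<inter> W)" "\<bar>clip n (f p') - g y\<bar> < \<epsilon>/3"
        using g UW y e3 unfolding cluster_def by blast
      then have "\<bar>clip n (f p') - clip n (f p)\<bar> < \<epsilon>/3"
        using W(3)[of p'] clip_diff_le[of n "f p'" "f p"] by auto
      then show ?thesis using p'(2) p(2) by linarith
    qed
    then show "\<exists>V. openin mtopology V \<and> V \<noteq> {} \<and> V \<subseteq> U \<and> (\<forall>y\<in>V. \<bar>g y - g x\<bar> < \<epsilon>)"
      using UW p W by (intro exI[of _ "U \<inter> W"]) auto
  qed
  then have "g \<in> QC mtopology" by (simp add: QC_def)
  then show ?thesis using g unfolding cluster_def by blast
qed

text \<open>With a single closed nowhere dense set no two patches have to be kept apart. Patch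
  \<open>n\<close> lives within \<open>inverse (Suc n)\<close> of \<open>D\<close>, so
  \<open>F n x\<close> differs from \<open>f x\<close> for finitely many \<open>n\<close> only,
  whatever the ideals.\<close>

lemma PWD0_subset_equal_limits:
  assumes I: "ideal_on_nat I" and J: "ideal_on_nat J"
  shows "PWD0 mtopology \<subseteq> equal_limits_QC I J mtopology"
proof
  fix f assume f: "f \<in> PWD0 mtopology"
  define D where "D = mtopology closure_of (M - {x \<in> M. quasi_continuous_at mtopology f x})"
  have D: "closed_nwd mtopology D"
    using f closed_nwd_closure unfolding D_def PWD0_def by auto
  have sub: "M - {x \<in> M. quasi_continuous_at mtopology f x} \<subseteq> D"
    unfolding D_def by (rule closure_of_subset) auto
  have qc: "quasi_continuous_at mtopology f x" if "x \<in> M" "x \<notin> D \<inter> mtopology closure_of M" for x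
    using sub that closure_of_topspace[of mtopology] by auto
  have MM: "mtopology closure_of M = M" using closure_of_topspace[of mtopology] by simp
  have DM: "D \<subseteq> M" using D closedin_subset by (fastforce simp: closed_nwd_def)
  have "\<exists>F W. F \<in> QC mtopology \<and> closedin mtopology W \<and>
    (\<forall>x\<in>D \<inter> mtopology closure_of M. F x = f x) \<and> (\<forall>x\<in>M - W. F x = f x) \<and>
    W - D \<subseteq> M \<and> (\<forall>x\<in>W - D. \<exists>y\<in>D. d y x < inverse (Suc n)) \<and>
    (\<forall>i::nat. D \<inter> mtopology closure_of {} \<subseteq> mtopology closure_of ({} - W))" for n :: nat
    by (rule quasi_continuous_patch[where R = "\<lambda>_. {}", OF D]) (use qc openin_topspace[of mtopology] in auto)
  then have "\<forall>n. \<exists>F W. F \<in> QC mtopology \<and> (\<forall>x\<in>D. F x = f x) \<and> (\<forall>x\<in>M - W. F x = f x) \<and>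
    (\<forall>x\<in>W - D. \<exists>y\<in>D. d y x < inverse (Suc n))" unfolding MM using DM by (metis Int_absorb2)
  then obtain F W where F: "\<And>n. F n \<in> QC mtopology" "\<And>n x. x \<in> D \<Longrightarrow> F n x = f x"
    "\<And>n x. x \<in> M - W n \<Longrightarrow> F n x = f x" "\<And>n x. x \<in> W n - D \<Longrightarrow> \<exists>y\<in>D. d y x < inverse (Suc n)" by metis
  show "f \<in> equal_limits_QC I J mtopology"
  proof (rule equal_limitsI[of F _ "\<lambda>n. inverse (Suc n)"])
    show "ideal_null_seq J (\<lambda>n. inverse (Suc n))"
      unfolding ideal_null_seq_def
    proof (intro allI impI)
      fix \<epsilon> :: real assume "\<epsilon> > 0"
      then obtain k where k: "inverse (real (Suc k)) < \<epsilon>" using reals_Archimedean by blast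
      have "{n. \<epsilon> \<le> \<bar>inverse (real (Suc n))\<bar>} \<subseteq> {..<k}"
      proof
        fix n assume n: "n \<in> {n. \<epsilon> \<le> \<bar>inverse (real (Suc n))\<bar>}"
        show "n \<in> {..<k}"
        proof (rule ccontr)
          assume "n \<notin> {..<k}"
          then have "inverse (real (Suc n)) \<le> inverse (real (Suc k))" by simp
          then have "inverse (real (Suc n)) < \<epsilon>" using k by linarith
          then show False using n by simp
        qed
      qed
      then show "{n. \<epsilon> \<le> \<bar>inverse (real (Suc n))\<bar>} \<in> J"
        using ideal_on_natD(3)[OF J] finite_subset by blast
    qed
    fix x assume "x \<in> topspace mtopology"
    then have x: "x \<in> M" by simp
    have "finite {n. inverse (real (Suc n)) \<le> \<bar>F n x - f x\<bar>}"
    proof (cases "x \<in> D")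
      case True
      then show ?thesis using F(2) by simp
    next
      case False
      have "closedin mtopology D" using D by (simp add: closed_nwd_def)
      from closedin_far[OF this x False] obtain r where r: "r > 0" "\<forall>y\<in>D. r \<le> d y x" by blast
      obtain k where k: "inverse (real (Suc k)) < r" using reals_Archimedean[OF r(1)] by blast
      have "n < k" if n: "inverse (real (Suc n)) \<le> \<bar>F n x - f x\<bar>" for n
      proof (rule ccontr)
        assume "\<not> n < k"
        then have le: "inverse (real (Suc n)) \<le> inverse (real (Suc k))" by simp
        have "F n x \<noteq> f x" using n by auto
        then have "x \<in> W n - D" using F(3) x False by blast
        then obtain y where "y \<in> D" "d y x < inverse (Suc n)" using F(4) by blast
        moreover from this have "r \<le> d y x" using r(2) by blast
        ultimately show False using le k by linarith
      qed
      then show ?thesis by (auto intro: finite_subset[of _ "{..<k}"])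
    qed
    then show "{n. inverse (real (Suc n)) \<le> \<bar>F n x - f x\<bar>} \<in> I" by (rule ideal_on_natD(3)[OF I])
  qed (use F(1) in auto)
qed

text \<open>\<open>D k\<close> consists of the points without a neighbourhood on which
  \<open>f\<close> varies by less than \<open>inverse (Suc k)\<close>. The error bound shrinks with
  the level instead of the index, so up to finitely many indices it is large only on finitely many
  \<open>A i\<close>, as convergence along \<open>J\<close> permits.\<close>

lemma PWD_subset_equal_limits:
  assumes I: "ideal_on_nat I" and J: "ideal_on_nat J"
    and A: "\<And>n. A n \<in> J" and nwR: "\<not> weakly_Ramsey (ideal_join_seq I A)"
  shows "PWD mtopology \<subseteq> equal_limits_QC I J mtopology"
proof
  fix f assume f: "f \<in> PWD mtopology"
  define Pc where "Pc = {x \<in> M. topcontinuous_at mtopology euclideanreal f x}"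
  have Pc: "mtopology closure_of Pc = M" using f by (simp add: PWD_def Pc_def)
  define small where "small k U \<longleftrightarrow> openin mtopology U \<and> (\<forall>y\<in>U. \<forall>z\<in>U. \<bar>f y - f z\<bar> < inverse (real (Suc k)))" for k U
  define D where "D k = M - \<Union>{U. small k U}" for k
  have PcD: "Pc \<inter> D k = {}" for k
    using continuity_point_small_oscillation[of mtopology f _ "inverse (real (Suc k))"]
    by (fastforce simp: Pc_def D_def small_def)
  have D: "closed_nwd mtopology (D k)" for k
    unfolding closed_nwd_def interior_of_eq_empty
  proof (intro conjI allI impI)
    have "openin mtopology (\<Union>{U. small k U})" by (auto simp: small_def)
    then show "closedin mtopology (D k)" unfolding D_def by (metis closedin_diff closedin_topspace topspace_mtopology)
    fix T assume T: "openin mtopology T \<and> T \<subseteq> D k"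
    have "T \<inter> Pc = {}" using T PcD by blast
    then show "T = {}" using T closure_of_meets[of _ mtopology Pc T] Pc openin_subset[of mtopology T] by fastforce
  qed
  have small_mono: "small k U" if "small l U" "k \<le> l" for k l U
  proof -
    have "inverse (real (Suc l)) \<le> inverse (real (Suc k))" using that(2) by simp
    then show ?thesis using that(1) unfolding small_def by (meson less_le_trans)
  qed
  have "incseq D" unfolding incseq_def D_def using small_mono by blast
  have D_out: "\<exists>U. small k U \<and> x \<in> U" if "x \<in> M" "x \<notin> D k" for x k
    using that by (auto simp: D_def)
  define P where "P = M - (\<Union>k. D k)"
  have "Pc \<subseteq> P" using PcD by (auto simp: P_def Pc_def)
  then have P: "mtopology closure_of P = M"
    using Pc closure_of_mono[of Pc P mtopology] closure_of_subset_topspace[of mtopology P] by auto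
  have cont: "\<exists>U. openin mtopology U \<and> x \<in> U \<and> (\<forall>y\<in>U \<inter> P. \<bar>f y - f x\<bar> < \<epsilon>)" if x: "x \<in> P" and "\<epsilon> > 0" for x \<epsilon>
  proof -
    obtain k where k: "inverse (real (Suc k)) < \<epsilon>" using reals_Archimedean[OF \<open>\<epsilon> > 0\<close>] by blast
    obtain U where "small k U" "x \<in> U" using D_out[of x k] x by (auto simp: P_def)
    then show ?thesis using k by (intro exI[of _ U]) (force simp: small_def)
  qed
  have "\<forall>n. \<exists>g\<in>QC mtopology. \<forall>x\<in>M. \<forall>\<epsilon>>0. \<forall>U. openin mtopology U \<and> x \<in> U \<longrightarrow>
    (\<exists>p\<in>P \<inter> U. \<bar>clip n (f p) - g x\<bar> < \<epsilon>)" using clip_extension[OF P cont] by blast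
  then obtain g where g: "\<And>n. g n \<in> QC mtopology"
    and cl: "\<And>n x \<epsilon> U. x \<in> M \<Longrightarrow> \<epsilon> > 0 \<Longrightarrow> openin mtopology U \<Longrightarrow> x \<in> U \<Longrightarrow> \<exists>p\<in>P \<inter> U. \<bar>clip n (f p) - g n x\<bar> < \<epsilon>"
    by metis
  define C where "C k = (\<Union>i<k. A i)" for k
  have C_mono: "C k \<subseteq> C l" if "k \<le> l" for k l unfolding C_def using that by force
  \<comment> \<open>The level is the first \<open>i\<close> with \<open>n \<in> A i\<close>. An
    index in no \<open>A i\<close> gets level \<open>n\<close>, so only finitely many of these lie
    below a given level.\<close>
  define \<kappa> where "\<kappa> n = (if \<exists>k. n \<in> C (Suc k) then LEAST k. n \<in> C (Suc k) else n)" for n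
  \<comment> \<open>The factor 2 pays for the cluster value and for the oscillation of
    \<open>f\<close> near the point.\<close>
  define e where "e n = 2 * inverse (real (Suc (\<kappa> n)))" for n
  obtain B where B: "avoidance_system (ideal_join_seq I A) B"
    using not_weakly_Ramsey_imp_avoidance[OF ideal_on_nat_join_seq[OF I] nwR] by blast
  have \<kappa>1: "\<kappa> n < k" if "n \<in> C k" for n k
  proof (cases k)
    case 0
    then show ?thesis using that by (simp add: C_def)
  next
    case (Suc l)
    then have "(LEAST k. n \<in> C (Suc k)) \<le> l" using that by (intro Least_le) simp
    then show ?thesis using that Suc by (auto simp: \<kappa>_def)
  qed
  have below: "{n. \<kappa> n < k} \<subseteq> C k \<union> {..<k}" for k
  proof
    fix n assume n: "n \<in> {n. \<kappa> n < k}"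
    show "n \<in> C k \<union> {..<k}"
    proof (cases "\<exists>k. n \<in> C (Suc k)")
      case True
      then have "n \<in> C (Suc (\<kappa> n))" unfolding \<kappa>_def by (auto intro: LeastI)
      then show ?thesis using n C_mono[of "Suc (\<kappa> n)" k] by auto
    next
      case False
      then show ?thesis using n by (simp add: \<kappa>_def)
    qed
  qed
  have \<kappa>2: "finite ({n. \<kappa> n < k} - C k)" for k
    by (rule finite_subset[of _ "{..<k}"]) (use below in auto)
  have e_pos: "e n > 0" for n by (simp add: e_def)
  have approx: "{n. x \<notin> D (\<kappa> n) \<and> e n \<le> \<bar>g n x - f x\<bar>} \<in> I" if x: "x \<in> M" for x
  proof -
    \<comment> \<open>The margin 1 bounds the oscillation near \<open>x\<close>; from
      \<open>N\<close> on clipping leaves the value at the chosen point \<open>p\<close>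
      unchanged.\<close>
    obtain N where N: "\<bar>f x\<bar> + 1 < real N" using reals_Archimedean2 by blast
    have "n < N" if n: "x \<notin> D (\<kappa> n)" "e n \<le> \<bar>g n x - f x\<bar>" for n
    proof (rule ccontr)
      assume "\<not> n < N"
      then have big: "\<bar>f x\<bar> + 1 < real n" using N by linarith
      define \<delta> where "\<delta> = inverse (real (Suc (\<kappa> n)))"
      have \<delta>: "0 < \<delta>" "\<delta> \<le> 1" by (auto simp: \<delta>_def inverse_le_1_iff)
      obtain U where U: "small (\<kappa> n) U" "x \<in> U" using D_out[OF x n(1)] by blast
      then obtain p where p: "p \<in> P \<inter> U" "\<bar>clip n (f p) - g n x\<bar> < \<delta>"
        using cl[OF x \<delta>(1)] unfolding small_def by blast
      have "\<bar>f p - f x\<bar> < \<delta>" using U p by (auto simp: small_def \<delta>_def)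
      moreover from this have "clip n (f p) = f p" using big \<delta> by (intro clip_eq) linarith
      ultimately have "\<bar>g n x - f x\<bar> < 2 * \<delta>" using p(2) by linarith
      then show False using n(2) by (simp add: e_def \<delta>_def)
    qed
    then have "{n. x \<notin> D (\<kappa> n) \<and> e n \<le> \<bar>g n x - f x\<bar>} \<subseteq> {..<N}" by auto
    then show ?thesis using ideal_on_natD(3)[OF I] finite_subset by blast
  qed
  have "\<exists>F. (\<forall>n. F n \<in> QC mtopology) \<and> (\<forall>x\<in>M. {n. e n \<le> \<bar>F n x - f x\<bar>} \<in> I)"
    by (rule equal_limit_construction[OF I B \<kappa>1[unfolded C_def] \<kappa>2[unfolded C_def] D \<open>incseq D\<close> e_pos g approx])
  then obtain F where F: "\<And>n. F n \<in> QC mtopology" "\<And>x. x \<in> M \<Longrightarrow> {n. e n \<le> \<bar>F n x - f x\<bar>} \<in> I" by blast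
  have "ideal_null_seq J e"
    unfolding ideal_null_seq_def
  proof (intro allI impI)
    fix \<epsilon> :: real assume "\<epsilon> > 0"
    then obtain k where k: "inverse (real (Suc k)) < \<epsilon>/2" using reals_Archimedean[of "\<epsilon>/2"] by auto
    have "\<kappa> n < k" if "\<epsilon> \<le> \<bar>e n\<bar>" for n
    proof (rule ccontr)
      assume "\<not> \<kappa> n < k"
      then have "inverse (real (Suc (\<kappa> n))) \<le> inverse (real (Suc k))" by simp
      then have "2 * inverse (real (Suc (\<kappa> n))) < \<epsilon>" using k by linarith
      then show False using that by (simp add: e_def)
    qed
    then have "{n. \<epsilon> \<le> \<bar>e n\<bar>} \<subseteq> C k \<union> {..<k}" using below by blast
    moreover have "C k \<union> {..<k} \<in> J"
      unfolding C_def
      by (intro ideal_on_natD(1)[OF J _ ideal_on_natD(3)[OF J]] ideal_finite_UN[OF J] A) simp_all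
    ultimately show "{n. \<epsilon> \<le> \<bar>e n\<bar>} \<in> J" using ideal_on_natD(2)[OF J] by blast
  qed
  then show "f \<in> equal_limits_QC I J mtopology"
    using F e_pos by (intro equal_limitsI[of F _ e]) auto
qed

text \<open>On the index set \<open>A \<in> J\<close> there is no restriction on the error bounds, so \<open>e\<close> may tend to
  infinity there, which makes any \<open>g n\<close> with \<open>\<bar>g n x\<bar> \<le> n + 1\<close> an admissible approximation.\<close>

lemma Baire_subset_equal_limits:
  assumes I: "ideal_on_nat I" and J: "ideal_on_nat J"
    and A: "A \<in> J" and nwR: "\<not> weakly_Ramsey (ideal_join I A)" and "Baire_space mtopology"
  shows "Baire_functions mtopology \<subseteq> equal_limits_QC I J mtopology"
proof
  fix f assume f: "f \<in> Baire_functions mtopology"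
  obtain \<B> :: "real set set" where \<B>: "countable \<B>" "topological_basis \<B>"
    using ex_countable_basis by blast
  have "\<B> \<noteq> {}" using topological_basisE[OF \<B>(2) open_UNIV UNIV_I] by blast
  define b where "b = from_nat_into \<B>"
  have b_open: "open (b k)" for k
    using topological_basis_open[OF \<B>(2)] from_nat_into[OF \<open>\<B> \<noteq> {}\<close>] by (simp add: b_def)
  define Q where "Q k U Z \<longleftrightarrow> openin mtopology U \<and> (\<forall>i::nat. nowhere_dense_in mtopology (Z i)) \<and>
     ({x \<in> M. f x \<in> b k} - U) \<union> (U - {x \<in> M. f x \<in> b k}) = (\<Union>i. Z i)" for k U Z
  have "\<exists>U Z. Q k U Z" for k
  proof -
    have "has_Baire_property mtopology {x \<in> M. f x \<in> b k}"
      using f b_open[of k] by (simp add: Baire_functions_def)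
    then show ?thesis unfolding has_Baire_property_def meager_in_def Q_def by blast
  qed
  then obtain U Z where "\<And>k. Q k (U k) (Z k)" by metis
  then have U: "\<And>k. openin mtopology (U k)" and Z: "\<And>k i. nowhere_dense_in mtopology (Z k (i::nat))"
    and UZ: "\<And>k. ({x \<in> M. f x \<in> b k} - U k) \<union> (U k - {x \<in> M. f x \<in> b k}) = (\<Union>i. Z k i)"
    by (simp_all add: Q_def)
  \<comment> \<open>The closures of the first \<open>k + 1\<close> exceptional sets, over all basic
    open sets; off their union every basic preimage is relatively open.\<close>
  define D where "D k = (\<Union>m\<le>k. mtopology closure_of case_prod Z (prod_decode m))" for k
  have D: "closed_nwd mtopology (D k)" for k
    unfolding D_def using Z by (intro closed_nwd_finite_UN closed_nwd_closure) (auto split: prod.split)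
  have "incseq D" unfolding incseq_def D_def by force
  have ZD: "Z k i \<subseteq> D (prod_encode (k, i))" for k i
  proof -
    have "Z k i \<subseteq> mtopology closure_of Z k i"
      using Z by (intro closure_of_subset) (simp add: nowhere_dense_in_def)
    also have "\<dots> \<subseteq> D (prod_encode (k, i))"
      using UN_upper[of "prod_encode (k, i)" "{..prod_encode (k, i)}"
          "\<lambda>m. mtopology closure_of case_prod Z (prod_decode m)"] by (simp add: D_def)
    finally show ?thesis .
  qed
  define P where "P = M - (\<Union>k. D k)"
  have "mtopology closure_of (\<Inter>k. M - D k) = M"
    using assms(5)[unfolded Baire_space_def, rule_format, of "\<lambda>k. M - D k"] closed_nwd_complement[OF D]
    by simp
  moreover have "(\<Inter>k. M - D k) = P" by (auto simp: P_def)
  ultimately have P: "mtopology closure_of P = M" by simp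
  have cont: "\<exists>U. openin mtopology U \<and> x \<in> U \<and> (\<forall>y\<in>U \<inter> P. \<bar>f y - f x\<bar> < \<epsilon>)" if "x \<in> P" "\<epsilon> > 0" for x \<epsilon>
  proof -
    obtain B' where B': "B' \<in> \<B>" "f x \<in> B'" "B' \<subseteq> ball (f x) \<epsilon>"
      using topological_basisE[OF \<B>(2), of "ball (f x) \<epsilon>" "f x"] \<open>\<epsilon> > 0\<close> by auto
    obtain k where k: "b k = B'" using from_nat_into_surj[OF \<B>(1) B'(1)] unfolding b_def by blast
    have iff: "y \<in> U k \<longleftrightarrow> f y \<in> b k" if "y \<in> P" for y
    proof -
      have "y \<notin> (\<Union>i. Z k i)" using that ZD by (auto simp: P_def)
      then show ?thesis using UZ[of k] that by (auto simp: P_def)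
    qed
    have "\<bar>f y - f x\<bar> < \<epsilon>" if "y \<in> U k \<inter> P" for y
    proof -
      have "f y \<in> ball (f x) \<epsilon>" using iff[of y] that k B' by auto
      then show ?thesis by (simp add: dist_real_def abs_minus_commute)
    qed
    then show ?thesis using U[of k] iff[OF \<open>x \<in> P\<close>] k B' by (intro exI[of _ "U k"]) auto
  qed
  have "\<forall>n. \<exists>g\<in>QC mtopology. \<forall>x\<in>M. \<forall>\<epsilon>>0. \<forall>U. openin mtopology U \<and> x \<in> U \<longrightarrow>
    (\<exists>p\<in>P \<inter> U. \<bar>clip n (f p) - g x\<bar> < \<epsilon>)" using clip_extension[OF P cont] by blast
  then obtain g where g: "\<And>n. g n \<in> QC mtopology"
    and cl: "\<And>n x \<epsilon> U. x \<in> M \<Longrightarrow> \<epsilon> > 0 \<Longrightarrow> openin mtopology U \<Longrightarrow> x \<in> U \<Longrightarrow> \<exists>p\<in>P \<inter> U. \<bar>clip n (f p) - g n x\<bar> < \<epsilon>"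
    by metis
  \<comment> \<open>For the constant sequence \<open>A\<close> the indices in \<open>A\<close> must
    have level below 1.\<close>
  define \<kappa> where "\<kappa> n = (if n \<in> A then 0 else n)" for n
  \<comment> \<open>Eventually \<open>\<bar>f x\<bar> < n\<close>, and together with
    \<open>\<bar>g n x\<bar> \<le> n + 1\<close> this keeps the error below
    \<open>2 * n + 2\<close>.\<close>
  define e where "e n = (if n \<in> A then 2 * real n + 2 else inverse (real (Suc n)))" for n
  obtain B where B: "avoidance_system (ideal_join_seq I (\<lambda>_. A)) B"
    using not_weakly_Ramsey_imp_avoidance[OF ideal_on_nat_join_seq[OF I]] nwR ideal_join_eq_seq[OF I] by metis
  have \<kappa>1: "\<kappa> n < k" if "n \<in> (\<Union>i<k. A)" for n k
    proof -
    from that show ?thesis by (rule UN_E) (simp add: \<kappa>_def)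
  qed
  have \<kappa>2: "finite ({n. \<kappa> n < k} - (\<Union>i<k. A))" for k
    by (rule finite_subset[of _ "{..<k}"]) (auto simp: \<kappa>_def split: if_splits)
  have e_pos: "e n > 0" for n by (simp add: e_def)
  have gP: "\<bar>g n x - f x\<bar> < \<epsilon>" if x: "x \<in> P" "\<bar>f x\<bar> \<le> real n" and "\<epsilon> > 0" for n x \<epsilon>
  proof -
    have e2: "\<epsilon>/2 > 0" using \<open>\<epsilon> > 0\<close> by simp
    obtain N where N: "openin mtopology N" "x \<in> N" "\<forall>y\<in>N \<inter> P. \<bar>f y - f x\<bar> < \<epsilon>/2" using cont[OF x(1) e2] by blast
    have "x \<in> M" using x(1) by (simp add: P_def)
    from cl[OF this e2 N(1,2)] obtain p where p: "p \<in> P \<inter> N" "\<bar>clip n (f p) - g n x\<bar> < \<epsilon>/2" by blast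
    have "\<bar>f p - f x\<bar> < \<epsilon>/2" using N(3) p(1) by blast
    then have "\<bar>clip n (f p) - clip n (f x)\<bar> < \<epsilon>/2"
      using clip_diff_le[of n "f p" "f x"] by linarith
    then show ?thesis using p(2) clip_eq[OF x(2)] by linarith
  qed
  have gbd: "\<bar>g n x\<bar> \<le> real n + 1" if x: "x \<in> M" for n x
  proof -
    obtain p where "\<bar>clip n (f p) - g n x\<bar> < 1" using cl[OF x, of 1 M n] x openin_topspace[of mtopology] by auto
    then show ?thesis using abs_clip_le[of n "f p"] by linarith
  qed
  have approx: "{n. x \<notin> D (\<kappa> n) \<and> e n \<le> \<bar>g n x - f x\<bar>} \<in> I" if x: "x \<in> M" for x
  proof -
    obtain N where N: "\<bar>f x\<bar> + 1 < real N" using reals_Archimedean2 by blast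
    obtain m where m: "x \<in> P \<or> x \<in> D m" using x by (auto simp: P_def)
    have "n < max N m" if n: "x \<notin> D (\<kappa> n)" "e n \<le> \<bar>g n x - f x\<bar>" for n
    proof (rule ccontr)
      assume "\<not> n < max N m"
      then have big: "\<bar>f x\<bar> + 1 < real n" "m \<le> n" using N by auto
      show False
      proof (cases "n \<in> A")
        case True
        then show False using n(2) gbd[OF x, of n] big(1) by (simp add: e_def)
      next
        case False
        then have "x \<notin> D m" using n(1) incseqD[OF \<open>incseq D\<close> big(2)] by (auto simp: \<kappa>_def)
        then have "x \<in> P" using m by blast
        then have "\<bar>g n x - f x\<bar> < e n" using gP[of x n "e n"] e_pos big(1) by simp
        then show False using n(2) by simp
      qed
    qed
    then have "{n. x \<notin> D (\<kappa> n) \<and> e n \<le> \<bar>g n x - f x\<bar>} \<subseteq> {..<max N m}" by auto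
    then show ?thesis using ideal_on_natD(3)[OF I] finite_subset by blast
  qed
  have "\<exists>F. (\<forall>n. F n \<in> QC mtopology) \<and> (\<forall>x\<in>M. {n. e n \<le> \<bar>F n x - f x\<bar>} \<in> I)"
    by (rule equal_limit_construction[OF I B \<kappa>1 \<kappa>2 D \<open>incseq D\<close> e_pos g approx])
  then obtain F where F: "\<And>n. F n \<in> QC mtopology" "\<And>x. x \<in> M \<Longrightarrow> {n. e n \<le> \<bar>F n x - f x\<bar>} \<in> I" by blast
  have "ideal_null_seq J e"
    unfolding ideal_null_seq_def
  proof (intro allI impI)
    fix \<epsilon> :: real assume "\<epsilon> > 0"
    then obtain k where k: "inverse (real (Suc k)) < \<epsilon>" using reals_Archimedean by blast
    have "n \<in> A \<union> {..<k}" if "\<epsilon> \<le> \<bar>e n\<bar>" for n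
    proof (rule ccontr)
      assume n: "n \<notin> A \<union> {..<k}"
      then have "inverse (real (Suc n)) \<le> inverse (real (Suc k))" by simp
      then have "inverse (real (Suc n)) < \<epsilon>" using k by linarith
      then show False using that n by (simp add: e_def)
    qed
    then have "{n. \<epsilon> \<le> \<bar>e n\<bar>} \<subseteq> A \<union> {..<k}" by blast
    moreover have "A \<union> {..<k} \<in> J" using ideal_on_natD(1)[OF J A ideal_on_natD(3)[OF J]] by simp
    ultimately show "{n. \<epsilon> \<le> \<bar>e n\<bar>} \<in> J" using ideal_on_natD(2)[OF J] by blast
  qed
  then show "f \<in> equal_limits_QC I J mtopology"
    using F e_pos by (intro equal_limitsI[of F _ e]) auto
qed

end

section \<open>Upper bounds for the classes of equal limits\<close>

text \<open>Otherwise the closures of all \<open>U \<inter> T i\<close> would be nowhere dense, and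
  some point of \<open>U\<close> would avoid them and hence every \<open>T i\<close>.\<close>

lemma Baire_space_cover:
  assumes X: "Baire_space X" and cover: "topspace X \<subseteq> (\<Union>i::nat. T i)" and U: "openin X U" "U \<noteq> {}"
  shows "\<exists>i V. openin X V \<and> V \<noteq> {} \<and> V \<subseteq> U \<and> V \<subseteq> X closure_of T i"
proof (rule ccontr)
  assume none: "\<nexists>i V. openin X V \<and> V \<noteq> {} \<and> V \<subseteq> U \<and> V \<subseteq> X closure_of T i"
  have "closed_nwd X (X closure_of (U \<inter> T i))" for i
    unfolding closed_nwd_def interior_of_eq_empty
  proof (intro conjI allI impI)
    fix W assume W: "openin X W \<and> W \<subseteq> X closure_of (U \<inter> T i)"
    show "W = {}"
    proof (rule ccontr)
      assume "W \<noteq> {}"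
      then obtain w where w: "w \<in> W" by blast
      then have "w \<in> X closure_of (U \<inter> T i)" using W by blast
      then have "W \<inter> (U \<inter> T i) \<noteq> {}" using closure_of_meets W w by metis
      then have "W \<inter> U \<noteq> {}" by blast
      moreover have "openin X (W \<inter> U)" using W U by blast
      moreover have "X closure_of (U \<inter> T i) \<subseteq> X closure_of T i" by (intro closure_of_mono) blast
      then have "W \<inter> U \<subseteq> X closure_of T i" using W by blast
      ultimately show False using none by blast
    qed
  qed simp
  from closed_nwd_complement[OF this]
  have dense: "X closure_of (\<Inter>i. topspace X - X closure_of (U \<inter> T i)) = topspace X"
    using X[unfolded Baire_space_def, rule_format, of "\<lambda>i. topspace X - X closure_of (U \<inter> T i)"] by simp
  obtain u where "u \<in> U" using U by blast
  then have "u \<in> X closure_of (\<Inter>i. topspace X - X closure_of (U \<inter> T i))"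
    using dense openin_subset[OF U(1)] by blast
  then have "U \<inter> (\<Inter>i. topspace X - X closure_of (U \<inter> T i)) \<noteq> {}"
    using closure_of_meets U(1) \<open>u \<in> U\<close> by metis
  then obtain x where x: "x \<in> U" "\<And>i. x \<in> topspace X - X closure_of (U \<inter> T i)" by blast
  obtain i where "x \<in> T i" using cover x(2) by blast
  then have "x \<in> U \<inter> T i" using x(1) by blast
  moreover have "U \<inter> T i \<subseteq> X closure_of (U \<inter> T i)"
    using openin_subset[OF U(1)] by (intro closure_of_subset) blast
  ultimately show False using x(2) by blast
qed

text \<open>The values of \<open>f\<close> near a point \<open>z\<close> are only known on \<open>T\<close>, but a single quasi-continuous
  approximation transfers the value at \<open>z\<close> to points of \<open>T\<close>.\<close>

lemma quasi_continuous_transfer: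
  assumes "quasi_continuous_at X h z" "\<epsilon> > 0" "openin X U" "z \<in> U"
    and "\<bar>h z - f z\<bar> < \<epsilon>" and "\<And>y. y \<in> T \<Longrightarrow> \<bar>h y - f y\<bar> < \<epsilon>"
  shows "\<exists>W. openin X W \<and> W \<noteq> {} \<and> W \<subseteq> U \<and> (\<forall>y\<in>W \<inter> T. \<bar>f y - f z\<bar> < 3 * \<epsilon>)"
proof -
  obtain W where W: "openin X W" "W \<noteq> {}" "W \<subseteq> U" "\<And>y. y \<in> W \<Longrightarrow> \<bar>h y - h z\<bar> < \<epsilon>"
    using assms(1-4) unfolding quasi_continuous_at_def by meson
  have "\<bar>f y - f z\<bar> < 3 * \<epsilon>" if "y \<in> W \<inter> T" for y
    using assms(5) assms(6)[of y] W(4)[of y] that by auto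
  then show ?thesis using W by blast
qed

lemma dense_open_meets:
  assumes "openin X W" "W \<noteq> {}" "W \<subseteq> X closure_of T"
  shows "W \<inter> T \<noteq> {}"
  using assms closure_of_meets by fast

lemma equal_limitsD:
  assumes "f \<in> equal_limits I J S \<F>"
  shows "\<exists>F e. (\<forall>n. F n \<in> \<F>) \<and> (\<forall>n. e n > 0) \<and> ideal_null_seq J e \<and>
    (\<forall>x\<in>S. {n. e n \<le> \<bar>F n x - f x\<bar>} \<in> I)"
  using assms unfolding equal_limits_def equal_convergent_def by blast

lemma omega_plus_diagonalizableD:
  assumes "omega_plus_diagonalizable K"
  shows "\<exists>Z :: nat \<Rightarrow> nat set. (\<forall>i. Z i \<notin> K) \<and> (\<forall>Y. - Y \<in> K \<longrightarrow> (\<exists>i. Z i \<subseteq> Y))"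
  using assms unfolding omega_plus_diagonalizable_def positive_sets_def dual_filter_def by simp

text \<open>For one error level \<open>\<epsilon>\<close> the indices with
  \<open>\<epsilon> \<le> e n\<close> form a single set of \<open>J\<close>, so joins with one set
  suffice. The diagonalizing sets may change with \<open>\<epsilon>\<close>, which is why only a
  dense G_delta set of continuity points results.\<close>

lemma equal_limits_subset_PWD:
  assumes I: "ideal_on_nat I" and diag: "\<And>A. A \<in> J \<Longrightarrow> omega_plus_diagonalizable (ideal_join I A)"
    and X: "Baire_space X"
  shows "equal_limits_QC I J X \<subseteq> PWD X"
proof
  fix f assume "f \<in> equal_limits_QC I J X"
  from equal_limitsD[OF this] obtain F e where F: "\<And>n. F n \<in> QC X" and e: "\<And>n. e n > 0" "ideal_null_seq J e"
    and bad: "\<And>x. x \<in> topspace X \<Longrightarrow> {n. e n \<le> \<bar>F n x - f x\<bar>} \<in> I" by blast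
  have qc: "quasi_continuous_at X (F n) x" if "x \<in> topspace X" for n x
    using F[of n] that by (simp add: QC_def)
  define small where "small \<delta> U \<longleftrightarrow> openin X U \<and> (\<forall>y\<in>U. \<forall>z\<in>U. \<bar>f y - f z\<bar> < \<delta>)" for \<delta> U
  have small_ex: "\<exists>V. small \<delta> V \<and> V \<noteq> {} \<and> V \<subseteq> U" if U: "openin X U" "U \<noteq> {}" and "\<delta> > 0" for U \<delta>
  proof -
    \<comment> \<open>All values of \<open>f\<close> on \<open>V\<close> will lie within
      \<open>5 * \<epsilon>\<close> of one number.\<close>
    define \<epsilon> where "\<epsilon> = \<delta>/10"
    have "\<epsilon> > 0" using \<open>\<delta> > 0\<close> by (simp add: \<epsilon>_def)
    define A where "A = {n. \<epsilon> \<le> \<bar>e n\<bar>}"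
    have "A \<in> J" using e(2) \<open>\<epsilon> > 0\<close> by (simp add: ideal_null_seq_def A_def)
    from omega_plus_diagonalizableD[OF diag[OF this]]
    obtain Z :: "nat \<Rightarrow> nat set" where "\<forall>i. Z i \<notin> ideal_join I A"
      "\<forall>Y. - Y \<in> ideal_join I A \<longrightarrow> (\<exists>i. Z i \<subseteq> Y)" by (elim exE conjE)
    note Z = this[rule_format]
    have near: "- {n. \<bar>F n x - f x\<bar> < \<epsilon>} \<in> ideal_join I A" if x: "x \<in> topspace X" for x
    proof -
      have "- {n. \<bar>F n x - f x\<bar> < \<epsilon>} - A \<subseteq> {n. e n \<le> \<bar>F n x - f x\<bar>}" by (auto simp: A_def)
      then show ?thesis using ideal_on_natD(2)[OF I bad[OF x]] by (simp add: ideal_join_iff[OF I])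
    qed
    define T where "T i = {x \<in> topspace X. \<forall>n\<in>Z i. \<bar>F n x - f x\<bar> < \<epsilon>}" for i
    have "x \<in> (\<Union>i. T i)" if x: "x \<in> topspace X" for x
    proof -
      obtain i where "Z i \<subseteq> {n. \<bar>F n x - f x\<bar> < \<epsilon>}" using Z(2)[OF near[OF x]] by blast
      then have "x \<in> T i" using x by (auto simp: T_def)
      then show ?thesis by blast
    qed
    then have "topspace X \<subseteq> (\<Union>i. T i)" by (rule subsetI)
    from Baire_space_cover[OF X this U] obtain i V0
      where V0: "openin X V0" "V0 \<noteq> {}" "V0 \<subseteq> U" "V0 \<subseteq> X closure_of T i" by (elim exE conjE)
    \<comment> \<open>Although \<open>z\<close> need not belong to \<open>T i\<close>, the set
      \<open>Z i\<close> is positive and the indices bad at \<open>z\<close> form a set in the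
      ideal, so some index of \<open>Z i\<close> is good at \<open>z\<close>.\<close>
    have pick: "\<exists>n\<in>Z i. \<bar>F n z - f z\<bar> < \<epsilon>" if z: "z \<in> topspace X" for z
    proof (rule ccontr)
      assume "\<not> (\<exists>n\<in>Z i. \<bar>F n z - f z\<bar> < \<epsilon>)"
      then have "Z i \<subseteq> - {n. \<bar>F n z - f z\<bar> < \<epsilon>}" by blast
      then have "Z i - A \<subseteq> - {n. \<bar>F n z - f z\<bar> < \<epsilon>} - A" by blast
      then have "Z i \<in> ideal_join I A"
        using near[OF z] ideal_on_natD(2)[OF I] unfolding ideal_join_iff[OF I] by blast
      then show False using Z(1) by blast
    qed
    obtain x0 where x0: "x0 \<in> V0" using V0 by blast
    have V0X: "V0 \<subseteq> topspace X" using V0(1) by (rule openin_subset)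
    obtain n where n: "n \<in> Z i" using pick x0 V0X by blast
    obtain V where V: "openin X V" "V \<noteq> {}" "V \<subseteq> V0" "\<And>y. y \<in> V \<Longrightarrow> \<bar>F n y - F n x0\<bar> < \<epsilon>"
      using qc[of x0 n] x0 V0X V0(1) \<open>\<epsilon> > 0\<close> unfolding quasi_continuous_at_def by (meson subsetD)
    \<comment> \<open>The index \<open>n'\<close> depends on \<open>z\<close> and carries its value
      to a point \<open>y \<in> T i\<close>, at cost \<open>3 * \<epsilon>\<close>; the fixed index
      \<open>n\<close> compares \<open>f y\<close> with \<open>F n y\<close> and this with
      \<open>F n x0\<close>, at cost \<open>\<epsilon>\<close> each.\<close>
    have val: "\<bar>f z - F n x0\<bar> < 5 * \<epsilon>" if z: "z \<in> V" for z
    proof -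
      have zX: "z \<in> topspace X" using z V(3) V0X by blast
      obtain n' where n': "n' \<in> Z i" "\<bar>F n' z - f z\<bar> < \<epsilon>" using pick[OF zX] by blast
      obtain W where W: "openin X W" "W \<noteq> {}" "W \<subseteq> V" "\<forall>y\<in>W \<inter> T i. \<bar>f y - f z\<bar> < 3 * \<epsilon>"
        using quasi_continuous_transfer[of X "F n'" z \<epsilon> V f "T i", OF qc[OF zX] \<open>\<epsilon> > 0\<close> V(1) z n'(2)] n'(1)
        by (auto simp: T_def)
      have "W \<inter> T i \<noteq> {}" using W V V0 by (intro dense_open_meets) auto
      then obtain y where y: "y \<in> W" "y \<in> T i" by blast
      have "\<bar>f y - f z\<bar> < 3 * \<epsilon>" "\<bar>F n y - f y\<bar> < \<epsilon>" "\<bar>F n y - F n x0\<bar> < \<epsilon>"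
        using W y n V(4) by (auto simp: T_def)
      then show ?thesis by linarith
    qed
    have "\<bar>f y - f z\<bar> < \<delta>" if "y \<in> V" "z \<in> V" for y z
      using val[OF that(1)] val[OF that(2)] unfolding \<epsilon>_def by linarith
    then show ?thesis using V V0 by (intro exI[of _ V]) (auto simp: small_def)
  qed
  define G where "G k = \<Union>{U. small (inverse (real (Suc k))) U}" for k
  have "openin X (G k)" for k by (auto simp: G_def small_def)
  moreover have "X closure_of G k = topspace X" for k
  proof -
    have "U \<inter> G k \<noteq> {}" if U: "openin X U" "x \<in> U" for U x
    proof -
      have "U \<noteq> {}" "inverse (real (Suc k)) > 0" using U(2) by auto
      from small_ex[OF U(1) this]
      obtain V where V: "small (inverse (real (Suc k))) V" "V \<noteq> {}" "V \<subseteq> U" by (elim exE conjE)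
      then have "V \<subseteq> G k" unfolding G_def by blast
      then show ?thesis using V by blast
    qed
    then show ?thesis using closure_of_subset_topspace[of X "G k"] by (auto simp: closure_of_meets_iff)
  qed
  ultimately have dense: "X closure_of (\<Inter>k. G k) = topspace X"
    using X[unfolded Baire_space_def, rule_format, of G] by simp
  have "x \<in> topspace X \<and> topcontinuous_at X euclideanreal f x" if x: "x \<in> (\<Inter>k. G k)" for x
  proof -
    obtain U0 where "small (inverse (real (Suc 0))) U0" "x \<in> U0" using x unfolding G_def by blast
    then have xX: "x \<in> topspace X" using openin_subset by (fastforce simp: small_def)
    have "\<exists>U. openin X U \<and> x \<in> U \<and> (\<forall>y\<in>U. f y \<in> V)" if V: "open V" "f x \<in> V" for V
    proof -
      obtain r where r: "r > 0" "ball (f x) r \<subseteq> V" using V open_contains_ball by blast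
      obtain k where k: "inverse (real (Suc k)) < r" using reals_Archimedean[OF r(1)] by blast
      obtain U where U: "small (inverse (real (Suc k))) U" "x \<in> U" using x by (auto simp: G_def)
      have "f y \<in> V" if "y \<in> U" for y
      proof -
        have "\<bar>f x - f y\<bar> < r" using U that k by (fastforce simp: small_def)
        then show ?thesis using r(2) by (auto simp: dist_real_def)
      qed
      then show ?thesis using U by (auto simp: small_def)
    qed
    then show ?thesis using xX unfolding topcontinuous_at_def by simp
  qed
  then have "(\<Inter>k. G k) \<subseteq> {x \<in> topspace X. topcontinuous_at X euclideanreal f x}" by blast
  from closure_of_mono[OF this, of X] dense
  show "f \<in> PWD X"
    using closure_of_subset_topspace[of X "{x \<in> topspace X. topcontinuous_at X euclideanreal f x}"]
    by (auto simp: PWD_def)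
qed

text \<open>One diagonalization serves all error levels: \<open>Z i\<close> remains positive after
  removing finitely many \<open>A k\<close>, so it has indices good at a given point with
  \<open>e n\<close> as small as desired. Hence \<open>f\<close> is quasi-continuous throughout any
  open set in which a fixed \<open>T i\<close> is dense.\<close>

lemma equal_limits_subset_PWD0:
  assumes I: "ideal_on_nat I" and first: "first_q_type I J" and X: "Baire_space X"
  shows "equal_limits_QC I J X \<subseteq> PWD0 X"
proof
  fix f assume "f \<in> equal_limits_QC I J X"
  from equal_limitsD[OF this] obtain F e where F: "\<And>n. F n \<in> QC X" and e: "\<And>n. e n > 0" "ideal_null_seq J e"
    and bad: "\<And>x. x \<in> topspace X \<Longrightarrow> {n. e n \<le> \<bar>F n x - f x\<bar>} \<in> I" by blast
  have qc: "quasi_continuous_at X (F n) x" if "x \<in> topspace X" for n x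
    using F[of n] that by (simp add: QC_def)
  define A where "A k = {n. inverse (real (Suc k)) \<le> \<bar>e n\<bar>}" for k
  have "A k \<in> J" for k using e(2) by (simp add: ideal_null_seq_def A_def)
  then have "omega_plus_diagonalizable (ideal_join_seq I A)" using first by (simp add: first_q_type_def)
  from omega_plus_diagonalizableD[OF this]
  obtain Z :: "nat \<Rightarrow> nat set" where "\<forall>i. Z i \<notin> ideal_join_seq I A"
    "\<forall>Y. - Y \<in> ideal_join_seq I A \<longrightarrow> (\<exists>i. Z i \<subseteq> Y)" by (elim exE conjE)
  note Z = this[rule_format]
  define T where "T i = {x \<in> topspace X. \<forall>n\<in>Z i. \<bar>F n x - f x\<bar> < e n}" for i
  have "\<exists>i. x \<in> T i" if x: "x \<in> topspace X" for x
  proof -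
    have "- {n. \<bar>F n x - f x\<bar> < e n} = {n. e n \<le> \<bar>F n x - f x\<bar>}" by auto
    then have "- {n. \<bar>F n x - f x\<bar> < e n} - (\<Union>i<0. A i) \<in> I" using bad[OF x] by simp
    then obtain i where "Z i \<subseteq> {n. \<bar>F n x - f x\<bar> < e n}" using Z(2) unfolding ideal_join_seq_iff[OF I] by blast
    then show ?thesis using x by (auto simp: T_def)
  qed
  then have cover: "topspace X \<subseteq> (\<Union>i. T i)" by blast
  have transfer: "\<exists>W. openin X W \<and> W \<noteq> {} \<and> W \<subseteq> U \<and> (\<forall>y\<in>W \<inter> T i. \<bar>f y - f z\<bar> < 3 * \<epsilon>)"
    if U: "openin X U" "z \<in> U" and "\<epsilon> > 0" for U z i \<epsilon>
  proof -
    have z: "z \<in> topspace X" using U openin_subset by blast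
    obtain k where k: "inverse (real (Suc k)) < \<epsilon>" using reals_Archimedean[OF \<open>\<epsilon> > 0\<close>] by blast
    \<comment> \<open>With \<open>Suc k\<close>, the set \<open>A k\<close> is itself among those
      removed, which gives \<open>e n < \<epsilon>\<close>.\<close>
    have "\<not> Z i - (\<Union>j<Suc k. A j) \<subseteq> {n. e n \<le> \<bar>F n z - f z\<bar>}"
      using Z(1)[of i] ideal_on_natD(2)[OF I bad[OF z]] unfolding ideal_join_seq_iff[OF I] by blast
    then obtain n where "n \<in> Z i - (\<Union>j<Suc k. A j)" "n \<notin> {n. e n \<le> \<bar>F n z - f z\<bar>}" by blast
    then have n: "n \<in> Z i" "n \<notin> A k" "\<bar>F n z - f z\<bar> < e n" by auto
    have en: "e n < \<epsilon>" using n(2) k by (auto simp: A_def)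
    show ?thesis
    proof (rule quasi_continuous_transfer[OF qc[OF z] \<open>\<epsilon> > 0\<close> U])
      show "\<bar>F n z - f z\<bar> < \<epsilon>" using n(3) en by linarith
      show "\<bar>F n y - f y\<bar> < \<epsilon>" if "y \<in> T i" for y using that n(1) en by (fastforce simp: T_def)
    qed
  qed
  have inside: "quasi_continuous_at X f z" if V: "openin X V" "V \<subseteq> X closure_of T i" and z: "z \<in> V" for V i z
    unfolding quasi_continuous_at_def
  proof (intro allI impI)
    fix \<epsilon> :: real and U assume "\<epsilon> > 0" and U: "openin X U \<and> z \<in> U"
    \<comment> \<open>Two transfers, from \<open>z\<close> and from \<open>w\<close>, each costing
      three times this amount.\<close>
    have e6: "\<epsilon>/6 > 0" using \<open>\<epsilon> > 0\<close> by simp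
    have UV: "openin X (U \<inter> V)" "z \<in> U \<inter> V" using U V z by auto
    obtain O' where O': "openin X O'" "O' \<noteq> {}" "O' \<subseteq> U \<inter> V" "\<forall>y\<in>O' \<inter> T i. \<bar>f y - f z\<bar> < 3 * (\<epsilon>/6)"
      using transfer[OF UV e6] by blast
    have "\<bar>f w - f z\<bar> < \<epsilon>" if w: "w \<in> O'" for w
    proof -
      obtain W where W: "openin X W" "W \<noteq> {}" "W \<subseteq> O'" "\<forall>y\<in>W \<inter> T i. \<bar>f y - f w\<bar> < 3 * (\<epsilon>/6)"
        using transfer[OF O'(1) w e6] by blast
      have "W \<inter> T i \<noteq> {}" using W O' V by (intro dense_open_meets) auto
      then obtain y where y: "y \<in> W" "y \<in> T i" by blast
      have "\<bar>f y - f w\<bar> < 3 * (\<epsilon>/6)" "\<bar>f y - f z\<bar> < 3 * (\<epsilon>/6)" using y W O' by auto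
      then show ?thesis by linarith
    qed
    then show "\<exists>V. openin X V \<and> V \<noteq> {} \<and> V \<subseteq> U \<and> (\<forall>x\<in>V. \<bar>f x - f z\<bar> < \<epsilon>)"
      using O' by (intro exI[of _ O']) auto
  qed
  define G where "G = \<Union>{V. openin X V \<and> (\<exists>i. V \<subseteq> X closure_of T i)}"
  have G: "openin X G" by (auto simp: G_def)
  define S where "S = topspace X - {x \<in> topspace X. quasi_continuous_at X f x}"
  have "S \<subseteq> topspace X - G" using inside by (auto simp: S_def G_def)
  then have "X closure_of S \<subseteq> topspace X - G"
    using G by (intro closure_of_minimal) auto
  have "W = {}" if W: "openin X W" "W \<subseteq> X closure_of S" for W
  proof (rule ccontr)
    assume "W \<noteq> {}"
    then obtain i V where V: "openin X V" "V \<noteq> {}" "V \<subseteq> W" "V \<subseteq> X closure_of T i"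
      using Baire_space_cover[OF X cover W(1)] by blast
    then have "V \<subseteq> G" unfolding G_def by blast
    then show False using V W(2) \<open>X closure_of S \<subseteq> topspace X - G\<close> by blast
  qed
  then have "nowhere_dense_in X S"
    by (auto simp: nowhere_dense_in_def interior_of_eq_empty S_def)
  then show "f \<in> PWD0 X" by (simp add: PWD0_def S_def)
qed

section \<open>The Baire property\<close>

lemma nowhere_dense_in_subset:
  assumes "nowhere_dense_in X T" "S \<subseteq> T"
  shows "nowhere_dense_in X S"
  using assms interior_of_mono[OF closure_of_mono[OF assms(2), of X], of X]
  by (auto simp: nowhere_dense_in_def)

lemma meager_in_subset:
  assumes "meager_in X T" "S \<subseteq> T"
  shows "meager_in X S"
proof -
  obtain N where N: "\<And>n::nat. nowhere_dense_in X (N n)" "T = (\<Union>n. N n)" using assms(1) by (auto simp: meager_in_def)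
  have "nowhere_dense_in X (N n \<inter> S)" for n by (rule nowhere_dense_in_subset[OF N(1)]) blast
  moreover have "S = (\<Union>n. N n \<inter> S)" using N(2) assms(2) by blast
  ultimately show ?thesis unfolding meager_in_def by (intro exI[of _ "\<lambda>n. N n \<inter> S"]) simp
qed

lemma meager_in_UN:
  assumes "\<And>n::nat. meager_in X (T n)"
  shows "meager_in X (\<Union>n. T n)"
proof -
  obtain N where N: "\<And>n i. nowhere_dense_in X (N n (i::nat))" "\<And>n. T n = (\<Union>i. N n i)"
    using assms unfolding meager_in_def by metis
  have "(\<Union>n. T n) = (\<Union>k. case_prod N (prod_decode k))"
  proof (intro subset_antisym subsetI)
    fix x assume "x \<in> (\<Union>n. T n)"
    then obtain n i where "x \<in> N n i" using N(2) by blast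
    then have "x \<in> case_prod N (prod_decode (prod_encode (n, i)))" by simp
    then show "x \<in> (\<Union>k. case_prod N (prod_decode k))" by (rule UN_I[OF UNIV_I])
  next
    fix x assume "x \<in> (\<Union>k. case_prod N (prod_decode k))"
    then obtain k where "x \<in> case_prod N (prod_decode k)" by (rule UN_E)
    then have "x \<in> N (fst (prod_decode k)) (snd (prod_decode k))" by (simp add: case_prod_beta)
    then show "x \<in> (\<Union>n. T n)" using N(2) by blast
  qed
  moreover have "nowhere_dense_in X (case_prod N (prod_decode k))" for k using N(1) by (simp split: prod.split)
  ultimately show ?thesis unfolding meager_in_def
    by (intro exI[of _ "\<lambda>k. case_prod N (prod_decode k)"]) simp
qed

lemma nowhere_dense_meager: "nowhere_dense_in X S \<Longrightarrow> meager_in X S"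
  unfolding meager_in_def by (intro exI[of _ "\<lambda>_. S"]) simp

text \<open>A non-empty open subset of the closure of \<open>U\<close> meets
  \<open>U\<close>.\<close>

lemma nowhere_dense_frontier:
  assumes U: "openin X U"
  shows "nowhere_dense_in X (X closure_of U - U)"
proof -
  have "closedin X (X closure_of U - U)" using U by auto
  moreover have "W = {}" if "openin X W" "W \<subseteq> X closure_of U - U" for W
    using dense_open_meets[of X W U] that by blast
  ultimately show ?thesis
    using closedin_subset[of X "X closure_of U - U"]
    by (auto simp: nowhere_dense_in_def interior_of_eq_empty closure_of_closedin)
qed

lemma has_Baire_propertyI:
  assumes "S \<subseteq> topspace X" "openin X U" "meager_in X T" "(S - U) \<union> (U - S) \<subseteq> T"
  shows "has_Baire_property X S"
  unfolding has_Baire_property_def using assms(1,2) meager_in_subset[OF assms(3,4)] by blast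

text \<open>Complements are the delicate case: the closed complement of \<open>U\<close> is replaced
  by its interior, at the price of the nowhere dense frontier of \<open>U\<close>.\<close>

lemma sigma_algebra_Baire_property: "sigma_algebra (topspace X) {S. has_Baire_property X S}"
  unfolding sigma_algebra_iff2
proof (intro conjI ballI allI impI)
  show "{S. has_Baire_property X S} \<subseteq> Pow (topspace X)" by (auto simp: has_Baire_property_def)
  have "nowhere_dense_in X {}" by (simp add: nowhere_dense_in_def)
  then show "{} \<in> {S. has_Baire_property X S}"
    by (auto intro!: has_Baire_propertyI[of "{}" X "{}" "{}"] nowhere_dense_meager)
  show "topspace X - S \<in> {S. has_Baire_property X S}" if S: "S \<in> {S. has_Baire_property X S}" for S
  proof -
    obtain U where U: "openin X U" "meager_in X ((S - U) \<union> (U - S))" using S by (auto simp: has_Baire_property_def)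
    define T where "T n = (if n = 0 then (S - U) \<union> (U - S) else X closure_of U - U)" for n :: nat
    have "meager_in X (\<Union>n. T n)"
      using U(2) nowhere_dense_meager[OF nowhere_dense_frontier[OF U(1)]] by (intro meager_in_UN) (simp add: T_def)
    moreover have "T 0 \<union> T 1 \<subseteq> (\<Union>n. T n)" by blast
    ultimately have "meager_in X (T 0 \<union> T 1)" by (rule meager_in_subset)
    moreover have "U \<subseteq> X closure_of U" by (rule closure_of_subset[OF openin_subset[OF U(1)]])
    then have "(topspace X - S - (topspace X - X closure_of U)) \<union> (topspace X - X closure_of U - (topspace X - S)) \<subseteq> T 0 \<union> T 1"
      by (auto simp: T_def)
    ultimately have "has_Baire_property X (topspace X - S)"
      by (intro has_Baire_propertyI[of _ _ "topspace X - X closure_of U"]) auto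
    then show ?thesis by simp
  qed
  show "(\<Union>i. S i) \<in> {S. has_Baire_property X S}" if S: "range S \<subseteq> {S. has_Baire_property X S}" for S :: "nat \<Rightarrow> 'a set"
  proof -
    have S': "has_Baire_property X (S n)" for n using S by blast
    then have "\<exists>U. openin X U \<and> meager_in X ((S n - U) \<union> (U - S n))" for n by (simp add: has_Baire_property_def)
    then obtain U where U: "\<And>n. openin X (U n)" "\<And>n. meager_in X ((S n - U n) \<union> (U n - S n))" by metis
    have "has_Baire_property X (\<Union>n. S n)"
    proof (rule has_Baire_propertyI)
      show "(\<Union>n. S n) \<subseteq> topspace X" using S' by (auto simp: has_Baire_property_def)
      show "openin X (\<Union>n. U n)" using U(1) by blast
      show "meager_in X (\<Union>n. (S n - U n) \<union> (U n - S n))" by (rule meager_in_UN[OF U(2)])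
    qed blast
    then show ?thesis by simp
  qed
qed

definition Baire_algebra :: "'a topology \<Rightarrow> 'a measure" where
  "Baire_algebra X = sigma (topspace X) {S. has_Baire_property X S}"

lemma space_Baire_algebra [simp]: "space (Baire_algebra X) = topspace X"
  unfolding Baire_algebra_def by (rule space_measure_of) (auto simp: has_Baire_property_def)

lemma sets_Baire_algebra: "sets (Baire_algebra X) = {S. has_Baire_property X S}"
  unfolding Baire_algebra_def by (rule sigma_algebra.sets_measure_of_eq[OF sigma_algebra_Baire_property])

lemma Baire_functions_eq: "Baire_functions X = borel_measurable (Baire_algebra X)"
proof (rule set_eqI)
  fix f :: "'a \<Rightarrow> real"
  have eq: "f -` U \<inter> topspace X = {x \<in> topspace X. f x \<in> U}" for U by auto
  show "f \<in> Baire_functions X \<longleftrightarrow> f \<in> borel_measurable (Baire_algebra X)"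
  proof
    assume "f \<in> Baire_functions X"
    then show "f \<in> borel_measurable (Baire_algebra X)"
      by (intro borel_measurableI) (simp add: eq sets_Baire_algebra Baire_functions_def)
  next
    assume f: "f \<in> borel_measurable (Baire_algebra X)"
    have "has_Baire_property X {x \<in> topspace X. f x \<in> U}" if "open U" for U
      using measurable_sets[OF f borel_open[OF that]] by (simp add: eq sets_Baire_algebra)
    then show "f \<in> Baire_functions X" by (simp add: Baire_functions_def)
  qed
qed

text \<open>Quasi-continuity puts the preimage of an open set into the closure of its own interior,
  so it differs from an open set by part of a frontier.\<close>

lemma QC_subset_Baire_functions: "QC X \<subseteq> Baire_functions X"
proof
  fix f assume f: "f \<in> QC X"
  have "has_Baire_property X {x \<in> topspace X. f x \<in> V}" if V: "open V" for V
  proof -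
    define S where "S = {x \<in> topspace X. f x \<in> V}"
    define U where "U = X interior_of S"
    have "S \<subseteq> X closure_of U"
    proof
      fix x assume x: "x \<in> S"
      then have "f x \<in> V" by (simp add: S_def)
      then obtain r where r: "r > 0" "ball (f x) r \<subseteq> V" using V open_contains_ball by blast
      have "W \<inter> U \<noteq> {}" if W: "openin X W" "x \<in> W" for W
      proof -
        have "quasi_continuous_at X f x" using f x by (simp add: QC_def S_def)
        from this[unfolded quasi_continuous_at_def, rule_format, OF r(1) conjI[OF W]]
        obtain W' where W': "openin X W'" "W' \<noteq> {}" "W' \<subseteq> W" "\<forall>y\<in>W'. \<bar>f y - f x\<bar> < r" by blast
        have "W' \<subseteq> S"
        proof
          fix y assume y: "y \<in> W'"
          then have "\<bar>f y - f x\<bar> < r" using W'(4) by blast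
          then have "f y \<in> ball (f x) r" by (simp add: dist_real_def abs_minus_commute)
          then show "y \<in> S" using r(2) y openin_subset[OF W'(1)] by (auto simp: S_def)
        qed
        then have "W' \<subseteq> U" using W'(1) by (simp add: U_def interior_of_maximal)
        then show ?thesis using W' by blast
      qed
      then show "x \<in> X closure_of U" using x by (auto simp: closure_of_meets_iff S_def)
    qed
    moreover have "openin X U" "U \<subseteq> S" by (auto simp: U_def interior_of_subset)
    ultimately have "has_Baire_property X S"
      by (intro has_Baire_propertyI[of S X U "X closure_of U - U"] nowhere_dense_meager nowhere_dense_frontier)
        (auto simp: S_def)
    then show ?thesis by (simp add: S_def)
  qed
  then show "f \<in> Baire_functions X" by (simp add: Baire_functions_def)
qed

text \<open>Makes a map into \<open>nat \<Rightarrow> bool\<close> Borel as soon as its coordinates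
  are.\<close>

instance bool :: second_countable_topology
proof
  have "(open :: bool set \<Rightarrow> bool) = generate_topology UNIV"
    by (rule ext) (simp add: open_discrete generate_topology.Basis)
  then show "\<exists>B :: bool set set. countable B \<and> open = generate_topology B"
    by (intro exI[of _ UNIV]) (simp add: countable_finite)
qed

lemma measurable_bool_borel:
  assumes "{x \<in> space M. P x} \<in> sets M"
  shows "P \<in> M \<rightarrow>\<^sub>M (borel :: bool measure)"
proof (rule borel_measurableI)
  fix S :: "bool set"
  have eq: "P -` S \<inter> space M = (if True \<in> S then {x \<in> space M. P x} else {}) \<union>
      (if False \<in> S then space M - {x \<in> space M. P x} else {})"
  proof (rule set_eqI)
    show "x \<in> P -` S \<inter> space M \<longleftrightarrow> x \<in> (if True \<in> S then {x \<in> space M. P x} else {}) \<union>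
      (if False \<in> S then space M - {x \<in> space M. P x} else {})" for x
      by (cases "P x") simp_all
  qed
  have "(if True \<in> S then {x \<in> space M. P x} else {}) \<in> sets M"
    "(if False \<in> S then space M - {x \<in> space M. P x} else {}) \<in> sets M"
    using assms sets.compl_sets[OF assms] sets.empty_sets[of M] by (simp_all split: if_split)
  then show "P -` S \<inter> space M \<in> sets M" unfolding eq by (rule sets.Un)
qed

text \<open>\<open>f x < a\<close> holds iff, for some \<open>j\<close>, the indices outside
  \<open>A j\<close> with \<open>a - \<delta> j \<le> F n x\<close> form a set in \<open>I\<close>.
  For the converse, non-orthogonality yields an index outside this set, the error set and
  \<open>A j\<close>. The criterion is a preimage of the Borel set of characteristic functions of
  \<open>I\<close> under a map with measurable coordinates.\<close>

lemma equal_limits_subset_Baire_functions: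
  assumes I: "ideal_on_nat I" and orth: "\<not> orthogonal_ideals I J" and borel: "borel_family I"
  shows "equal_limits_QC I J X \<subseteq> Baire_functions X"
proof
  fix f assume "f \<in> equal_limits_QC I J X"
  from equal_limitsD[OF this] obtain F e where F: "\<And>n. F n \<in> QC X" and e: "\<And>n. e n > 0" "ideal_null_seq J e"
    and bad: "\<And>x. x \<in> topspace X \<Longrightarrow> {n. e n \<le> \<bar>F n x - f x\<bar>} \<in> I" by blast
  let ?M = "Baire_algebra X"
  have F_meas: "F n \<in> borel_measurable ?M" for n
    using F[of n] QC_subset_Baire_functions[of X] by (auto simp: Baire_functions_eq)
  define \<delta> where "\<delta> j = inverse (real (Suc j))" for j
  define A where "A j = {n. \<delta> j \<le> \<bar>e n\<bar>}" for j
  have A: "A j \<in> J" for j using e(2) by (simp add: ideal_null_seq_def A_def \<delta>_def)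
  
  have "{x \<in> topspace X. f x < a} \<in> sets ?M" for a
  proof -
    define H where "H j x = {n. n \<notin> A j \<and> a - \<delta> j \<le> F n x}" for j x
    have meas: "{x \<in> topspace X. H j x \<in> I} \<in> sets ?M" for j
    proof -
      have "(\<lambda>x. n \<in> H j x) \<in> ?M \<rightarrow>\<^sub>M borel" for n
      proof (rule measurable_bool_borel)
        have "{x \<in> space ?M. a - \<delta> j \<le> F n x} \<in> sets ?M"
          using F_meas[of n] unfolding borel_measurable_iff_ge by blast
        then show "{x \<in> space ?M. n \<in> H j x} \<in> sets ?M"
          by (cases "n \<in> A j") (simp_all add: H_def)
      qed
      then have "(\<lambda>x n. n \<in> H j x) \<in> ?M \<rightarrow>\<^sub>M borel" by (rule measurable_coordinatewise_then_product)
      then have "(\<lambda>x n. n \<in> H j x) -` char_functions I \<inter> space ?M \<in> sets ?M"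
        using borel unfolding borel_family_def by (rule measurable_sets)
      moreover have "(\<lambda>x n. n \<in> H j x) -` char_functions I \<inter> space ?M = {x \<in> topspace X. H j x \<in> I}"
        using char_functions_mem_iff[of _ I] by auto
      ultimately show ?thesis by simp
    qed
    have "f x < a \<longleftrightarrow> (\<exists>j. H j x \<in> I)" if x: "x \<in> topspace X" for x
    proof
      assume "f x < a"
      \<comment> \<open>With half the gap, \<open>a - \<delta> j\<close> exceeds \<open>f x\<close>
        by more than \<open>\<delta> j\<close>, which in turn exceeds \<open>e n\<close>.\<close>
      then obtain j where j: "\<delta> j < (a - f x)/2" unfolding \<delta>_def using reals_Archimedean[of "(a - f x)/2"] by auto
      have "H j x \<subseteq> {n. e n \<le> \<bar>F n x - f x\<bar>}"
      proof
        fix n assume "n \<in> H j x"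
        then have "e n < \<delta> j" "a - \<delta> j \<le> F n x" using e(1)[of n] by (auto simp: H_def A_def)
        then have "e n \<le> \<bar>F n x - f x\<bar>" using j by (simp add: field_simps)
        then show "n \<in> {n. e n \<le> \<bar>F n x - f x\<bar>}" by simp
      qed
      then show "\<exists>j. H j x \<in> I" using ideal_on_natD(2)[OF I bad[OF x]] by blast
    next
      assume "\<exists>j. H j x \<in> I"
      then obtain j where "H j x \<in> I" ..
      then have "H j x \<union> {n. e n \<le> \<bar>F n x - f x\<bar>} \<in> I" using ideal_on_natD(1)[OF I] bad[OF x] by blast
      then have "H j x \<union> {n. e n \<le> \<bar>F n x - f x\<bar>} \<union> A j \<noteq> UNIV"
        using orth A unfolding orthogonal_ideals_def by blast
      then obtain n where "n \<notin> H j x \<union> {n. e n \<le> \<bar>F n x - f x\<bar>} \<union> A j" by blast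
      then have "n \<notin> H j x" "n \<notin> A j" "\<bar>F n x - f x\<bar> < e n" by auto
      then have "F n x < a - \<delta> j" "\<bar>F n x - f x\<bar> < \<delta> j" using e(1)[of n] by (auto simp: H_def A_def)
      then show "f x < a" by linarith
    qed
    then have "{x \<in> topspace X. f x < a} = (\<Union>j. {x \<in> topspace X. H j x \<in> I})" by auto
    then show ?thesis using meas by auto
  qed
  then show "f \<in> Baire_functions X" by (simp add: Baire_functions_eq borel_measurable_iff_less)
qed

section \<open>The trichotomy and its converse\<close>

lemma first_q_type_limits:
  fixes m :: "'b metric"
  assumes "ideal_on_nat I" "ideal_on_nat J" "first_q_type I J" "Baire_space (mtopology_of m)"
  shows "equal_limits_QC I J (mtopology_of m) = PWD0 (mtopology_of m)"
proof
  show "equal_limits_QC I J (mtopology_of m) \<subseteq> PWD0 (mtopology_of m)"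
    using assms equal_limits_subset_PWD0 by blast
  show "PWD0 (mtopology_of m) \<subseteq> equal_limits_QC I J (mtopology_of m)"
    using Metric_space.PWD0_subset_equal_limits[OF Metric_space_mspace_mdist assms(1,2)]
    unfolding mtopology_of_def .
qed

lemma second_q_type_limits:
  fixes m :: "'b metric"
  assumes "ideal_on_nat I" "ideal_on_nat J" "second_q_type I J" "Baire_space (mtopology_of m)"
  shows "equal_limits_QC I J (mtopology_of m) = PWD (mtopology_of m)"
proof
  show "equal_limits_QC I J (mtopology_of m) \<subseteq> PWD (mtopology_of m)"
    using assms equal_limits_subset_PWD unfolding second_q_type_def by blast
  obtain A where "\<And>n. A n \<in> J" "\<not> weakly_Ramsey (ideal_join_seq I A)"
    using assms(3) unfolding second_q_type_def by blast
  then show "PWD (mtopology_of m) \<subseteq> equal_limits_QC I J (mtopology_of m)"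
    using Metric_space.PWD_subset_equal_limits[OF Metric_space_mspace_mdist assms(1,2)]
    unfolding mtopology_of_def by blast
qed

lemma third_q_type_limits:
  fixes m :: "'b metric"
  assumes "ideal_on_nat I" "ideal_on_nat J" "third_q_type I J" "Baire_space (mtopology_of m)"
  shows "Baire_functions (mtopology_of m) \<subseteq> equal_limits_QC I J (mtopology_of m)"
proof -
  obtain A where "A \<in> J" "\<not> weakly_Ramsey (ideal_join I A)"
    using assms(3) unfolding third_q_type_def by blast
  then show ?thesis
    using Metric_space.Baire_subset_equal_limits[OF Metric_space_mspace_mdist assms(1,2)] assms(4)
    unfolding mtopology_of_def by blast
qed

text \<open>Without the third type, the dichotomy for constant sequences makes all joins with one
  set diagonalizable; without the first, it yields a sequence whose join is not weakly Ramsey.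
  Together these are the second type.\<close>

lemma q_type_trichotomy:
  assumes I: "ideal_on_nat I" and co: "coanalytic_family I"
  shows "first_q_type I J \<or> second_q_type I J \<or> third_q_type I J"
proof -
  have "third_q_type I J" if "A \<in> J" "\<not> omega_plus_diagonalizable (ideal_join I A)" for A
    using coanalytic_dichotomy[OF I co, of "\<lambda>_. A"] that
    unfolding third_q_type_def ideal_join_eq_seq[OF I] by blast
  moreover have "\<exists>A. (\<forall>n. A n \<in> J) \<and> \<not> weakly_Ramsey (ideal_join_seq I A)" if "\<not> first_q_type I J"
    using coanalytic_dichotomy[OF I co] that unfolding first_q_type_def by blast
  ultimately show ?thesis unfolding second_q_type_def by blast
qed

section \<open>Separating the function classes on the real line\<close>

lemma Baire_space_real: "Baire_space euclideanreal"
  unfolding Baire_space_def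
proof (intro allI impI)
  fix G :: "nat \<Rightarrow> real set"
  assume G: "\<forall>n. openin euclideanreal (G n) \<and> euclideanreal closure_of G n = topspace euclideanreal"
  have "Met_TC.mtopology closure_of \<Inter> (range G) = (UNIV :: real set)"
    using G by (intro Met_TC.metric_Baire_category) (auto simp: complete_UNIV)
  then show "euclideanreal closure_of (\<Inter>n. G n) = topspace euclideanreal" by simp
qed

definition Dirichlet :: "real \<Rightarrow> real" where
  "Dirichlet = indicator \<rat>"

text \<open>The place of a rational number in an enumeration replaces its denominator; at most
  finitely many points still have a value above any given positive bound.\<close>

definition Thomae :: "real \<Rightarrow> real" where
  "Thomae x = (if x \<in> \<rat> then inverse (real (Suc (to_nat_on \<rat> x))) else 0)"

lemma open_contains_rational:
  fixes U :: "real set"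
  assumes "open U" "U \<noteq> {}"
  shows "\<exists>x\<in>U. x \<in> \<rat>"
proof -
  obtain a where "a \<in> U" using assms(2) by blast
  then obtain r where r: "r > 0" "ball a r \<subseteq> U" using assms(1) open_contains_ball by blast
  have "a < a + r" using r(1) by simp
  then obtain x where "x \<in> \<rat>" "a < x" "x < a + r" using Rats_dense_in_real by blast
  then have "x \<in> ball a r" by (simp add: dist_real_def)
  then show ?thesis using r(2) \<open>x \<in> \<rat>\<close> by blast
qed

lemma open_contains_irrational:
  fixes U :: "real set"
  assumes "open U" "U \<noteq> {}"
  shows "\<exists>x\<in>U. x \<notin> \<rat>"
  using open_minus_countable[OF countable_rat assms(2,1)] by blast

lemma Dirichlet_not_PWD: "Dirichlet \<notin> PWD euclideanreal"
proof
  assume "Dirichlet \<in> PWD euclideanreal"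
  then have "euclideanreal closure_of {x. topcontinuous_at euclideanreal euclideanreal Dirichlet x} = UNIV"
    by (simp add: PWD_def)
  then have "{x. topcontinuous_at euclideanreal euclideanreal Dirichlet x} \<noteq> {}"
    by (metis closure_of_empty UNIV_not_empty)
  then obtain x where "topcontinuous_at euclideanreal euclideanreal Dirichlet x" by blast
  from continuity_point_small_oscillation[OF this, of 1] obtain U
    where U: "open U" "x \<in> U" "\<forall>y\<in>U. \<forall>z\<in>U. \<bar>Dirichlet y - Dirichlet z\<bar> < 1" by auto
  obtain y z where "y \<in> U" "y \<in> \<rat>" "z \<in> U" "z \<notin> \<rat>"
    using open_contains_rational[of U] open_contains_irrational[of U] U by blast
  moreover from this have "\<bar>Dirichlet y - Dirichlet z\<bar> < 1" using U(3) by blast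
  ultimately have "\<bar>Dirichlet y - Dirichlet z\<bar> < 1" "Dirichlet y = 1" "Dirichlet z = 0"
    by (simp_all add: Dirichlet_def)
  then show False by simp
qed

text \<open>Both 0 and 1 occur on every non-empty open set, and no number is at distance less than
  1/2 from both.\<close>

lemma Dirichlet_not_PWD0: "Dirichlet \<notin> PWD0 euclideanreal"
proof
  assume "Dirichlet \<in> PWD0 euclideanreal"
  moreover have "\<not> quasi_continuous_at euclideanreal Dirichlet x" for x
  proof
    assume "quasi_continuous_at euclideanreal Dirichlet x"
    from this[unfolded quasi_continuous_at_def, rule_format, of "1/2" UNIV]
    obtain V where V: "open V" "V \<noteq> {}" "\<forall>y\<in>V. \<bar>Dirichlet y - Dirichlet x\<bar> < 1/2" by auto
    obtain y z where "y \<in> V" "y \<in> \<rat>" "z \<in> V" "z \<notin> \<rat>"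
      using open_contains_rational[OF V(1,2)] open_contains_irrational[OF V(1,2)] by blast
    then have "\<bar>Dirichlet y - Dirichlet x\<bar> < 1/2" "\<bar>Dirichlet z - Dirichlet x\<bar> < 1/2"
      "Dirichlet y = 1" "Dirichlet z = 0"
      using V(3) by (auto simp: Dirichlet_def)
    then show False by linarith
  qed
  then have "{x. quasi_continuous_at euclideanreal Dirichlet x} = {}" by blast
  ultimately show False by (simp add: PWD0_def nowhere_dense_in_def)
qed

lemma Dirichlet_Baire: "Dirichlet \<in> Baire_functions euclideanreal"
proof -
  have "nowhere_dense_in euclideanreal {x}" for x :: real
    by (simp add: nowhere_dense_in_def)
  then have "meager_in euclideanreal (\<Union>n. {from_nat_into \<rat> n} :: real set)"
    by (intro meager_in_UN nowhere_dense_meager)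
  moreover have "(\<rat> :: real set) \<subseteq> (\<Union>n. {from_nat_into \<rat> n})"
    using from_nat_into_surj[OF countable_rat] by blast
  ultimately have "has_Baire_property euclideanreal (\<rat> :: real set)"
    by (intro has_Baire_propertyI[of _ _ "{}"]) auto
  then have "(\<rat> :: real set) \<in> sets (Baire_algebra euclideanreal)" by (simp add: sets_Baire_algebra)
  then show ?thesis unfolding Dirichlet_def Baire_functions_eq by (rule borel_measurable_indicator)
qed

lemma Thomae_PWD: "Thomae \<in> PWD euclideanreal"
proof -
  have cont: "topcontinuous_at euclideanreal euclideanreal Thomae x" if x: "x \<notin> \<rat>" for x
  proof -
    have "\<exists>U. open U \<and> x \<in> U \<and> (\<forall>y\<in>U. Thomae y \<in> V)" if V: "open V" "Thomae x \<in> V" for V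
    proof -
      obtain r where r: "r > 0" "ball (Thomae x) r \<subseteq> V" using V open_contains_ball by blast
      obtain k where k: "inverse (real (Suc k)) < r" using reals_Archimedean[OF r(1)] by blast
      define S where "S = {y \<in> (\<rat> :: real set). to_nat_on \<rat> y < k}"
      have "finite (to_nat_on \<rat> ` S)" by (rule finite_subset[of _ "{..<k}"]) (auto simp: S_def)
      moreover have "inj_on (to_nat_on \<rat>) S"
        using inj_on_to_nat_on[OF countable_rat] by (rule inj_on_subset) (auto simp: S_def)
      ultimately have "finite S" by (rule finite_imageD)
      have "Thomae y \<in> V" if "y \<notin> S" for y
      proof -
        have "Thomae y < r"
        proof (cases "y \<in> \<rat>")
          case True
          then have "inverse (real (Suc (to_nat_on \<rat> y))) \<le> inverse (real (Suc k))"
            using that by (simp add: S_def)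
          then have "inverse (real (Suc (to_nat_on \<rat> y))) < r" using k by linarith
          then show ?thesis using True by (simp add: Thomae_def)
        qed (simp add: Thomae_def r)
        moreover have "0 \<le> Thomae y" "Thomae x = 0" using x by (auto simp: Thomae_def)
        ultimately have "Thomae y \<in> ball (Thomae x) r" by (simp add: dist_real_def)
        then show ?thesis using r(2) by blast
      qed
      then show ?thesis using x finite_imp_closed[OF \<open>finite S\<close>]
        by (intro exI[of _ "- S"]) (auto simp: S_def)
    qed
    then show ?thesis by (simp add: topcontinuous_at_def)
  qed
  have "x \<in> euclideanreal closure_of {x. topcontinuous_at euclideanreal euclideanreal Thomae x}" for x
    unfolding closure_of_meets_iff using cont open_contains_irrational by fastforce
  then show ?thesis by (auto simp: PWD_def)
qed

text \<open>Zeros occur in every non-empty open set, so quasi-continuity fails at each rational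
  point, where the value is positive; these points are dense.\<close>

lemma Thomae_not_PWD0: "Thomae \<notin> PWD0 euclideanreal"
proof
  assume T: "Thomae \<in> PWD0 euclideanreal"
  have "\<not> quasi_continuous_at euclideanreal Thomae x" if x: "x \<in> \<rat>" for x
  proof
    have pos: "Thomae x > 0" using x by (simp add: Thomae_def)
    assume "quasi_continuous_at euclideanreal Thomae x"
    from this[unfolded quasi_continuous_at_def, rule_format, OF pos, of UNIV]
    obtain V where V: "open V" "V \<noteq> {}" "\<forall>y\<in>V. \<bar>Thomae y - Thomae x\<bar> < Thomae x" by auto
    obtain z where "z \<in> V" "z \<notin> \<rat>" using open_contains_irrational[OF V(1,2)] by blast
    then have "\<bar>Thomae z - Thomae x\<bar> < Thomae x" "Thomae z = 0" using V(3) by (auto simp: Thomae_def)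
    then show False by linarith
  qed
  then have sub: "\<rat> \<subseteq> UNIV - {x. quasi_continuous_at euclideanreal Thomae x}" by blast
  have "x \<in> euclideanreal closure_of \<rat>" for x
    unfolding closure_of_meets_iff using open_contains_rational by fastforce
  then have "euclideanreal closure_of (UNIV - {x. quasi_continuous_at euclideanreal Thomae x}) = UNIV"
    using closure_of_mono[OF sub, of euclideanreal] by blast
  then show False using T by (simp add: PWD0_def nowhere_dense_in_def)
qed

theorem theorem4p21:
  fixes I J :: "nat set set"
  assumes "ideal_on_nat I" and "ideal_on_nat J"
    and "\<not> orthogonal_ideals I J"
    and "coanalytic_family I"
  shows
    "(first_q_type I J \<longleftrightarrow>
        (\<forall>m :: 'a metric. Baire_space (mtopology_of m) \<longrightarrow>
           equal_limits_QC I J (mtopology_of m) = PWD0 (mtopology_of m)) \<and>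
        (\<forall>m :: real metric. Baire_space (mtopology_of m) \<longrightarrow>
           equal_limits_QC I J (mtopology_of m) = PWD0 (mtopology_of m)))
     \<and>
     (second_q_type I J \<longleftrightarrow>
        (\<forall>m :: 'a metric. Baire_space (mtopology_of m) \<longrightarrow>
           equal_limits_QC I J (mtopology_of m) = PWD (mtopology_of m)) \<and>
        (\<forall>m :: real metric. Baire_space (mtopology_of m) \<longrightarrow>
           equal_limits_QC I J (mtopology_of m) = PWD (mtopology_of m)))
     \<and>
     (third_q_type I J \<longleftrightarrow>
        (\<forall>m :: 'a metric. Baire_space (mtopology_of m) \<longrightarrow>
           Baire_functions (mtopology_of m) \<subseteq> equal_limits_QC I J (mtopology_of m)) \<and>
        (\<forall>m :: real metric. Baire_space (mtopology_of m) \<longrightarrow>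
           Baire_functions (mtopology_of m) \<subseteq> equal_limits_QC I J (mtopology_of m)))
     \<and>
     (third_q_type I J \<and> borel_family I \<longrightarrow>
        (\<forall>m :: 'a metric. Baire_space (mtopology_of m) \<longrightarrow>
           Baire_functions (mtopology_of m) = equal_limits_QC I J (mtopology_of m)))"
proof -
  note ideals = assms(1,2)
  let ?X = "mtopology_of (euclidean_metric :: real metric)"
  have X: "?X = euclideanreal" "Baire_space ?X" using Baire_space_real by simp_all
  have first: "equal_limits_QC I J ?X = PWD0 ?X" if "first_q_type I J"
    using first_q_type_limits[OF ideals that X(2)] .
  have second: "equal_limits_QC I J ?X = PWD ?X" if "second_q_type I J"
    using second_q_type_limits[OF ideals that X(2)] .
  have third: "Baire_functions ?X \<subseteq> equal_limits_QC I J ?X" if "third_q_type I J"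
    using third_q_type_limits[OF ideals that X(2)] .
  \<comment> \<open>On the line at most one of the three right-hand sides can hold; so each of them
    excludes two types, and the trichotomy leaves the third.\<close>
  have sep: "PWD ?X \<noteq> PWD0 ?X" "\<not> Baire_functions ?X \<subseteq> PWD0 ?X" "\<not> Baire_functions ?X \<subseteq> PWD ?X"
    unfolding X(1) using Dirichlet_not_PWD Dirichlet_not_PWD0 Dirichlet_Baire Thomae_PWD Thomae_not_PWD0
    by blast+
  note tri = q_type_trichotomy[OF assms(1,4), of J]
  show ?thesis
  proof (intro conjI)
    show "first_q_type I J \<longleftrightarrow>
        (\<forall>m :: 'a metric. Baire_space (mtopology_of m) \<longrightarrow>
           equal_limits_QC I J (mtopology_of m) = PWD0 (mtopology_of m)) \<and>
        (\<forall>m :: real metric. Baire_space (mtopology_of m) \<longrightarrow>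
           equal_limits_QC I J (mtopology_of m) = PWD0 (mtopology_of m))" (is "_ \<longleftrightarrow> ?A \<and> ?B")
    proof (intro iffI)
      assume "?A \<and> ?B"
      then have "equal_limits_QC I J ?X = PWD0 ?X" using X(2) by blast
      then show "first_q_type I J" using tri second third sep by metis
    next
      assume "first_q_type I J"
      then show "?A \<and> ?B" by (intro conjI allI impI first_q_type_limits[OF ideals])
    qed
    show "second_q_type I J \<longleftrightarrow>
        (\<forall>m :: 'a metric. Baire_space (mtopology_of m) \<longrightarrow>
           equal_limits_QC I J (mtopology_of m) = PWD (mtopology_of m)) \<and>
        (\<forall>m :: real metric. Baire_space (mtopology_of m) \<longrightarrow>
           equal_limits_QC I J (mtopology_of m) = PWD (mtopology_of m))" (is "_ \<longleftrightarrow> ?A \<and> ?B")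
    proof (intro iffI)
      assume "?A \<and> ?B"
      then have "equal_limits_QC I J ?X = PWD ?X" using X(2) by blast
      then show "second_q_type I J" using tri first third sep by metis
    next
      assume "second_q_type I J"
      then show "?A \<and> ?B" by (intro conjI allI impI second_q_type_limits[OF ideals])
    qed
    show "third_q_type I J \<longleftrightarrow>
        (\<forall>m :: 'a metric. Baire_space (mtopology_of m) \<longrightarrow>
           Baire_functions (mtopology_of m) \<subseteq> equal_limits_QC I J (mtopology_of m)) \<and>
        (\<forall>m :: real metric. Baire_space (mtopology_of m) \<longrightarrow>
           Baire_functions (mtopology_of m) \<subseteq> equal_limits_QC I J (mtopology_of m))" (is "_ \<longleftrightarrow> ?A \<and> ?B")
    proof (intro iffI)
      assume "?A \<and> ?B"
      then have "Baire_functions ?X \<subseteq> equal_limits_QC I J ?X" using X(2) by blast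
      then show "third_q_type I J" using tri first second sep by metis
    next
      assume "third_q_type I J"
      then show "?A \<and> ?B" by (intro conjI allI impI third_q_type_limits[OF ideals])
    qed
    show "third_q_type I J \<and> borel_family I \<longrightarrow>
        (\<forall>m :: 'a metric. Baire_space (mtopology_of m) \<longrightarrow>
           Baire_functions (mtopology_of m) = equal_limits_QC I J (mtopology_of m))"
      using third_q_type_limits[OF ideals] equal_limits_subset_Baire_functions[OF assms(1,3)]
      by (metis subset_antisym)
  qed
qed

end
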